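(* Let $T>0$, $\alpha\in(0,2)$ and $0<\varepsilon_0<1$. There exists a constant $C>0$, depending only on $\varepsilon_0$, $\alpha$ and $T$, such that for all $(u_0,u_1)\in H^1_\alpha\times L^2(0,1)$ and all $f\in L^1(0,T;L^2(0,1))$, if $u$ is the weak solution of problem (P) with data $(f,u_0,u_1)$, then $$\frac{1}{\varepsilon}\int_0^T\int_{1-\varepsilon}^1 x^\alpha|u_x(t,x)|^2\,dx\,dt\le C\Big(\|f\|_{L^1(0,T;L^2(0,1))}^2+\|u_0\|_{H^1_\alpha}^2+\|u_1\|_{L^2(0,1)}^2\Big)\quad\text{for all }\varepsilon\in(0,\varepsilon_0].$$
   Context: Let $T>0$, $\alpha\in(0,2)$, $Q=(0,T)\times(0,1)$. The case $\alpha\in(0,1)$ is the weakly degenerate case (WDC), $\alpha\in[1,2)$ the strongly degenerate case (SDC). In the WDC, $H^1_\alpha$ is the set of $u\in L^2(0,1)$ that are absolutely continuous on $[0,1]$, with $x^{\alpha/2}u_x\in L^2(0,1)$ and $u(0)=u(1)=0$. In the SDC, $H^1_\alpha$ is the set of $u\in L^2(0,1)$ that are locally absolutely continuous on $(0,1]$, with $x^{\alpha/2}u_x\in L^2(0,1)$ and $u(1)=0$. In both cases $\|u\|_{H^1_\alpha}=(\|u\|_{L^2(0,1)}^2+\|x^{\alpha/2}u_x\|_{L^2(0,1)}^2)^{1/2}$. Problem (P): $u_{tt}-(x^\alpha u_x)_x=f$ in $Q$; $u(t,1)=0$ for $t\in(0,T)$; $u(t,0)=0$ if $\alpha\in(0,1)$,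 or $(x^\alpha u_x)(t,0)=0$ if $\alpha\in[1,2)$; $u(0,\cdot)=u_0$, $u_t(0,\cdot)=u_1$. Weak solution: given $f\in L^1(0,T;L^2(0,1))$ and $(u_0,u_1)\in H^1_\alpha\times L^2(0,1)$, a function $u\in C([0,T];H^1_\alpha)\cap C^1([0,T];L^2(0,1))$ is a weak solution of (P) if $u(0,\cdot)=u_0$ and $$\int_Q(-u_t\varphi_t+x^\alpha u_x\varphi_x)\,dx\,dt-\int_0^1u_1\varphi(0,x)\,dx=\int_Q f\varphi\,dx\,dt$$ for all $\varphi\in L^2(0,T;H^1_\alpha)$ with $\varphi_t\in L^2(Q)$ and $\varphi(T,\cdot)=0$. (For such data a weak solution exists, is unique, satisfies $\sup_{t}(\|u_t(t)\|_{L^2}^2+\|u(t)\|_{H^1_\alpha}^2)\le C_{T,\alpha}(\|f\|^2_{L^1(0,T;L^2)}+\|u_0\|^2_{H^1_\alpha}+\|u_1\|^2_{L^2})$, and has $u_x(\cdot,1)\in L^2(0,T)$ with $\int_0^T|u_x(t,1)|^2dt$ bounded by the same type of quantity.) *)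

theory Defs
  imports "HOL-Analysis.Analysis"
begin

definition abs_cont_on :: "real \<Rightarrow> real \<Rightarrow> (real \<Rightarrow> real) \<Rightarrow> bool" where
  "abs_cont_on a b f \<longleftrightarrow>
     (\<forall>e>0. \<exists>d>0. \<forall>(n::nat) (l::nat \<Rightarrow> real) (r::nat \<Rightarrow> real).
        (\<forall>i<n. a \<le> l i \<and> l i \<le> r i \<and> r i \<le> b) \<longrightarrow>
        (\<forall>i<n. \<forall>j<n. i \<noteq> j \<longrightarrow> r i \<le> l j \<or> r j \<le> l i) \<longrightarrow>
        (\<Sum>i<n. r i - l i) < d \<longrightarrow>
        (\<Sum>i<n. \<bar>f (r i) - f (l i)\<bar>) < e)"

definition loc_abs_cont_0_1 :: "(real \<Rightarrow> real) \<Rightarrow> bool" where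
  "loc_abs_cont_0_1 f \<longleftrightarrow> (\<forall>a. 0 < a \<and> a \<le> 1 \<longrightarrow> abs_cont_on a 1 f)"

definition L2_01 :: "(real \<Rightarrow> real) \<Rightarrow> bool" where
  "L2_01 v \<longleftrightarrow> v \<in> borel_measurable (lebesgue_on {0<..<1})
              \<and> integrable (lebesgue_on {0<..<1}) (\<lambda>x. (v x)\<^sup>2)"

definition L2_01_norm2 :: "(real \<Rightarrow> real) \<Rightarrow> real" where
  "L2_01_norm2 v = (LINT x|lebesgue_on {0<..<1}. (v x)\<^sup>2)"

definition H1a_pair :: "real \<Rightarrow> (real \<Rightarrow> real) \<Rightarrow> (real \<Rightarrow> real) \<Rightarrow> bool" where
  "H1a_pair a v w \<longleftrightarrow>
     L2_01 v \<and>
     (if a < 1 then abs_cont_on 0 1 v \<and> v 0 = 0 \<and> v 1 = 0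
      else loc_abs_cont_0_1 v \<and> v 1 = 0) \<and>
     (AE x in lebesgue. x \<in> {0<..<1} \<longrightarrow> (v has_real_derivative w x) (at x)) \<and>
     w \<in> borel_measurable (lebesgue_on {0<..<1}) \<and>
     integrable (lebesgue_on {0<..<1}) (\<lambda>x. x powr a * (w x)\<^sup>2)"

definition H1a_norm2 :: "real \<Rightarrow> (real \<Rightarrow> real) \<Rightarrow> (real \<Rightarrow> real) \<Rightarrow> real" where
  "H1a_norm2 a v w = L2_01_norm2 v + (LINT x|lebesgue_on {0<..<1}. x powr a * (w x)\<^sup>2)"

definition Qset :: "real \<Rightarrow> (real \<times> real) set" where
  "Qset T = {0<..<T} \<times> {0<..<1}"

definition L1L2 :: "real \<Rightarrow> (real \<Rightarrow> real \<Rightarrow> real) \<Rightarrow> bool" where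
  "L1L2 T f \<longleftrightarrow> (\<lambda>(t,x). f t x) \<in> borel_measurable (lebesgue_on (Qset T))
     \<and> (AE t in lebesgue. t \<in> {0<..<T} \<longrightarrow> L2_01 (f t))
     \<and> integrable (lebesgue_on {0<..<T}) (\<lambda>t. sqrt (L2_01_norm2 (f t)))"

definition L1L2_norm :: "real \<Rightarrow> (real \<Rightarrow> real \<Rightarrow> real) \<Rightarrow> real" where
  "L1L2_norm T f = (LINT t|lebesgue_on {0<..<T}. sqrt (L2_01_norm2 (f t)))"

text \<open>Admissible test functions: phi \<in> L^2(0,T;H^1_a) with x-derivative phix, phi_t = phit \<in> L^2(Q),
  phi(T,.) = 0. The time derivative is realized through a representative that is absolutely
  continuous in t on [0,T] for a.e. x, so that phi(0,.) and phi(T,.) are meaningful.\<close>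
definition test_fun :: "real \<Rightarrow> real \<Rightarrow> (real \<Rightarrow> real \<Rightarrow> real) \<Rightarrow> (real \<Rightarrow> real \<Rightarrow> real)
     \<Rightarrow> (real \<Rightarrow> real \<Rightarrow> real) \<Rightarrow> bool" where
  "test_fun a T phi phit phix \<longleftrightarrow>
     (\<lambda>(t,x). phi t x) \<in> borel_measurable (lebesgue_on (Qset T)) \<and>
     (\<lambda>(t,x). phix t x) \<in> borel_measurable (lebesgue_on (Qset T)) \<and>
     (\<lambda>(t,x). phit t x) \<in> borel_measurable (lebesgue_on (Qset T)) \<and>
     (AE t in lebesgue. t \<in> {0<..<T} \<longrightarrow> H1a_pair a (phi t) (phix t)) \<and>
     integrable (lebesgue_on (Qset T)) (\<lambda>(t,x). (phi t x)\<^sup>2 + x powr a * (phix t x)\<^sup>2) \<and>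
     integrable (lebesgue_on (Qset T)) (\<lambda>(t,x). (phit t x)\<^sup>2) \<and>
     (AE x in lebesgue. x \<in> {0<..<1} \<longrightarrow>
        abs_cont_on 0 T (\<lambda>t. phi t x) \<and>
        (AE t in lebesgue. t \<in> {0<..<T} \<longrightarrow> ((\<lambda>s. phi s x) has_real_derivative phit t x) (at t)) \<and>
        phi T x = 0)"

definition weak_solution :: "real \<Rightarrow> real \<Rightarrow> (real \<Rightarrow> real \<Rightarrow> real) \<Rightarrow> (real \<Rightarrow> real)
     \<Rightarrow> (real \<Rightarrow> real) \<Rightarrow> (real \<Rightarrow> real \<Rightarrow> real) \<Rightarrow> (real \<Rightarrow> real \<Rightarrow> real)
     \<Rightarrow> (real \<Rightarrow> real \<Rightarrow> real) \<Rightarrow> bool" where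
  "weak_solution a T f u0 u1 u ut ux \<longleftrightarrow>
     \<comment> \<open>u \<in> C([0,T]; H^1_a) with x-derivative ux\<close>
     (\<forall>t\<in>{0..T}. H1a_pair a (u t) (ux t)) \<and>
     (\<forall>t\<in>{0..T}. ((\<lambda>s. H1a_norm2 a (\<lambda>x. u s x - u t x) (\<lambda>x. ux s x - ux t x)) \<longlongrightarrow> 0)
                  (at t within {0..T})) \<and>
     \<comment> \<open>u \<in> C^1([0,T]; L^2(0,1)) with derivative ut\<close>
     (\<forall>t\<in>{0..T}. L2_01 (ut t)) \<and>
     (\<forall>t\<in>{0..T}. ((\<lambda>s. L2_01_norm2 (\<lambda>x. (u s x - u t x) / (s - t) - ut t x)) \<longlongrightarrow> 0)
                  (at t within {0..T})) \<and>
     (\<forall>t\<in>{0..T}. ((\<lambda>s. L2_01_norm2 (\<lambda>x. ut s x - ut t x)) \<longlongrightarrow> 0) (at t within {0..T})) \<and>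
     \<comment> \<open>jointly measurable representatives of u_t and u_x on Q\<close>
     (\<lambda>(t,x). ut t x) \<in> borel_measurable (lebesgue_on (Qset T)) \<and>
     (\<lambda>(t,x). ux t x) \<in> borel_measurable (lebesgue_on (Qset T)) \<and>
     \<comment> \<open>initial datum\<close>
     (AE x in lebesgue. x \<in> {0<..<1} \<longrightarrow> u 0 x = u0 x) \<and>
     \<comment> \<open>variational identity\<close>
     (\<forall>phi phit phix. test_fun a T phi phit phix \<longrightarrow>
        (LINT p|lebesgue_on (Qset T).
            - ut (fst p) (snd p) * phit (fst p) (snd p)
            + (snd p) powr a * ux (fst p) (snd p) * phix (fst p) (snd p))
        - (LINT x|lebesgue_on {0<..<1}. u1 x * phi 0 x)
        = (LINT p|lebesgue_on (Qset T). f (fst p) (snd p) * phi (fst p) (snd p)))"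

end

(*
  All estimates are extracted from the variational identity alone, by testing with products of a
  cutoff in time and a function of x; this gives the integrated equation
  (u_t(s) - u_1, psi) + (int_0^s x^(a/2) u_x, x^(a/2) psi') = (int_0^s f, psi).
  Its difference quotients in time say that the Steklov average v of u satisfies v_tt - (x^a v_x)_x = g
  with v_t in H^1_a and x^a v_x locally absolutely continuous (du Bois-Reymond). Testing with v_t yields
  the energy estimate. Testing with m v_x, where m is piecewise linear, supported in [c,1], equal to 1 in
  the middle, with slope -1/eps on (1-eps,1) and m(1) = 0, yields the layer estimate: because m vanishes
  at x = 1 no trace of u_x appears there, and -m'/2 produces the factor 1/(2 eps). All constants are
  uniform in the averaging length, which is finally sent to 0.
*)
theory Submission
  imports Defs
begin

section \<open>Absolute continuity and the fundamental theorem of calculus\<close>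

text \<open>In general \<open>ut\<close> does not lie in H^1_a and m u_x is not an admissible test
  function, so neither multiplier applies to u itself. For a time average, v_t is a difference
  quotient of u and hence lies in H^1_a. The source is only integrable in time with values in L^2,
  so its average has no bound uniform in t and h. Its pairings are bounded by increments of the
  primitive F of t -> ||f(t)||; such an increment divided by h is the derivative of a sliding mean
  of F, which is added to the energy and multiplier functionals as a bounded corrector. The
  degeneracy at 0, and with it the difference between the weakly and the strongly degenerate case,
  is kept out of the multiplier argument by m = 0 on [0,c]. With c = (1 - eps0)/2 the inner ramp
  [c,2c] fits for every admissible eps and costs only 1/c. Differentiating the weight adds a term
  with a m / x, whose sign is favourable. Curves in L^2 are treated by scalar calculus: pair with a
  fixed function, then choose the error itself as that function.\<close>

definition ac_modulus :: "real \<Rightarrow> real \<Rightarrow> (real \<Rightarrow> real) \<Rightarrow> real \<Rightarrow> real \<Rightarrow> bool" where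
  "ac_modulus a b f e d \<longleftrightarrow>
     (\<forall>(n::nat) (l::nat \<Rightarrow> real) (r::nat \<Rightarrow> real).
        (\<forall>i<n. a \<le> l i \<and> l i \<le> r i \<and> r i \<le> b) \<longrightarrow>
        (\<forall>i<n. \<forall>j<n. i \<noteq> j \<longrightarrow> r i \<le> l j \<or> r j \<le> l i) \<longrightarrow>
        (\<Sum>i<n. r i - l i) < d \<longrightarrow>
        (\<Sum>i<n. \<bar>f (r i) - f (l i)\<bar>) < e)"

lemma abs_cont_on_iff_modulus: "abs_cont_on a b f \<longleftrightarrow> (\<forall>e>0. \<exists>d>0. ac_modulus a b f e d)"
  unfolding abs_cont_on_def ac_modulus_def ..

lemma ac_modulusI:
  assumes "\<And>(n::nat) l r. \<lbrakk>\<And>i. i < n \<Longrightarrow> a \<le> l i \<and> l i \<le> r i \<and> r i \<le> b;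
      \<And>i j. \<lbrakk>i < n; j < n; i \<noteq> j\<rbrakk> \<Longrightarrow> r i \<le> l j \<or> r j \<le> l i; (\<Sum>i<n. r i - l i) < d\<rbrakk>
      \<Longrightarrow> (\<Sum>i<n. \<bar>f (r i) - f (l i)\<bar>) < e"
  shows "ac_modulus a b f e d"
  unfolding ac_modulus_def
proof (intro allI impI)
  fix n :: nat and l r :: "nat \<Rightarrow> real"
  assume H: "\<forall>i<n. a \<le> l i \<and> l i \<le> r i \<and> r i \<le> b"
      "\<forall>i<n. \<forall>j<n. i \<noteq> j \<longrightarrow> r i \<le> l j \<or> r j \<le> l i" "(\<Sum>i<n. r i - l i) < d"
  show "(\<Sum>i<n. \<bar>f (r i) - f (l i)\<bar>) < e"
    by (rule assms) (use H in blast)+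
qed

text \<open>Enumerating \<open>I\<close> by a bijection frees the condition from sequences; the
  gauge argument below applies it to a set of tagged intervals.\<close>

lemma ac_modulusD:
  assumes "ac_modulus a b f e d" "finite I" "\<And>i. i \<in> I \<Longrightarrow> a \<le> l i \<and> l i \<le> r i \<and> r i \<le> b"
    "\<And>i j. \<lbrakk>i \<in> I; j \<in> I; i \<noteq> j\<rbrakk> \<Longrightarrow> r i \<le> l j \<or> r j \<le> l i" "(\<Sum>i\<in>I. r i - l i) < d"
  shows "(\<Sum>i\<in>I. \<bar>f (r i) - f (l i)\<bar>) < e"
proof -
  obtain g where g: "bij_betw g {..<card I} I"
    using ex_bij_betw_nat_finite[OF assms(2)] by (auto simp: atLeast0LessThan)
  have gI: "g i \<in> I" if "i < card I" for i
    using g that by (auto simp: bij_betw_def)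
  have gne: "g i \<noteq> g j" if "i < card I" "j < card I" "i \<noteq> j" for i j
    using g that by (auto simp: bij_betw_def inj_on_def)
  have s: "(\<Sum>i\<in>I. h i) = (\<Sum>i<card I. h (g i))" for h
    using sum.reindex_bij_betw[OF g, of h] by simp
  have "\<forall>i<card I. a \<le> l (g i) \<and> l (g i) \<le> r (g i) \<and> r (g i) \<le> b"
    using assms(3) gI by blast
  moreover have "\<forall>i<card I. \<forall>j<card I. i \<noteq> j \<longrightarrow> r (g i) \<le> l (g j) \<or> r (g j) \<le> l (g i)"
    using assms(4) gI gne by blast
  moreover have "(\<Sum>i<card I. r (g i) - l (g i)) < d"
    using assms(5) s[of "\<lambda>i. r i - l i"] by simp
  ultimately have "(\<Sum>i<card I. \<bar>f (r (g i)) - f (l (g i))\<bar>) < e"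
    using assms(1)[unfolded ac_modulus_def, rule_format, of "card I" "\<lambda>i. l (g i)" "\<lambda>i. r (g i)"] by blast
  then show ?thesis using s[of "\<lambda>i. \<bar>f (r i) - f (l i)\<bar>"] by simp
qed

lemma abs_cont_on_subset:
  assumes "abs_cont_on a b f" "a \<le> a'" "b' \<le> b"
  shows "abs_cont_on a' b' f"
  unfolding abs_cont_on_iff_modulus
proof (intro allI impI)
  fix e :: real assume "e > 0"
  then obtain d where d: "d > 0" and D: "ac_modulus a b f e d"
    using assms(1) by (auto simp: abs_cont_on_iff_modulus)
  have "ac_modulus a' b' f e d"
  proof (rule ac_modulusI)
    fix n :: nat and l r :: "nat \<Rightarrow> real"
    assume H1: "\<And>i. i < n \<Longrightarrow> a' \<le> l i \<and> l i \<le> r i \<and> r i \<le> b'"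
      and H2: "\<And>i j. \<lbrakk>i < n; j < n; i \<noteq> j\<rbrakk> \<Longrightarrow> r i \<le> l j \<or> r j \<le> l i"
      and H3: "(\<Sum>i<n. r i - l i) < d"
    have "a \<le> l i \<and> l i \<le> r i \<and> r i \<le> b" if "i < n" for i
      using H1[OF that] assms(2,3) by linarith
    then show "(\<Sum>i<n. \<bar>f (r i) - f (l i)\<bar>) < e"
      by (intro ac_modulusD[OF D]) (use H2 H3 in auto)
  qed
  then show "\<exists>d>0. ac_modulus a' b' f e d" using d by blast
qed

lemma abs_cont_on_imp_continuous_on:
  assumes "abs_cont_on a b f"
  shows "continuous_on {a..b} f"
  unfolding continuous_on_iff
proof (intro ballI allI impI)
  fix x e :: real assume x: "x \<in> {a..b}" and "e > 0"
  obtain d where d: "d > 0" and D: "ac_modulus a b f e d"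
    using assms \<open>e > 0\<close> by (auto simp: abs_cont_on_iff_modulus)
  have "dist (f y) (f x) < e" if "y \<in> {a..b}" "dist y x < d" for y
    using ac_modulusD[OF D, of "{()}" "\<lambda>_. min x y" "\<lambda>_. max x y"] x that
    by (cases "x \<le> y") (auto simp: dist_real_def min_def max_def abs_minus_commute)
  then show "\<exists>d>0. \<forall>x'\<in>{a..b}. dist x' x < d \<longrightarrow> dist (f x') (f x) < e"
    using d by blast
qed

text \<open>Common source of the closure properties: sums, differences, products and Lipschitz
  functions all satisfy such an increment bound, the term \<open>y - x\<close> serving the Lipschitz
  case.\<close>

lemma abs_cont_on_dominated:
  assumes f: "abs_cont_on a b f" and g: "abs_cont_on a b g" and "K \<ge> 0"
    and le: "\<And>x y. \<lbrakk>a \<le> x; x \<le> y; y \<le> b\<rbrakk> \<Longrightarrow> \<bar>h y - h x\<bar> \<le> K * (\<bar>f y - f x\<bar> + \<bar>g y - g x\<bar> + (y - x))"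
  shows "abs_cont_on a b h"
  unfolding abs_cont_on_iff_modulus
proof (intro allI impI)
  fix e :: real assume e: "e > 0"
  \<comment> \<open>Three contributions, each at most \<open>e'\<close>, are multiplied by
    \<open>K\<close>. Dividing by \<open>K + 1\<close> covers \<open>K = 0\<close> and leaves the
    strict bound \<open>e * (K / (K + 1)) < e\<close>.\<close>
  define e' where "e' = e / (3 * (K + 1))"
  have e': "e' > 0" using e \<open>K \<ge> 0\<close> by (auto simp: e'_def)
  obtain d1 where d1: "d1 > 0" and D1: "ac_modulus a b f e' d1"
    using f e' by (auto simp: abs_cont_on_iff_modulus)
  obtain d2 where d2: "d2 > 0" and D2: "ac_modulus a b g e' d2"
    using g e' by (auto simp: abs_cont_on_iff_modulus)
  have "ac_modulus a b h e (min e' (min d1 d2))"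
  proof (rule ac_modulusI)
    fix n :: nat and l r :: "nat \<Rightarrow> real"
    assume H1: "\<And>i. i < n \<Longrightarrow> a \<le> l i \<and> l i \<le> r i \<and> r i \<le> b"
      and H2: "\<And>i j. \<lbrakk>i < n; j < n; i \<noteq> j\<rbrakk> \<Longrightarrow> r i \<le> l j \<or> r j \<le> l i"
      and H3: "(\<Sum>i<n. r i - l i) < min e' (min d1 d2)"
    have "(\<Sum>i<n. \<bar>f (r i) - f (l i)\<bar>) < e'" 
      by (rule ac_modulusD[OF D1]) (use H1 H2 H3 in auto)
    moreover have "(\<Sum>i<n. \<bar>g (r i) - g (l i)\<bar>) < e'" 
      by (rule ac_modulusD[OF D2]) (use H1 H2 H3 in auto)
    ultimately have le3: "(\<Sum>i<n. \<bar>f (r i) - f (l i)\<bar>) + (\<Sum>i<n. \<bar>g (r i) - g (l i)\<bar>) + (\<Sum>i<n. r i - l i) \<le> e' + e' + e'"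
      using H3 by linarith
    have "(\<Sum>i<n. \<bar>h (r i) - h (l i)\<bar>) \<le> (\<Sum>i<n. K * (\<bar>f (r i) - f (l i)\<bar> + \<bar>g (r i) - g (l i)\<bar> + (r i - l i)))"
      using H1 le by (intro sum_mono) auto
    also have "\<dots> = K * ((\<Sum>i<n. \<bar>f (r i) - f (l i)\<bar>) + (\<Sum>i<n. \<bar>g (r i) - g (l i)\<bar>) + (\<Sum>i<n. r i - l i))"
      by (simp add: sum_distrib_left[symmetric] sum.distrib)
    also have "\<dots> \<le> K * (e' + e' + e')"
      using le3 \<open>K \<ge> 0\<close> by (rule mult_left_mono)
    also have "\<dots> = e * (K / (K + 1))"
    proof -
      have "3 * e' = e / (K + 1)"
        using \<open>K \<ge> 0\<close> nonzero_mult_div_cancel_left[of 3 "e / (K + 1)"] unfolding e'_def by (simp add: divide_simps)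
      then have "e' + e' + e' = e / (K + 1)" by linarith
      then show ?thesis by simp
    qed
    also have "\<dots> < e"
      using \<open>K \<ge> 0\<close> e by (simp add: field_simps)
    finally show "(\<Sum>i<n. \<bar>h (r i) - h (l i)\<bar>) < e" .
  qed
  then show "\<exists>d>0. ac_modulus a b h e d"
    using e' d1 d2 by (intro exI[of _ "min e' (min d1 d2)"]) auto
qed

lemma abs_cont_on_const: "abs_cont_on a b (\<lambda>x. c)"
  unfolding abs_cont_on_iff_modulus by (intro allI impI exI[of _ 1]) (simp add: ac_modulus_def)

lemma abs_cont_on_lipschitz:
  assumes "\<And>x y. \<lbrakk>a \<le> x; x \<le> y; y \<le> b\<rbrakk> \<Longrightarrow> \<bar>f y - f x\<bar> \<le> K * (y - x)"
  shows "abs_cont_on a b f"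
proof (rule abs_cont_on_dominated[OF abs_cont_on_const abs_cont_on_const, where K="\<bar>K\<bar>"])
  fix x y assume "a \<le> x" "x \<le> y" "y \<le> b"
  then have "\<bar>f y - f x\<bar> \<le> K * (y - x)" "K * (y - x) \<le> \<bar>K\<bar> * (y - x)"
    using assms[of x y] by (auto intro: mult_right_mono)
  then show "\<bar>f y - f x\<bar> \<le> \<bar>K\<bar> * (\<bar>0 - 0\<bar> + \<bar>0 - 0\<bar> + (y - x))"
    by simp
qed auto

lemma abs_cont_on_add:
  assumes "abs_cont_on a b f" "abs_cont_on a b g"
  shows "abs_cont_on a b (\<lambda>x. f x + g x)"
  by (rule abs_cont_on_dominated[OF assms, where K=1]) auto

lemma abs_cont_on_diff:
  assumes "abs_cont_on a b f" "abs_cont_on a b g"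
  shows "abs_cont_on a b (\<lambda>x. f x - g x)"
  by (rule abs_cont_on_dominated[OF assms, where K=1]) auto

lemma abs_cont_on_mult:
  assumes f: "abs_cont_on a b f" and g: "abs_cont_on a b g"
  shows "abs_cont_on a b (\<lambda>x. f x * g x)"
proof -
  have "bounded (f ` {a..b})" "bounded (g ` {a..b})"
    using f g by (auto intro!: compact_imp_bounded compact_continuous_image abs_cont_on_imp_continuous_on)
  then obtain B C where B: "\<And>x. x \<in> {a..b} \<Longrightarrow> \<bar>f x\<bar> \<le> B" and C: "\<And>x. x \<in> {a..b} \<Longrightarrow> \<bar>g x\<bar> \<le> C"
    unfolding bounded_iff by fastforce
  define K where "K = \<bar>B\<bar> + \<bar>C\<bar>"
  show ?thesis
  proof (rule abs_cont_on_dominated[OF f g])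
    show "K \<ge> 0" by (simp add: K_def)
    fix x y assume xy: "a \<le> x" "x \<le> y" "y \<le> b"
    have bnd: "\<bar>f y\<bar> \<le> K" "\<bar>g x\<bar> \<le> K"
      using B[of y] C[of x] xy by (auto simp: K_def)
    have "f y * g y - f x * g x = f y * (g y - g x) + (f y - f x) * g x"
      by (simp add: algebra_simps)
    then have "\<bar>f y * g y - f x * g x\<bar> \<le> \<bar>f y\<bar> * \<bar>g y - g x\<bar> + \<bar>f y - f x\<bar> * \<bar>g x\<bar>"
      using abs_triangle_ineq[of "f y * (g y - g x)" "(f y - f x) * g x"] by (simp add: abs_mult)
    also have "\<dots> \<le> K * \<bar>g y - g x\<bar> + \<bar>f y - f x\<bar> * K"
      using bnd by (intro add_mono mult_right_mono mult_left_mono) auto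
    also have "\<dots> \<le> K * (\<bar>f y - f x\<bar> + \<bar>g y - g x\<bar> + (y - x))"
      using xy \<open>K \<ge> 0\<close> by (simp add: algebra_simps mult_left_mono)
    finally show "\<bar>f y * g y - f x * g x\<bar> \<le> K * (\<bar>f y - f x\<bar> + \<bar>g y - g x\<bar> + (y - x))" .
  qed
qed

section \<open>Fundamental theorem of calculus for absolutely continuous functions\<close>

lemma open_negligible_cover:
  assumes "negligible (N::real set)" "d > 0"
  obtains G where "open G" "N \<subseteq> G" "G \<in> lmeasurable" "measure lebesgue G < d"
proof -
  have N: "N \<in> sets lebesgue" "N \<in> null_sets lebesgue"
    using assms by (auto simp: negligible_iff_null_sets)
  obtain G where G: "open G" "N \<subseteq> G" "G - N \<in> lmeasurable" "emeasure lebesgue (G - N) < ennreal d"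
    using sets_lebesgue_outer_open[OF N(1) assms(2)] by metis
  have "G \<in> sets lebesgue" using G by simp
  then have "emeasure lebesgue G < ennreal d"
    using G(4) N(2) by (simp add: emeasure_Diff_null_set)
  then show ?thesis
  proof (intro that[OF G(1,2)])
    show Gm: "G \<in> lmeasurable"
      using \<open>emeasure lebesgue G < ennreal d\<close> \<open>G \<in> sets lebesgue\<close>
      by (intro fmeasurableI) (auto intro: order_less_trans)
    show "measure lebesgue G < d"
      using \<open>emeasure lebesgue G < ennreal d\<close> Gm
      by (simp add: emeasure_eq_measure2 ennreal_less_iff)
  qed
qed

text \<open>Gauge argument. Intervals tagged outside \<open>N\<close> obey the derivative estimate.
  Intervals tagged in \<open>N\<close> are forced into an open set \<open>G\<close> of measure below
  \<open>d\<close>, so absolute continuity bounds the sum of their increments.\<close>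

theorem fundamental_theorem_of_calculus_abs_cont:
  fixes f :: "real \<Rightarrow> real"
  assumes ac: "abs_cont_on a b f" and ab: "a < b" and N: "negligible N"
    and der: "\<And>x. x \<in> {a..b} - N \<Longrightarrow> (f has_real_derivative f' x) (at x)"
  shows "(f' has_integral (f b - f a)) {a..b}"
proof -
  \<comment> \<open>Setting the integrand to 0 on \<open>N\<close> leaves only the increments of
    \<open>f\<close> to be estimated at those tags; changing it on a null set does not affect the
    integral.\<close>
  define g where "g x = (if x \<in> N then 0 else f' x)" for x
  have "(g has_integral (f b - f a)) (cbox a b)"
    unfolding has_integral
  proof (intro allI impI)
    fix e :: real assume e: "e > 0"
    \<comment> \<open>The good tags cost at most \<open>e1 * (b - a) = e / 2\<close>, the bad ones
      less than the other \<open>e / 2\<close>.\<close>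
    define e1 where "e1 = e / 2 / (b - a)"
    have e1: "e1 > 0" using e ab by (simp add: e1_def)
    obtain d where d: "d > 0" and D: "ac_modulus a b f (e / 2) d"
      using ac e by (metis abs_cont_on_iff_modulus half_gt_zero)
    obtain G where G: "open G" "N \<subseteq> G" "G \<in> lmeasurable" "measure lebesgue G < d"
      using open_negligible_cover[OF N d] by blast
    have "\<exists>\<delta>>0. \<forall>y. \<bar>y - x\<bar> < \<delta> \<longrightarrow> \<bar>f y - f x - f' x * (y - x)\<bar> \<le> e1 * \<bar>y - x\<bar>"
      if "x \<in> {a..b} - N" for x
      using der[OF that] e1 unfolding has_field_derivative_def has_derivative_at_alt
      by (auto simp: real_norm_def) 
    then obtain \<delta> where \<delta>: "\<And>x. x \<in> {a..b} - N \<Longrightarrow> \<delta> x > 0"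
      "\<And>x y. \<lbrakk>x \<in> {a..b} - N; \<bar>y - x\<bar> < \<delta> x\<rbrakk> \<Longrightarrow> \<bar>f y - f x - f' x * (y - x)\<bar> \<le> e1 * \<bar>y - x\<bar>"
      by metis
    \<comment> \<open>\<open>\<delta>\<close> is known to be positive only on
      \<open>{a..b} - N\<close>; the ball of radius 1 merely makes \<open>\<gamma>\<close> a gauge
      on the whole line.\<close>
    define \<gamma> where "\<gamma> x = (if x \<in> N then G else if x \<in> {a..b} then ball x (\<delta> x) else ball x 1)" for x
    have gauge: "gauge \<gamma>"
      using G \<delta>(1) by (auto simp: gauge_def \<gamma>_def)
    have bound: "norm ((\<Sum>(x,k)\<in>p. measure lborel k *\<^sub>R g x) - (f b - f a)) < e"
      if p: "p tagged_division_of (cbox a b)" and fine: "\<gamma> fine p" for p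
    proof -
      have fin: "finite p" using p by (rule tagged_division_of_finite)
      have P: "a \<le> Inf k" "Inf k \<le> x" "x \<le> Sup k" "Sup k \<le> b" "k = {Inf k..Sup k}" "measure lborel k = Sup k - Inf k"
        "k \<subseteq> \<gamma> x" "x \<in> {a..b}" "Inf k \<in> k" "Sup k \<in> k"
        if xk: "(x, k) \<in> p" for x k
      proof -
        obtain u v where uv: "k = cbox u v" using p xk by (meson tagged_division_ofD(4))
        have "x \<in> k" using p xk by (meson tagged_division_ofD(2))
        moreover have "k \<subseteq> cbox a b" using p xk by (meson tagged_division_ofD(3))
        moreover have "k \<subseteq> \<gamma> x" using fine xk by (auto simp: fine_def)
        ultimately show "a \<le> Inf k" "Inf k \<le> x" "x \<le> Sup k" "Sup k \<le> b" "k = {Inf k..Sup k}" "measure lborel k = Sup k - Inf k"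
          "k \<subseteq> \<gamma> x" "x \<in> {a..b}" "Inf k \<in> k" "Sup k \<in> k"
          using uv by (auto)
      qed
      have tele: "(\<Sum>(x,k)\<in>p. f (Sup k) - f (Inf k)) = f b - f a"
        using additive_tagged_division_1[OF _ p[unfolded box_real], of f] ab by simp
      have conts: "(\<Sum>(x,k)\<in>p. measure lborel k) = b - a"
        using additive_content_tagged_division[OF p] ab by simp
      \<comment> \<open>Degenerate intervals have no increment and are excluded, so that distinct
        members of \<open>A\<close> have distinct intervals and lengths can be added as
        measures.\<close>
      define A where "A = {q\<in>p. fst q \<in> N \<and> Inf (snd q) < Sup (snd q)}"
      have bad: "(\<Sum>q\<in>A. \<bar>f (Sup (snd q)) - f (Inf (snd q))\<bar>) < e / 2"
      proof (rule ac_modulusD[OF D])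
        show "finite A" using fin by (simp add: A_def)
        show "a \<le> Inf (snd q) \<and> Inf (snd q) \<le> Sup (snd q) \<and> Sup (snd q) \<le> b" if "q \<in> A" for q
          using P[of "fst q" "snd q"] that by (auto simp: A_def)
        show "Sup (snd q) \<le> Inf (snd q') \<or> Sup (snd q') \<le> Inf (snd q)" if "q \<in> A" "q' \<in> A" "q \<noteq> q'" for q q'
        proof -
          have "interior (snd q) \<inter> interior (snd q') = {}"
            using tagged_division_ofD(5)[OF p, of "fst q" "snd q" "fst q'" "snd q'"] that by (simp add: A_def prod_eq_iff)
          moreover have "snd q = {Inf (snd q)..Sup (snd q)}" "snd q' = {Inf (snd q')..Sup (snd q')}"
            using P(5)[of "fst q" "snd q"] P(5)[of "fst q'" "snd q'"] that by (auto simp: A_def)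
          ultimately have "{Inf (snd q)<..<Sup (snd q)} \<inter> {Inf (snd q')<..<Sup (snd q')} = {}"
            by (metis interior_atLeastAtMost_real)
          moreover have "Inf (snd q) < Sup (snd q)" "Inf (snd q') < Sup (snd q')"
            using that by (auto simp: A_def)
          ultimately show ?thesis
          proof -
            \<comment> \<open>Midpoint of the intersection: if the two intervals overlapped, it
              would lie in the interior of both.\<close>
            define m where "m = (max (Inf (snd q)) (Inf (snd q')) + min (Sup (snd q)) (Sup (snd q'))) / 2"
            have "m \<notin> {Inf (snd q)<..<Sup (snd q)} \<inter> {Inf (snd q')<..<Sup (snd q')}"
              using \<open>{Inf (snd q)<..<Sup (snd q)} \<inter> {Inf (snd q')<..<Sup (snd q')} = {}\<close> by (simp only: empty_iff not_False_eq_True)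
            then show ?thesis
              using \<open>Inf (snd q) < Sup (snd q)\<close> \<open>Inf (snd q') < Sup (snd q')\<close>
              unfolding m_def max_def min_def Int_iff greaterThanLessThan_iff by (auto split: if_splits)
          qed
        qed
        have inj: "inj_on snd A"
        proof (rule inj_onI)
          fix q q' assume q: "q \<in> A" "q' \<in> A" "snd q = snd q'"
          obtain x k x' where xk: "q = (x, k)" "q' = (x', k)"
            using q(3) by (metis prod.collapse)
          have xp: "(x, k) \<in> p" "(x', k) \<in> p" "Inf k < Sup k" using q xk by (auto simp: A_def)
          show "q = q'"
          proof (rule ccontr)
            assume "q \<noteq> q'"
            then have "interior k \<inter> interior k = {}"
              using tagged_division_ofD(5)[OF p xp(1,2)] xk by blast
            moreover have "interior k = {Inf k<..<Sup k}"
              using P(5)[OF xp(1)] interior_atLeastAtMost_real[of "Inf k" "Sup k"] by simp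
            ultimately show False using xp(3) by simp
          qed
        qed
        have div: "snd ` A division_of \<Union>(snd ` A)"
        proof -
          have "A tagged_partial_division_of cbox a b"
            using p tagged_partial_division_subset[of p "cbox a b" A]
            by (auto simp: A_def tagged_division_of_def)
          then show ?thesis by (rule partial_division_of_tagged_division)
        qed
        have "Sup (snd q) - Inf (snd q) = measure lebesgue (snd q)" if "q \<in> A" for q
        proof -
          have q: "(fst q, snd q) \<in> p" using that by (simp add: A_def)
          have "measure lebesgue (snd q) = measure lebesgue {Inf (snd q)..Sup (snd q)}"
            by (rule arg_cong[OF P(5)[OF q]])
          then show ?thesis using order_trans[OF P(2)[OF q] P(3)[OF q]] by simp
        qed
        then have "(\<Sum>q\<in>A. Sup (snd q) - Inf (snd q)) = (\<Sum>q\<in>A. measure lebesgue (snd q))"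
          by (rule sum.cong[OF refl])
        also have "\<dots> = (\<Sum>k\<in>snd ` A. measure lebesgue k)"
          using inj by (simp add: sum.reindex)
        also have "\<dots> = measure lebesgue (\<Union>(snd ` A))"
          using content_division[OF div] by simp
        also have "\<dots> \<le> measure lebesgue G"
        proof (rule measure_mono_fmeasurable)
          have "snd q \<subseteq> G" if "q \<in> A" for q
          proof -
            have "(fst q, snd q) \<in> p" "fst q \<in> N" using that by (simp_all add: A_def)
            then show ?thesis using P(7)[of "fst q" "snd q"] by (simp add: \<gamma>_def)
          qed
          then show "\<Union>(snd ` A) \<subseteq> G" by blast
          show "\<Union>(snd ` A) \<in> sets lebesgue"
            using lmeasurable_division[OF div] by (rule fmeasurableD)
        qed (rule G)
        finally show "(\<Sum>q\<in>A. Sup (snd q) - Inf (snd q)) < d" using G by simp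
      qed
      \<comment> \<open>By telescoping, the increment \<open>f b - f a\<close> is distributed over
        the intervals of the division, so the error can be estimated interval by interval.\<close>
      have "\<bar>(\<Sum>(x,k)\<in>p. measure lborel k *\<^sub>R g x) - (f b - f a)\<bar>
          = \<bar>\<Sum>(x,k)\<in>p. measure lborel k * g x - (f (Sup k) - f (Inf k))\<bar>"
        unfolding tele[symmetric] by (simp add: sum_subtractf case_prod_unfold)
      also have "\<dots> \<le> (\<Sum>(x,k)\<in>p. \<bar>measure lborel k * g x - (f (Sup k) - f (Inf k))\<bar>)"
        by (rule order_trans[OF sum_abs]) (simp add: case_prod_unfold)
      also have "\<dots> \<le> (\<Sum>(x,k)\<in>p. e1 * measure lborel k + (if (x,k) \<in> A then \<bar>f (Sup k) - f (Inf k)\<bar> else 0))"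
      proof (rule sum_mono, clarify)
        fix x k assume xk: "(x, k) \<in> p"
        note Q = P[OF xk]
        show "\<bar>measure lborel k * g x - (f (Sup k) - f (Inf k))\<bar> \<le> e1 * measure lborel k + (if (x,k) \<in> A then \<bar>f (Sup k) - f (Inf k)\<bar> else 0)"
        proof (cases "x \<in> N")
          case True
          show ?thesis
          proof (cases "Inf k < Sup k")
            case True
            then have "(x,k) \<in> A" using \<open>x \<in> N\<close> xk by (simp add: A_def)
            then show ?thesis using \<open>x \<in> N\<close> mult_nonneg_nonneg[of e1 "Sup k - Inf k"] e1 True Q(6)
              by (simp add: g_def abs_minus_commute)
          next
            case False
            then have eq: "Inf k = Sup k" using Q(2,3) by linarith
            show ?thesis unfolding Q(6) eq using \<open>x \<in> N\<close> by (simp add: g_def)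
          qed
        next
          case False
          have "k \<subseteq> ball x (\<delta> x)" using Q(7,8) False by (simp add: \<gamma>_def)
          moreover have "Inf k \<in> k" "Sup k \<in> k" using Q(9,10) .
          ultimately have "\<bar>Inf k - x\<bar> < \<delta> x" "\<bar>Sup k - x\<bar> < \<delta> x"
            by (auto simp: dist_real_def)
          then have "\<bar>f (Inf k) - f x - f' x * (Inf k - x)\<bar> \<le> e1 * \<bar>Inf k - x\<bar>"
            "\<bar>f (Sup k) - f x - f' x * (Sup k - x)\<bar> \<le> e1 * \<bar>Sup k - x\<bar>"
            using \<delta>(2)[of x] Q(8) False by blast+
          then have "\<bar>(Sup k - Inf k) * f' x - (f (Sup k) - f (Inf k))\<bar> \<le> e1 * (Sup k - Inf k)"
            using Q(2,3) by (simp add: algebra_simps)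
          then show ?thesis using False Q(6) by (simp add: g_def A_def)
        qed
      qed
      also have "\<dots> = e1 * (b - a) + (\<Sum>q\<in>p. if q \<in> A then \<bar>f (Sup (snd q)) - f (Inf (snd q))\<bar> else 0)"
        unfolding conts[symmetric] by (simp add: sum.distrib sum_distrib_left case_prod_unfold)
      also have "\<dots> = e1 * (b - a) + (\<Sum>q\<in>A. \<bar>f (Sup (snd q)) - f (Inf (snd q))\<bar>)"
        using fin by (simp add: sum.If_cases A_def Int_def)
      also have "\<dots> < e"
      proof -
        have "e1 * (b - a) = e / 2" using ab by (metis e1_def eq_divide_eq less_irrefl right_minus_eq)
        then show ?thesis using bad by linarith
      qed
      finally show ?thesis by (simp only: real_norm_def)
    qed
    show "\<exists>\<gamma>. gauge \<gamma> \<and> (\<forall>p. p tagged_division_of cbox a b \<and> \<gamma> fine p \<longrightarrow>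
        norm ((\<Sum>(x,k)\<in>p. measure lborel k *\<^sub>R g x) - (f b - f a)) < e)"
      by (intro exI[of _ \<gamma>] conjI allI impI gauge) (elim conjE, rule bound)
  qed
  then have "(f' has_integral (f b - f a)) (cbox a b)"
    using has_integral_spike[of N "cbox a b" f' g "f b - f a"] N by (auto simp: g_def)
  then show ?thesis by (simp only: box_real)
qed

section \<open>Indefinite Lebesgue integrals: absolute continuity and differentiation\<close>

lemma sum_integral_nonoverlapping_le:
  fixes h :: "real \<Rightarrow> real"
  assumes h: "integrable lebesgue h" "\<And>x. h x \<ge> 0" and I: "finite I"
    and H: "\<And>i. i \<in> I \<Longrightarrow> l i \<le> r i"
    "\<And>i j. \<lbrakk>i \<in> I; j \<in> I; i \<noteq> j\<rbrakk> \<Longrightarrow> r i \<le> l j \<or> r j \<le> l i"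
  shows "(\<Sum>i\<in>I. integral {l i..r i} h) \<le> (LINT x|lebesgue. h x)"
proof -
  have int: "integrable lebesgue (\<lambda>x. indicator {l i<..<r i} x * h x)" for i
    using integrable_mult_indicator[OF _ h(1), of "{l i<..<r i}"] by simp
  have "integral {l i..r i} h = (LINT x|lebesgue. indicator {l i<..<r i} x * h x)" for i
  proof -
    have "integral {l i..r i} h = integral {l i<..<r i} h"
      by (simp add: integral_open_interval_real)
    also have "\<dots> = set_lebesgue_integral lebesgue {l i<..<r i} h"
      using int[of i] by (intro set_lebesgue_integral_eq_integral(2)[symmetric]) (simp add: set_integrable_def)
    finally show ?thesis by (simp add: set_lebesgue_integral_def)
  qed
  then have "(\<Sum>i\<in>I. integral {l i..r i} h) = (LINT x|lebesgue. (\<Sum>i\<in>I. indicator {l i<..<r i} x * h x))"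
    using int by simp
  also have "\<dots> \<le> (LINT x|lebesgue. h x)"
  proof (rule integral_mono)
    fix x
    \<comment> \<open>The intervals may share end points; passing to their interiors makes them
      disjoint, so at most one indicator is 1 at each point.\<close>
    have "disjoint_family_on (\<lambda>i. {l i<..<r i}) I"
      unfolding disjoint_family_on_def
    proof (intro ballI impI)
      fix i j assume "i \<in> I" "j \<in> I" "i \<noteq> j"
      from H(2)[OF this] show "{l i<..<r i} \<inter> {l j<..<r j} = {}" by auto
    qed
    then have "(\<Sum>i\<in>I. indicator {l i<..<r i} x) = (indicator (\<Union>i\<in>I. {l i<..<r i}) x :: real)"
      using I by (simp add: indicator_UN_disjoint)
    then have "(\<Sum>i\<in>I. indicator {l i<..<r i} x * h x) = indicator (\<Union>i\<in>I. {l i<..<r i}) x * h x"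
      by (simp add: sum_distrib_right[symmetric])
    then show "(\<Sum>i\<in>I. indicator {l i<..<r i} x * h x) \<le> h x"
      using h(2)[of x] by (simp add: indicator_def)
  qed (use int h in auto)
  finally show ?thesis .
qed

lemma integrable_lebesgue_imp_integrable_on:
  fixes f :: "real \<Rightarrow> real"
  assumes "integrable lebesgue f"
  shows "f integrable_on {a..b}" "f absolutely_integrable_on {a..b}"
proof -
  show "f absolutely_integrable_on {a..b}"
    using integrable_mult_indicator[OF _ assms, of "{a..b}"] by (simp add: set_integrable_def)
  then show "f integrable_on {a..b}"
    using set_lebesgue_integral_eq_integral(1) by blast
qed

text \<open>Truncation at level n: |f| is at most n plus the excess \<open>h\<close>. The excess has
  small total integral, and the bounded part contributes at most n times the total length.\<close>

lemma abs_cont_on_integral: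
  fixes f :: "real \<Rightarrow> real"
  assumes f: "integrable lebesgue f"
  shows "abs_cont_on a b (\<lambda>x. integral {a..x} f)"
  unfolding abs_cont_on_iff_modulus
proof (intro allI impI)
  fix e :: real assume e: "e > 0"
  \<comment> \<open>At each point the excess over n is eventually 0, and |f| dominates it.\<close>
  have "(\<lambda>n. LINT x|lebesgue. max 0 (\<bar>f x\<bar> - real n)) \<longlonglongrightarrow> (LINT x|(lebesgue::real measure). (0::real))"
  proof (rule integral_dominated_convergence[where w="\<lambda>x. \<bar>f x\<bar>"])
    show "AE x in lebesgue. (\<lambda>n. max 0 (\<bar>f x\<bar> - real n)) \<longlonglongrightarrow> 0"
    proof (rule AE_I2)
      fix x
      obtain N where "\<bar>f x\<bar> \<le> real N" using real_arch_simple by blast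
      then have "eventually (\<lambda>n. max 0 (\<bar>f x\<bar> - real n) = 0) sequentially"
        by (intro eventually_sequentiallyI[of N]) auto
      then show "(\<lambda>n. max 0 (\<bar>f x\<bar> - real n)) \<longlonglongrightarrow> 0" by (rule tendsto_eventually)
    qed
  qed (use f in auto)
  then have "eventually (\<lambda>n. (LINT x|lebesgue. max 0 (\<bar>f x\<bar> - real n)) < e / 2) sequentially"
    using e by (intro order_tendstoD) auto
  then obtain n where n: "(LINT x|lebesgue. max 0 (\<bar>f x\<bar> - real n)) < e / 2"
    by (auto simp: eventually_sequentially)
  define h where "h = (\<lambda>x. max 0 (\<bar>f x\<bar> - real n))"
  have h: "integrable lebesgue h" "\<And>x. h x \<ge> 0" "(LINT x|lebesgue. h x) < e / 2"
    using f n by (auto simp: h_def intro!: Bochner_Integration.integrable_bound[OF f])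
  \<comment> \<open>Makes the bounded part \<open>real n * d\<close> at most \<open>e / 2\<close>;
    the added 1 keeps the denominator positive when \<open>n = 0\<close>.\<close>
  define d where "d = e / (2 * (real n + 1))"
  have d: "d > 0" using e by (simp add: d_def)
  have "ac_modulus a b (\<lambda>x. integral {a..x} f) e d"
  proof (rule ac_modulusI)
    fix m :: nat and l r :: "nat \<Rightarrow> real"
    assume H1: "\<And>i. i < m \<Longrightarrow> a \<le> l i \<and> l i \<le> r i \<and> r i \<le> b"
      and H2: "\<And>i j. \<lbrakk>i < m; j < m; i \<noteq> j\<rbrakk> \<Longrightarrow> r i \<le> l j \<or> r j \<le> l i"
      and H3: "(\<Sum>i<m. r i - l i) < d"
    have "\<bar>integral {a..r i} f - integral {a..l i} f\<bar> \<le> real n * (r i - l i) + integral {l i..r i} h" if "i < m" for i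
    proof -
      have "integral {a..l i} f + integral {l i..r i} f = integral {a..r i} f"
        using H1[OF that] integrable_lebesgue_imp_integrable_on[OF f]
        by (intro Henstock_Kurzweil_Integration.integral_combine) auto
      then have "\<bar>integral {a..r i} f - integral {a..l i} f\<bar> = norm (integral {l i..r i} f)"
        by simp
      also have "\<dots> \<le> integral {l i..r i} (\<lambda>x. real n + h x)"
      proof (rule integral_norm_bound_integral)
        show "(\<lambda>x. real n + h x) integrable_on {l i..r i}"
          using integrable_lebesgue_imp_integrable_on(1)[OF h(1)] by (intro integrable_add) auto
      qed (use integrable_lebesgue_imp_integrable_on[OF f] in \<open>auto simp: h_def\<close>)
      also have "\<dots> = real n * (r i - l i) + integral {l i..r i} h"
        using H1[OF that] integrable_lebesgue_imp_integrable_on(1)[OF h(1)]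
        by (subst Henstock_Kurzweil_Integration.integral_add) auto
      finally show ?thesis .
    qed
    then have "(\<Sum>i<m. \<bar>integral {a..r i} f - integral {a..l i} f\<bar>)
      \<le> (\<Sum>i<m. real n * (r i - l i) + integral {l i..r i} h)"
      by (intro sum_mono) simp
    also have "\<dots> = real n * (\<Sum>i<m. r i - l i) + (\<Sum>i<m. integral {l i..r i} h)"
      by (simp add: sum.distrib sum_distrib_left)
    also have "\<dots> \<le> real n * d + (LINT x|lebesgue. h x)"
      using H3 H1 H2 by (intro add_mono mult_left_mono sum_integral_nonoverlapping_le h) auto
    also have "\<dots> < e"
    proof -
      have "real n * d \<le> (real n + 1) * d" using d by simp
      also have "\<dots> = e / 2" by (simp add: d_def divide_simps)
      finally show ?thesis using h(3) by linarith
    qed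
    finally show "(\<Sum>i<m. \<bar>integral {a..r i} f - integral {a..l i} f\<bar>) < e" .
  qed
  then show "\<exists>d>0. ac_modulus a b (\<lambda>x. integral {a..x} f) e d" using d by blast
qed

text \<open>The known averaging result concerns the intervals [x, x + h], hence right derivatives
  only; left derivatives come from the reflected function. The exceptional set does not depend on
  the base point \<open>a\<close>.\<close>

theorem lebesgue_differentiation:
  fixes f :: "real \<Rightarrow> real"
  assumes f: "integrable lebesgue f"
  shows "AE x in lebesgue. \<forall>a<x. ((\<lambda>y. integral {a..y} f) has_real_derivative f x) (at x)"
proof -
  have io: "f integrable_on cbox a b" for a b
    using integrable_lebesgue_imp_integrable_on(1)[OF f] by simp
  obtain N1 where N1: "negligible N1" "\<And>x e. \<lbrakk>x \<notin> N1; 0 < e\<rbrakk> \<Longrightarrow>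
       \<exists>d>0. \<forall>h. 0 < h \<and> h < d \<longrightarrow> norm (integral (cbox x (x + h *\<^sub>R One)) f /\<^sub>R h ^ DIM(real) - f x) < e"
    using integrable_ccontinuous_explicit[OF io] by blast
  have io2: "(\<lambda>x. f (- x)) integrable_on cbox a b" for a b
    using io[of "-b" "-a"] Henstock_Kurzweil_Integration.integrable_reflect_real[where f=f and a="-b" and b="-a"] by simp
  obtain N2 where N2: "negligible N2" "\<And>x e. \<lbrakk>x \<notin> N2; 0 < e\<rbrakk> \<Longrightarrow>
       \<exists>d>0. \<forall>h. 0 < h \<and> h < d \<longrightarrow> norm (integral (cbox x (x + h *\<^sub>R One)) (\<lambda>x. f (- x)) /\<^sub>R h ^ DIM(real) - f (- x)) < e"
    using integrable_ccontinuous_explicit[OF io2] by blast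
  define N where "N = N1 \<union> uminus ` N2"
  \<comment> \<open>The null set of the reflected function is reflected back, and a differentiable
    map preserves null sets.\<close>
  have "negligible (uminus ` N2)"
    using N2(1) by (rule negligible_differentiable_image_negligible[rotated]) (auto intro!: derivative_intros simp: differentiable_on_def)
  then have "negligible N" using N1 by (simp add: N_def)
  then have "AE x in lebesgue. x \<notin> N" by (intro AE_not_in) (simp add: negligible_iff_null_sets)
  moreover have "((\<lambda>y. integral {a..y} f) has_real_derivative f x) (at x)" if x: "x \<notin> N" "a < x" for x a
    unfolding has_field_derivative_iff LIM_def
  proof (intro allI impI)
    have comb: "integral {a..v} f - integral {a..u} f = integral {u..v} f" if "a \<le> u" "u \<le> v" for u v
      using Henstock_Kurzweil_Integration.integral_combine[of a u v f] that io by simp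
    have x1: "x \<notin> N1" and x2: "- x \<notin> N2"
      using x by (auto simp: N_def image_iff)
    fix e :: real assume e: "e > 0"
    obtain d1 where d1: "d1 > 0" "\<And>h. 0 < h \<Longrightarrow> h < d1 \<Longrightarrow> \<bar>integral {x..x + h} f / h - f x\<bar> < e"
      using N1(2)[OF x1 e] by (auto simp: divide_inverse mult.commute)
    obtain d2 where d2: "d2 > 0" "\<And>h. 0 < h \<Longrightarrow> h < d2 \<Longrightarrow> \<bar>integral {-x..-x + h} (\<lambda>x. f (- x)) / h - f x\<bar> < e"
      using N2(2)[OF x2 e] by (auto simp: divide_inverse mult.commute)
    define d where "d = min d1 (min d2 (x - a))"
    have "dist ((integral {a..y} f - integral {a..x} f) / (y - x)) (f x) < e"
      if y: "y \<noteq> x" "dist y x < d" for y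
    proof (cases "x < y")
      case True
      then show ?thesis
        using d1(2)[of "y - x"] y comb[of x y] x by (auto simp: d_def dist_real_def)
    next
      case False
      then have "y < x" "x - y < d2" "a < y" using y by (auto simp: d_def dist_real_def)
      moreover have "integral {-x..-y} (\<lambda>x. f (- x)) = integral {y..x} f"
        using Henstock_Kurzweil_Integration.integral_reflect_real[where f=f and a=y and b=x] by simp
      moreover have "(integral {a..y} f - integral {a..x} f) / (y - x) = integral {y..x} f / (x - y)"
        using comb[of y x] \<open>y < x\<close> \<open>a < y\<close> minus_divide_divide[of "integral {y..x} f" "x - y"] by (simp add: algebra_simps)
      ultimately show ?thesis
        using d2(2)[of "x - y"] by (simp add: dist_real_def)
    qed
    moreover have "d > 0" using d1 d2 x by (simp add: d_def)
    ultimately show "\<exists>s>0. \<forall>y. y \<noteq> x \<and> dist y x < s \<longrightarrow> dist ((integral {a..y} f - integral {a..x} f) / (y - x)) (f x) < e"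
      by blast
  qed
  ultimately show ?thesis by (auto elim!: eventually_mono)
qed

section \<open>Finite exceptional sets, vanishing step sizes and ramps\<close>

lemma AE_lebesgue_notin_finite:
  fixes S :: "real set"
  assumes "finite S" shows "AE x in lebesgue. x \<notin> S"
  using assms by (intro AE_not_in null_sets_completionI finite_imp_null_set_lborel)

lemma vanishing_sequence:
  assumes "d > (0::real)"
  obtains h :: "nat \<Rightarrow> real" where "\<And>n. h n > 0" "\<And>n. h n < d" "h \<longlonglongrightarrow> 0"
proof (rule that[of "\<lambda>n. d / 2 / real (Suc n)"])
  fix n
  show "d / 2 / real (Suc n) > 0" using assms by simp
  have "d / 2 / real (Suc n) \<le> d / 2 / 1" using assms by (intro divide_left_mono) auto
  also have "\<dots> < d" using assms by simp
  finally show "d / 2 / real (Suc n) < d" .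
qed (rule LIMSEQ_Suc[OF lim_const_over_n])

lemma ramp_deriv:
  fixes p x :: real
  assumes "x \<noteq> p" shows "((\<lambda>x. max 0 (x - p)) has_real_derivative (if p < x then 1 else 0)) (at x)"
proof (cases "p < x")
  case True
  have "((\<lambda>x. x - p) has_real_derivative 1) (at x)" by (auto intro!: derivative_eq_intros)
  then have "((\<lambda>x. max 0 (x - p)) has_real_derivative 1) (at x)"
    by (rule has_field_derivative_transform_within_open[where S="{p<..}"]) (use True in auto)
  then show ?thesis using True by simp
next
  case False
  have "((\<lambda>x. 0) has_real_derivative 0) (at x)" by simp
  then have "((\<lambda>x. max 0 (x - p)) has_real_derivative 0) (at x)"
    by (rule has_field_derivative_transform_within_open[where S="{..<p}"]) (use False assms in auto)
  then show ?thesis using False by simp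
qed

lemma abs_cont_on_ramp: "abs_cont_on a b (\<lambda>x. max 0 (x - p))"
  by (rule abs_cont_on_lipschitz[where K=1]) auto

section \<open>Calculus of curves in the space of square integrable functions\<close>

abbreviation M01 :: "real measure" where "M01 \<equiv> lebesgue_on {0<..<1}"

abbreviation I0 :: "real \<Rightarrow> real measure" where "I0 t \<equiv> lebesgue_on {0<..<t}"

abbreviation MQ :: "real \<Rightarrow> (real \<times> real) measure" where "MQ T \<equiv> lebesgue_on (Qset T)"

definition ip :: "(real \<Rightarrow> real) \<Rightarrow> (real \<Rightarrow> real) \<Rightarrow> real" where
  "ip v w = (LINT x|M01. v x * w x)"

definition nrm :: "(real \<Rightarrow> real) \<Rightarrow> real" where
  "nrm v = sqrt (L2_01_norm2 v)"

section \<open>Square integrable functions on (0,1) and their inner product\<close>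

lemma finite_M01: "finite_measure M01"
  by (rule finite_measureI) (simp add: emeasure_restrict_space)

lemma L2_01_measurable: "L2_01 v \<Longrightarrow> v \<in> borel_measurable M01"
  by (simp add: L2_01_def)

lemma L2_01_mult_integrable:
  assumes "L2_01 v" "L2_01 w"
  shows "integrable M01 (\<lambda>x. v x * w x)"
proof (rule Bochner_Integration.integrable_bound)
  show "integrable M01 (\<lambda>x. (v x)\<^sup>2 + (w x)\<^sup>2)"
    using assms by (auto simp: L2_01_def)
  have "norm (v x * w x) \<le> norm ((v x)\<^sup>2 + (w x)\<^sup>2)" for x
  proof -
    have "2 * (\<bar>v x\<bar> * \<bar>w x\<bar>) \<le> (v x)\<^sup>2 + (w x)\<^sup>2" "0 \<le> \<bar>v x\<bar> * \<bar>w x\<bar>"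
      using sum_squares_bound[of "\<bar>v x\<bar>" "\<bar>w x\<bar>"] by simp_all
    then show ?thesis unfolding real_norm_def abs_mult by linarith
  qed
  then show "AE x in M01. norm (v x * w x) \<le> norm ((v x)\<^sup>2 + (w x)\<^sup>2)" by simp
qed (use assms in \<open>auto simp: L2_01_def\<close>)

lemma L2_01_add:
  assumes "L2_01 v" "L2_01 w" shows "L2_01 (\<lambda>x. v x + w x)"
proof -
  have "integrable M01 (\<lambda>x. (v x)\<^sup>2 + (w x)\<^sup>2 + 2 * (v x * w x))"
    using L2_01_mult_integrable[OF assms] assms unfolding L2_01_def
    by (intro Bochner_Integration.integrable_add integrable_mult_right) auto
  then show ?thesis
    using assms by (auto simp: L2_01_def power2_sum algebra_simps)
qed

lemma L2_01_bounded_mult: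
  assumes "L2_01 v" "b \<in> borel_measurable M01" "\<And>x. x \<in> {0<..<1} \<Longrightarrow> \<bar>b x\<bar> \<le> B"
  shows "L2_01 (\<lambda>x. b x * v x)"
  unfolding L2_01_def
proof
  show m: "(\<lambda>x. b x * v x) \<in> borel_measurable M01"
    using assms by (auto simp: L2_01_def)
  show "integrable M01 (\<lambda>x. (b x * v x)\<^sup>2)"
  proof (rule Bochner_Integration.integrable_bound)
    show "integrable M01 (\<lambda>x. B\<^sup>2 * (v x)\<^sup>2)" using assms by (auto simp: L2_01_def)
    show "AE x in M01. norm ((b x * v x)\<^sup>2) \<le> norm (B\<^sup>2 * (v x)\<^sup>2)"
    proof (rule AE_I2)
      fix x assume "x \<in> space M01"
      then have "\<bar>b x\<bar> \<le> B" using assms(3) by simp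
      then have "(b x)\<^sup>2 \<le> B\<^sup>2" by (metis abs_ge_zero power2_abs power_mono)
      then show "norm ((b x * v x)\<^sup>2) \<le> norm (B\<^sup>2 * (v x)\<^sup>2)"
        by (simp add: power_mult_distrib mult_right_mono)
    qed
  qed (use m in simp)
qed

lemma L2_01_cmult: "L2_01 v \<Longrightarrow> L2_01 (\<lambda>x. c * v x)"
  by (rule L2_01_bounded_mult[where B="\<bar>c\<bar>"]) auto

lemma L2_01_divide: "L2_01 v \<Longrightarrow> L2_01 (\<lambda>x. v x / c)"
  using L2_01_cmult[of v "1/c"] by simp

lemma L2_01_diff: "L2_01 v \<Longrightarrow> L2_01 w \<Longrightarrow> L2_01 (\<lambda>x. v x - w x)"
  using L2_01_add[of v "\<lambda>x. (-1) * w x"] L2_01_cmult[of w "-1"] by simp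

lemma L2_01_bounded:
  assumes "b \<in> borel_measurable M01" "\<And>x. x \<in> {0<..<1} \<Longrightarrow> \<bar>b x\<bar> \<le> B"
  shows "L2_01 b"
proof -
  interpret finite_measure M01 by (rule finite_M01)
  have "L2_01 (\<lambda>x. 1)" by (simp add: L2_01_def)
  from L2_01_bounded_mult[OF this assms] show ?thesis by simp
qed

lemma L2_01_integrable:
  assumes "L2_01 v" shows "integrable M01 v"
proof -
  interpret finite_measure M01 by (rule finite_M01)
  have "L2_01 (\<lambda>x. 1)" by (simp add: L2_01_def)
  from L2_01_mult_integrable[OF assms this] show ?thesis by simp
qed

lemma norm2_eq_ip: "L2_01_norm2 v = ip v v"
  by (simp add: L2_01_norm2_def ip_def power2_eq_square)

lemma norm2_nonneg [simp]: "L2_01_norm2 v \<ge> 0"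
  by (simp add: L2_01_norm2_def)

lemma nrm_nonneg [simp]: "nrm v \<ge> 0" by (simp add: nrm_def)

lemma nrm_power2: "(nrm v)\<^sup>2 = L2_01_norm2 v" by (simp add: nrm_def)

lemma ip_commute: "ip v w = ip w v"
  by (simp add: ip_def mult.commute)

lemma ip_diff_left: "\<lbrakk>L2_01 u; L2_01 v; L2_01 w\<rbrakk> \<Longrightarrow> ip (\<lambda>x. u x - v x) w = ip u w - ip v w"
  unfolding ip_def by (simp add: left_diff_distrib L2_01_mult_integrable)

lemma ip_diff_right: "\<lbrakk>L2_01 u; L2_01 v; L2_01 w\<rbrakk> \<Longrightarrow> ip w (\<lambda>x. u x - v x) = ip w u - ip w v"
  using ip_diff_left by (simp add: ip_commute)

lemma ip_cmult_left: "ip (\<lambda>x. c * v x) w = c * ip v w"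
  unfolding ip_def by (simp add: mult.assoc)

lemma ip_divide_left: "ip (\<lambda>x. v x / c) w = ip v w / c"
  using ip_cmult_left[of "1/c" v w] by simp

lemma ip_divide_right: "ip w (\<lambda>x. v x / c) = ip w v / c"
  using ip_divide_left by (simp add: ip_commute)

lemma norm2_cmult: "L2_01_norm2 (\<lambda>x. c * v x) = c\<^sup>2 * L2_01_norm2 v"
  by (simp add: L2_01_norm2_def power_mult_distrib)

lemma norm2_add_le:
  assumes "L2_01 v" "L2_01 w"
  shows "L2_01_norm2 (\<lambda>x. v x + w x) \<le> 2 * L2_01_norm2 v + 2 * L2_01_norm2 w"
proof -
  have "L2_01_norm2 (\<lambda>x. v x + w x) \<le> (LINT x|M01. 2 * (v x)\<^sup>2 + 2 * (w x)\<^sup>2)"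
    unfolding L2_01_norm2_def
  proof (rule integral_mono)
    show "integrable M01 (\<lambda>x. (v x + w x)\<^sup>2)" using L2_01_add[OF assms] by (simp add: L2_01_def)
    show "integrable M01 (\<lambda>x. 2 * (v x)\<^sup>2 + 2 * (w x)\<^sup>2)" using assms by (auto simp: L2_01_def)
    show "(v x + w x)\<^sup>2 \<le> 2 * (v x)\<^sup>2 + 2 * (w x)\<^sup>2" for x
      using sum_squares_bound[of "v x" "w x"] by (simp add: power2_sum)
  qed
  also have "\<dots> = 2 * L2_01_norm2 v + 2 * L2_01_norm2 w"
    using assms by (simp add: L2_01_norm2_def L2_01_def)
  finally show ?thesis .
qed

lemma norm2_diff_le:
  assumes "L2_01 v" "L2_01 w"
  shows "L2_01_norm2 (\<lambda>x. v x - w x) \<le> 2 * L2_01_norm2 v + 2 * L2_01_norm2 w"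
  using norm2_add_le[OF assms(1) L2_01_cmult[OF assms(2), of "-1"]] norm2_cmult[of "-1" w] by simp

lemma norm2_bounded_mult_le:
  assumes "L2_01 v" "b \<in> borel_measurable M01" "\<And>x. x \<in> {0<..<1} \<Longrightarrow> \<bar>b x\<bar> \<le> B"
  shows "L2_01_norm2 (\<lambda>x. b x * v x) \<le> B\<^sup>2 * L2_01_norm2 v"
proof -
  have "L2_01_norm2 (\<lambda>x. b x * v x) \<le> (LINT x|M01. B\<^sup>2 * (v x)\<^sup>2)"
    unfolding L2_01_norm2_def
  proof (rule integral_mono)
    show "integrable M01 (\<lambda>x. (b x * v x)\<^sup>2)" using L2_01_bounded_mult[OF assms] by (simp add: L2_01_def)
    show "integrable M01 (\<lambda>x. B\<^sup>2 * (v x)\<^sup>2)" using assms by (auto simp: L2_01_def)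
    fix x assume "x \<in> space M01"
    then have "\<bar>b x\<bar> \<le> B" using assms(3) by simp
    then have "(b x)\<^sup>2 \<le> B\<^sup>2" by (metis abs_ge_zero power2_abs power_mono)
    then show "(b x * v x)\<^sup>2 \<le> B\<^sup>2 * (v x)\<^sup>2"
      by (simp add: power_mult_distrib mult_right_mono)
  qed
  then show ?thesis by (simp add: L2_01_norm2_def)
qed

lemma nrm_bounded_mult_le:
  assumes "L2_01 v" "b \<in> borel_measurable M01" "\<And>x. x \<in> {0<..<1} \<Longrightarrow> \<bar>b x\<bar> \<le> B" "B \<ge> 0"
  shows "nrm (\<lambda>x. b x * v x) \<le> B * nrm v"
  using real_sqrt_le_mono[OF norm2_bounded_mult_le[OF assms(1-3)]] assms(4)
  by (simp add: nrm_def real_sqrt_mult)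

lemma ip_Cauchy_Schwarz:
  assumes v: "L2_01 v" and w: "L2_01 w"
  shows "\<bar>ip v w\<bar> \<le> nrm v * nrm w"
proof -
  define A B C where "A = ip v v" "B = ip v w" "C = ip w w"
  have nn: "0 \<le> A - 2 * t * B + t\<^sup>2 * C" for t
  proof -
    have tw: "L2_01 (\<lambda>x. t * w x)" by (rule L2_01_cmult[OF w])
    have "ip (\<lambda>x. v x - t * w x) (\<lambda>x. v x - t * w x) = A - 2 * t * B + t\<^sup>2 * C"
      using ip_commute[of w v]
      by (simp add: A_B_C_def ip_diff_left[OF v tw L2_01_diff[OF v tw]] ip_diff_right[OF v tw v] ip_diff_right[OF v tw tw]
        ip_cmult_left ip_commute[of _ "\<lambda>x. t * w x"] power2_eq_square algebra_simps)
    then show ?thesis using norm2_nonneg[of "\<lambda>x. v x - t * w x"] by (simp add: norm2_eq_ip)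
  qed
  have "C \<ge> 0" using norm2_nonneg[of w] by (simp add: A_B_C_def norm2_eq_ip)
  have "B\<^sup>2 \<le> A * C"
  proof (cases "C = 0")
    case True
    have "B = 0"
    proof (rule ccontr)
      assume "B \<noteq> 0"
      \<comment> \<open>For \<open>C = 0\<close> the expression is affine in t, and at this t it
        equals -1.\<close>
      then show False using nn[of "(A + 1) / (2 * B)"] True by simp
    qed
    then show ?thesis using True by simp
  next
    case False
    then have "0 \<le> A - B\<^sup>2 / C"
      \<comment> \<open>The minimizer of the quadratic polynomial in t.\<close>
      using nn[of "B / C"] by (simp add: power2_eq_square divide_simps)
    then show ?thesis using False \<open>C \<ge> 0\<close> by (simp add: divide_simps mult.commute split: if_splits)
  qed
  then have "sqrt (B\<^sup>2) \<le> sqrt (A * C)" by (rule real_sqrt_le_mono)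
  then show ?thesis by (simp add: A_B_C_def real_sqrt_mult nrm_def norm2_eq_ip)
qed

lemma ip_tendsto:
  assumes U: "\<forall>\<^sub>F s in F. L2_01 (U s)" "L2_01 U0" "((\<lambda>s. L2_01_norm2 (\<lambda>x. U s x - U0 x)) \<longlongrightarrow> 0) F"
    and V: "\<forall>\<^sub>F s in F. L2_01 (V s)" "L2_01 V0" "((\<lambda>s. L2_01_norm2 (\<lambda>x. V s x - V0 x)) \<longlongrightarrow> 0) F"
  shows "((\<lambda>s. ip (U s) (V s)) \<longlongrightarrow> ip U0 V0) F"
proof -
  define a where "a s = nrm (\<lambda>x. U s x - U0 x)" for s
  define b where "b s = nrm (\<lambda>x. V s x - V0 x)" for s
  have a: "(a \<longlongrightarrow> 0) F" and b: "(b \<longlongrightarrow> 0) F"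
    using tendsto_real_sqrt[OF U(3)] tendsto_real_sqrt[OF V(3)] by (simp_all add: a_def[abs_def] b_def[abs_def] nrm_def)
  have "((\<lambda>s. a s * b s + a s * nrm V0 + nrm U0 * b s) \<longlongrightarrow> 0 * 0 + 0 * nrm V0 + nrm U0 * 0) F"
    by (intro tendsto_intros a b)
  then have lim: "((\<lambda>s. a s * b s + a s * nrm V0 + nrm U0 * b s) \<longlongrightarrow> 0) F" by simp
  have "\<forall>\<^sub>F s in F. norm (ip (U s) (V s) - ip U0 V0) \<le> a s * b s + a s * nrm V0 + nrm U0 * b s"
    using U(1) V(1)
  proof eventually_elim
    case (elim s)
    note dU = L2_01_diff[OF elim(1) U(2)] and dV = L2_01_diff[OF elim(2) V(2)]
    \<comment> \<open>Bilinear expansion around the limits; Cauchy-Schwarz bounds the three terms by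
      the three summands of the majorant.\<close>
    have "ip (U s) (V s) - ip U0 V0 = ip (\<lambda>x. U s x - U0 x) (\<lambda>x. V s x - V0 x)
        + ip (\<lambda>x. U s x - U0 x) V0 + ip U0 (\<lambda>x. V s x - V0 x)"
      using elim U V by (simp add: ip_diff_left[OF elim(1) U(2)] ip_diff_right[OF elim(2) V(2)] dV)
    then show ?case
      using ip_Cauchy_Schwarz[OF dU dV] ip_Cauchy_Schwarz[OF dU V(2)] ip_Cauchy_Schwarz[OF U(2) dV]
      by (simp add: a_def b_def)
  qed
  then have "((\<lambda>s. ip (U s) (V s) - ip U0 V0) \<longlongrightarrow> 0) F"
    by (rule Lim_null_comparison[OF _ lim])
  then show ?thesis by (simp add: LIM_zero_iff)
qed

section \<open>Continuous and differentiable curves of square integrable functions\<close>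

definition L2_cont :: "real set \<Rightarrow> (real \<Rightarrow> real \<Rightarrow> real) \<Rightarrow> bool" where
  "L2_cont S U \<longleftrightarrow> (\<forall>t\<in>S. L2_01 (U t)) \<and>
     (\<forall>t\<in>S. ((\<lambda>s. L2_01_norm2 (\<lambda>x. U s x - U t x)) \<longlongrightarrow> 0) (at t within S))"

text \<open>Curves consist of representatives, not of equivalence classes, and convergence is
  measured by the squared norm. Limits are taken within \<open>S\<close>, hence are one-sided at the
  end points of an interval.\<close>

definition L2_deriv :: "real set \<Rightarrow> (real \<Rightarrow> real \<Rightarrow> real) \<Rightarrow> (real \<Rightarrow> real \<Rightarrow> real) \<Rightarrow> bool" where
  "L2_deriv S U U' \<longleftrightarrow> (\<forall>t\<in>S. L2_01 (U t)) \<and> (\<forall>t\<in>S. L2_01 (U' t)) \<and>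
     (\<forall>t\<in>S. ((\<lambda>s. L2_01_norm2 (\<lambda>x. (U s x - U t x) / (s - t) - U' t x)) \<longlongrightarrow> 0) (at t within S))"

lemma L2_cont_const: "L2_01 v \<Longrightarrow> L2_cont S (\<lambda>t. v)"
  by (simp add: L2_cont_def L2_01_norm2_def)

lemma eventually_within_L2: "(\<forall>t\<in>S. L2_01 (U t)) \<Longrightarrow> \<forall>\<^sub>F s in at t within S. L2_01 (U s)"
  by (simp add: eventually_at_filter)

lemma L2_cont_ip:
  assumes "L2_cont S U" "L2_cont S V"
  shows "continuous_on S (\<lambda>t. ip (U t) (V t))"
  unfolding continuous_on_def using assms
  by (auto simp: L2_cont_def intro!: ip_tendsto eventually_within_L2)

lemma L2_cont_bounded:
  assumes "L2_cont {a..b} U" obtains M where "M > 0" "\<And>t. t \<in> {a..b} \<Longrightarrow> nrm (U t) \<le> M"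
proof -
  have "continuous_on {a..b} (\<lambda>t. nrm (U t))"
    unfolding nrm_def norm2_eq_ip by (intro continuous_intros L2_cont_ip assms)
  then have "bounded ((\<lambda>t. nrm (U t)) ` {a..b})"
    by (intro compact_imp_bounded compact_continuous_image) auto
  then obtain M where "\<And>t. t \<in> {a..b} \<Longrightarrow> nrm (U t) \<le> M"
    unfolding bounded_iff by fastforce
  then have "nrm (U t) \<le> \<bar>M\<bar> + 1" if "t \<in> {a..b}" for t
    using \<open>\<And>t. t \<in> {a..b} \<Longrightarrow> nrm (U t) \<le> M\<close>[OF that] by linarith
  then show ?thesis using that[of "\<bar>M\<bar> + 1"] by simp
qed

lemma norm2_tendsto_0:
  assumes "(B \<longlongrightarrow> 0) (at t within S)" "\<And>s. \<lbrakk>s \<in> S; s \<noteq> t\<rbrakk> \<Longrightarrow> L2_01_norm2 (p s) \<le> B s"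
  shows "((\<lambda>s. L2_01_norm2 (p s)) \<longlongrightarrow> 0) (at t within S)"
  by (rule Lim_null_comparison[OF _ assms(1)]) (use assms(2) in \<open>auto simp: eventually_at_filter\<close>)

text \<open>The increment is s - t times the sum of the derivative and an error tending to
  0.\<close>

lemma L2_deriv_imp_cont:
  assumes "L2_deriv S U U'" shows "L2_cont S U"
  unfolding L2_cont_def
proof (intro conjI ballI)
  fix t assume t: "t \<in> S"
  show "L2_01 (U t)" using assms t by (simp add: L2_deriv_def)
  define q where "q s x = (U s x - U t x) / (s - t) - U' t x" for s x
  have "((\<lambda>s. L2_01_norm2 (q s)) \<longlongrightarrow> 0) (at t within S)" using assms t by (simp add: L2_deriv_def q_def[abs_def])
  then have "((\<lambda>s. (s - t)\<^sup>2 * (2 * L2_01_norm2 (q s) + 2 * L2_01_norm2 (U' t))) \<longlongrightarrow> 0) (at t within S)"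
    by (auto intro!: tendsto_eq_intros)
  then show "((\<lambda>s. L2_01_norm2 (\<lambda>x. U s x - U t x)) \<longlongrightarrow> 0) (at t within S)"
  proof (rule norm2_tendsto_0)
    fix s assume s: "s \<in> S" "s \<noteq> t"
    have L: "L2_01 (q s)" "L2_01 (U' t)"
      using assms s t by (auto simp: L2_deriv_def q_def[abs_def] intro!: L2_01_diff L2_01_divide)
    have "L2_01_norm2 (\<lambda>x. U s x - U t x) = (s - t)\<^sup>2 * L2_01_norm2 (\<lambda>x. q s x + U' t x)"
      using s unfolding norm2_cmult[symmetric] by (simp add: q_def)
    also have "\<dots> \<le> (s - t)\<^sup>2 * (2 * L2_01_norm2 (q s) + 2 * L2_01_norm2 (U' t))"
      using norm2_add_le[OF L] by (intro mult_left_mono) auto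
    finally show "L2_01_norm2 (\<lambda>x. U s x - U t x) \<le> \<dots>" .
  qed
qed

text \<open>Product rule. The increment of the first factor is paired with \<open>V s\<close>, that
  of the second with \<open>U t\<close>, so continuity of \<open>V\<close> is used besides the two
  derivatives.\<close>

lemma L2_deriv_ip:
  assumes U: "L2_deriv S U U'" and V: "L2_deriv S V V'" and t: "t \<in> S"
  shows "((\<lambda>s. ip (U s) (V s)) has_real_derivative (ip (U' t) (V t) + ip (U t) (V' t))) (at t within S)"
  unfolding has_field_derivative_iff
proof (rule Lim_transform_eventually)
  have LU: "\<forall>t\<in>S. L2_01 (U t)" "\<forall>t\<in>S. L2_01 (U' t)" and LV: "\<forall>t\<in>S. L2_01 (V t)" "\<forall>t\<in>S. L2_01 (V' t)"
    using U V by (auto simp: L2_deriv_def)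
  have Vc: "L2_cont S V" by (rule L2_deriv_imp_cont[OF V])
  have ev: "\<forall>\<^sub>F s in at t within S. L2_01 (\<lambda>x. (U s x - U t x) / (s - t))"
    "\<forall>\<^sub>F s in at t within S. L2_01 (\<lambda>x. (V s x - V t x) / (s - t))"
    unfolding eventually_at_filter using LU LV t
    by (auto intro!: always_eventually L2_01_divide L2_01_diff)
  show "((\<lambda>s. ip (\<lambda>x. (U s x - U t x) / (s - t)) (V s) + ip (U t) (\<lambda>x. (V s x - V t x) / (s - t)))
     \<longlongrightarrow> ip (U' t) (V t) + ip (U t) (V' t)) (at t within S)"
    using U V Vc t LU LV
    by (intro tendsto_add ip_tendsto ev eventually_within_L2)
      (auto simp: L2_deriv_def L2_cont_def L2_01_norm2_def)
  show "\<forall>\<^sub>F s in at t within S. ip (\<lambda>x. (U s x - U t x) / (s - t)) (V s) + ip (U t) (\<lambda>x. (V s x - V t x) / (s - t))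
     = (ip (U s) (V s) - ip (U t) (V t)) / (s - t)"
    unfolding eventually_at_filter
  proof (intro always_eventually allI impI)
    fix s assume "s \<in> S"
    then have L: "L2_01 (U s)" "L2_01 (U t)" "L2_01 (V s)" "L2_01 (V t)" using LU LV t by auto
    show "ip (\<lambda>x. (U s x - U t x) / (s - t)) (V s) + ip (U t) (\<lambda>x. (V s x - V t x) / (s - t))
       = (ip (U s) (V s) - ip (U t) (V t)) / (s - t)"
      by (simp only: ip_divide_left ip_divide_right ip_diff_left[OF L(1,2,3)] ip_diff_right[OF L(3,4,2)])
        (simp add: diff_divide_distrib)
  qed
qed

lemma L2_cont_subset: "L2_cont S U \<Longrightarrow> S' \<subseteq> S \<Longrightarrow> L2_cont S' U"
  unfolding L2_cont_def by (meson subsetD tendsto_within_subset)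

lemma L2_cont_bounded_mult:
  assumes "L2_cont S V" "b \<in> borel_measurable M01" "\<And>x. x \<in> {0<..<1} \<Longrightarrow> \<bar>b x\<bar> \<le> B"
  shows "L2_cont S (\<lambda>t x. b x * V t x)"
  unfolding L2_cont_def
proof (intro conjI ballI)
  fix t assume t: "t \<in> S"
  show "L2_01 (\<lambda>x. b x * V t x)"
    using assms t by (intro L2_01_bounded_mult) (auto simp: L2_cont_def)
  have "((\<lambda>s. B\<^sup>2 * L2_01_norm2 (\<lambda>x. V s x - V t x)) \<longlongrightarrow> 0) (at t within S)"
    using assms t by (auto simp: L2_cont_def intro!: tendsto_mult_right_zero)
  then show "((\<lambda>s. L2_01_norm2 (\<lambda>x. b x * V s x - b x * V t x)) \<longlongrightarrow> 0) (at t within S)"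
  proof (rule norm2_tendsto_0)
    fix s assume "s \<in> S"
    then have "L2_01 (\<lambda>x. V s x - V t x)" using assms t by (auto simp: L2_cont_def intro!: L2_01_diff)
    from norm2_bounded_mult_le[OF this assms(2,3)]
    show "L2_01_norm2 (\<lambda>x. b x * V s x - b x * V t x) \<le> B\<^sup>2 * L2_01_norm2 (\<lambda>x. V s x - V t x)"
      by (simp add: right_diff_distrib)
  qed
qed

lemma L2_deriv_bounded_mult:
  assumes "L2_deriv S V V'" "b \<in> borel_measurable M01" "\<And>x. x \<in> {0<..<1} \<Longrightarrow> \<bar>b x\<bar> \<le> B"
  shows "L2_deriv S (\<lambda>t x. b x * V t x) (\<lambda>t x. b x * V' t x)"
  unfolding L2_deriv_def
proof (intro conjI ballI)
  fix t assume t: "t \<in> S"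
  show "L2_01 (\<lambda>x. b x * V t x)" "L2_01 (\<lambda>x. b x * V' t x)"
    using assms t by (intro L2_01_bounded_mult; auto simp: L2_deriv_def)+
  define q where "q s x = (V s x - V t x) / (s - t) - V' t x" for s x
  have eq: "(b x * V s x - b x * V t x) / (s - t) - b x * V' t x = b x * q s x" for s x
    by (simp add: q_def right_diff_distrib diff_divide_distrib)
  have "((\<lambda>s. B\<^sup>2 * L2_01_norm2 (q s)) \<longlongrightarrow> 0) (at t within S)"
    using assms t by (auto simp: L2_deriv_def q_def[abs_def] intro!: tendsto_mult_right_zero)
  then show "((\<lambda>s. L2_01_norm2 (\<lambda>x. (b x * V s x - b x * V t x) / (s - t) - b x * V' t x)) \<longlongrightarrow> 0) (at t within S)"
    unfolding eq
  proof (rule norm2_tendsto_0)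
    fix s assume "s \<in> S"
    then have "L2_01 (q s)" using assms t by (auto simp: L2_deriv_def q_def[abs_def] intro!: L2_01_diff L2_01_divide)
    then show "L2_01_norm2 (\<lambda>x. b x * q s x) \<le> B\<^sup>2 * L2_01_norm2 (q s)"
      by (rule norm2_bounded_mult_le[OF _ assms(2,3)])
  qed
qed

lemma filterlim_shift_within:
  assumes "h > (0::real)" 
  shows "filterlim (\<lambda>s. s + h) (at (t + h) within {0..T}) (at t within {0..T - h})"
  unfolding filterlim_at
proof
  show "\<forall>\<^sub>F x in at t within {0..T - h}. x + h \<in> {0..T} \<and> x + h \<noteq> t + h"
    unfolding eventually_at_filter using assms by (intro always_eventually) auto
  show "((\<lambda>s. s + h) \<longlongrightarrow> t + h) (at t within {0..T - h})" by (intro tendsto_intros)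
qed

text \<open>Source of both time derivatives in the averaged equation: applied to u it yields v_tt,
  applied to the time primitive of x^(a/2) u_x it yields x^(a/2) v_tx. The interval shrinks by
  \<open>h\<close> so that \<open>t + h\<close> stays inside [0,T].\<close>

lemma L2_deriv_diff_quot:
  assumes U: "L2_deriv {0..T} U U'" and h: "h > 0"
  shows "L2_deriv {0..T - h} (\<lambda>t x. (U (t + h) x - U t x) / h) (\<lambda>t x. (U' (t + h) x - U' t x) / h)"
  unfolding L2_deriv_def
proof (intro conjI ballI)
  fix t assume t: "t \<in> {0..T - h}"
  have t': "t \<in> {0..T}" "t + h \<in> {0..T}" using t h by auto
  have L: "L2_01 (U t)" "L2_01 (U' t)" "L2_01 (U (t + h))" "L2_01 (U' (t + h))"
    using U t' by (auto simp: L2_deriv_def)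
  show "L2_01 (\<lambda>x. (U (t + h) x - U t x) / h)" "L2_01 (\<lambda>x. (U' (t + h) x - U' t x) / h)"
    using L by (auto intro!: L2_01_diff L2_01_divide)
  define q where "q s x = (U s x - U t x) / (s - t) - U' t x" for s x
  define r where "r s x = (U (s + h) x - U (t + h) x) / (s + h - (t + h)) - U' (t + h) x" for s x
  have q: "((\<lambda>s. L2_01_norm2 (q s)) \<longlongrightarrow> 0) (at t within {0..T - h})"
  proof (rule tendsto_within_subset)
    show "((\<lambda>s. L2_01_norm2 (q s)) \<longlongrightarrow> 0) (at t within {0..T})"
      using U t' by (simp add: L2_deriv_def q_def[abs_def])
  qed (use h in auto)
  have "((\<lambda>s. L2_01_norm2 (\<lambda>x. (U s x - U (t + h) x) / (s - (t + h)) - U' (t + h) x)) \<longlongrightarrow> 0) (at (t + h) within {0..T})"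
    using U t' by (auto simp: L2_deriv_def)
  from filterlim_compose[OF this filterlim_shift_within[OF h]]
  have r: "((\<lambda>s. L2_01_norm2 (r s)) \<longlongrightarrow> 0) (at t within {0..T - h})"
    by (simp add: r_def[abs_def])
  have "((\<lambda>s. (1/h)\<^sup>2 * (2 * L2_01_norm2 (r s) + 2 * L2_01_norm2 (q s))) \<longlongrightarrow> 0) (at t within {0..T - h})"
    using q r by (auto intro!: tendsto_eq_intros)
  then show "((\<lambda>s. L2_01_norm2 (\<lambda>x. ((U (s + h) x - U s x) / h - (U (t + h) x - U t x) / h) / (s - t) - (U' (t + h) x - U' t x) / h)) \<longlongrightarrow> 0) (at t within {0..T - h})"
  proof (rule norm2_tendsto_0)
    fix s assume s: "s \<in> {0..T - h}" "s \<noteq> t"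
    have "L2_01 (U s)" "L2_01 (U (s + h))" using U s h by (auto simp: L2_deriv_def)
    then have Lq: "L2_01 (q s)" and Lr: "L2_01 (r s)"
      using L by (auto simp: q_def[abs_def] r_def[abs_def] intro!: L2_01_diff L2_01_divide)
    have eq: "((U (s + h) x - U s x) / h - (U (t + h) x - U t x) / h) / (s - t) - (U' (t + h) x - U' t x) / h = (1/h) * (r s x - q s x)" for x
      using s h by (simp add: q_def r_def divide_simps) (simp add: algebra_simps)
    show "L2_01_norm2 (\<lambda>x. ((U (s + h) x - U s x) / h - (U (t + h) x - U t x) / h) / (s - t) - (U' (t + h) x - U' t x) / h)
        \<le> (1/h)\<^sup>2 * (2 * L2_01_norm2 (r s) + 2 * L2_01_norm2 (q s))"
      unfolding eq norm2_cmult using norm2_diff_le[OF Lr Lq] by (intro mult_left_mono) auto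
  qed
qed

section \<open>Fubini for Lebesgue measurable functions on the cylinder\<close>

lemma AE_lebesgue_on_iff:
  assumes "S \<in> sets lebesgue"
  shows "(AE x in lebesgue_on S. P x) \<longleftrightarrow> (AE x in lebesgue. x \<in> S \<longrightarrow> P x)"
  using assms by (subst AE_restrict_space_iff) auto

text \<open>Lebesgue measure on the plane is the completion of a product, not itself the product of
  the completed line measures. Fubini is therefore applied to a Borel function that agrees almost
  everywhere with the extension by 0, and the results are carried back here.\<close>

lemma lebesgue_on_Borel_version:
  fixes v v0 :: "'a::euclidean_space \<Rightarrow> real"
  assumes S: "S \<in> sets borel" and v0: "v0 \<in> borel_measurable borel"
    and eq: "AE x in lborel. v0 x = indicator S x * v x"
  shows "v \<in> borel_measurable (lebesgue_on S)"
    "integrable (lebesgue_on S) v \<longleftrightarrow> integrable lborel v0"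
    "(LINT x|lebesgue_on S. v x) = (LINT x|lborel. v0 x)"
proof -
  have S': "S \<inter> space lebesgue \<in> sets lebesgue" using S by auto
  have eq': "AE x in lebesgue. v0 x = indicator S x * v x" using eq by (rule AE_completion)
  have v0': "v0 \<in> borel_measurable lebesgue" "v0 \<in> borel_measurable lborel"
    using v0 by (auto intro: measurable_completion)
  have m: "(\<lambda>x. indicator S x * v x) \<in> borel_measurable lebesgue"
    by (rule borel_measurable_AE[OF v0'(1) eq'])
  then show "v \<in> borel_measurable (lebesgue_on S)"
    using S' by (subst borel_measurable_restrict_space_iff) auto
  have "integrable (lebesgue_on S) v \<longleftrightarrow> integrable lebesgue (\<lambda>x. indicator S x * v x)"
    using S' by (subst integrable_restrict_space) auto
  also have "\<dots> \<longleftrightarrow> integrable lebesgue v0"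
    using eq' by (intro integrable_cong_AE m v0') (auto elim: eventually_mono)
  finally show "integrable (lebesgue_on S) v \<longleftrightarrow> integrable lborel v0"
    using v0' by (simp add: integrable_completion)
  have "(LINT x|lebesgue_on S. v x) = (LINT x|lebesgue. indicator S x * v x)"
    using S' by (subst integral_restrict_space) auto
  also have "\<dots> = (LINT x|lebesgue. v0 x)"
    using eq' by (intro integral_cong_AE m v0') (auto elim: eventually_mono)
  finally show "(LINT x|lebesgue_on S. v x) = (LINT x|lborel. v0 x)"
    using v0' by (simp add: integral_completion)
qed

lemma lebesgue_on_Borel_version_exists:
  fixes v :: "'a::euclidean_space \<Rightarrow> real"
  assumes S: "S \<in> sets borel" and v: "v \<in> borel_measurable (lebesgue_on S)"
  obtains v0 where "v0 \<in> borel_measurable borel" "AE x in lborel. v0 x = indicator S x * v x"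
proof -
  have S': "S \<inter> space lebesgue \<in> sets lebesgue" using S by auto
  have "(\<lambda>x. indicator S x * v x) \<in> borel_measurable lebesgue"
    using v S' by (subst (asm) borel_measurable_restrict_space_iff) auto
  then obtain v0 where "v0 \<in> borel_measurable lborel" "AE x in lborel. indicator S x * v x = v0 x"
    using completion_ex_borel_measurable_real by blast
  then have "AE x in lborel. v0 x = indicator S x * v x" "v0 \<in> borel_measurable borel"
    by (auto elim: eventually_mono)
  then show ?thesis by (intro that)
qed

lemma AE_lborel_pair:
  fixes P :: "real \<times> real \<Rightarrow> bool"
  assumes "AE p in lborel. P p"
  shows "AE t in lborel. AE x in lborel. P (t, x)" "AE x in lborel. AE t in lborel. P (t, x)"
proof -
  have P: "AE p in lborel \<Otimes>\<^sub>M lborel. P p" unfolding lborel_prod by (rule assms)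
  show 1: "AE t in lborel. AE x in lborel. P (t, x)"
    by (rule lborel_pair.AE_pair[OF P])
  \<comment> \<open>Exchanging the two quantifiers needs a measurable set, which \<open>P\<close>
    need not define; the complement of a null set does.\<close>
  obtain N where N: "{p \<in> space (lborel \<Otimes>\<^sub>M lborel). \<not> P p} \<subseteq> N" "N \<in> null_sets (lborel \<Otimes>\<^sub>M lborel)"
    using P by (auto simp: eventually_ae_filter)
  have "AE p in lborel \<Otimes>\<^sub>M lborel. p \<notin> N" using N(2) by (rule AE_not_in)
  from lborel_pair.AE_pair[OF this] have "AE t in lborel. AE x in lborel. (t, x) \<notin> N" .
  moreover have "{p \<in> space (lborel \<Otimes>\<^sub>M lborel). (fst p, snd p) \<notin> N} \<in> sets (lborel \<Otimes>\<^sub>M lborel)"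
  proof -
    have "{p \<in> space (lborel \<Otimes>\<^sub>M lborel). (fst p, snd p) \<notin> N} = space (lborel \<Otimes>\<^sub>M lborel) - N"
      by (auto simp: space_pair_measure)
    then show ?thesis using N(2) by (simp only: null_sets_def mem_Collect_eq sets.compl_sets)
  qed
  ultimately have "AE x in lborel. AE t in lborel. (t, x) \<notin> N"
    using lborel_pair.AE_commute[of "\<lambda>t x. (t, x) \<notin> N"] by simp
  moreover have "P p" if "p \<notin> N" for p using N(1) that by (auto simp: space_pair_measure)
  ultimately show "AE x in lborel. AE t in lborel. P (t, x)"
    by (auto elim!: eventually_mono)
qed

lemma AE_lborel_snd:
  fixes P :: "real \<Rightarrow> bool"
  assumes "AE x in lborel. P x"
  shows "AE p in (lborel :: (real \<times> real) measure). P (snd p)"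
proof -
  obtain N where N: "{x. \<not> P x} \<subseteq> N" "N \<in> null_sets lborel"
    using assms by (auto simp: eventually_ae_filter)
  have "UNIV \<times> N \<in> null_sets (lborel \<Otimes>\<^sub>M (lborel :: real measure))"
    using N(2) by (auto simp: null_sets_def lborel.emeasure_pair_measure_Times)
  then have "UNIV \<times> N \<in> null_sets (lborel :: (real \<times> real) measure)" by (simp add: lborel_prod)
  then show ?thesis using N(1) by (auto simp: eventually_ae_filter intro!: bexI[of _ "UNIV \<times> N"])
qed

text \<open>\<open>\<psi>\<close> is only Lebesgue measurable on the line. Its Borel version lifts
  to the plane, and the line null set where the two differ lifts to a null set of the plane.\<close>

lemma measurable_Qset_times:
  fixes \<psi> \<eta> :: "real \<Rightarrow> real"
  assumes \<psi>: "\<psi> \<in> borel_measurable M01" and \<eta>: "\<eta> \<in> borel_measurable borel"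
  shows "(\<lambda>(t, x). \<eta> t * \<psi> x) \<in> borel_measurable (MQ T)"
proof -
  obtain v0 where v0: "v0 \<in> borel_measurable borel" "AE x in lborel. v0 x = indicator {0<..<1} x * \<psi> x"
    using lebesgue_on_Borel_version_exists[OF _ \<psi>] by auto
  have Q: "Qset T \<in> sets borel" by (auto simp: Qset_def intro!: borel_open open_Times)
  have ev: "AE p in (lborel :: (real \<times> real) measure). v0 (snd p) = indicator {0<..<1} (snd p) * \<psi> (snd p)"
    using AE_lborel_snd[OF v0(2)] .
  have "AE p in lborel. indicator (Qset T) p * (\<eta> (fst p) * v0 (snd p)) = indicator (Qset T) p * (\<lambda>(t, x). \<eta> t * \<psi> x) p"
    using ev by eventually_elim (auto simp: Qset_def indicator_def split: prod.splits)
  then show ?thesis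
  proof (rule lebesgue_on_Borel_version(1)[OF Q, rotated])
    have "(\<lambda>p. \<eta> (fst p) * v0 (snd p)) \<in> borel_measurable (borel \<Otimes>\<^sub>M borel)"
      using v0(1) \<eta> by measurable
    then show "(\<lambda>p. indicator (Qset T) p * (\<eta> (fst p) * v0 (snd p))) \<in> borel_measurable borel"
      using Q by (simp add: borel_prod)
  qed
qed

lemma Qset_borel [simp]: "Qset T \<in> sets borel"
  by (auto simp: Qset_def intro!: borel_open open_Times)

text \<open>The majorant \<open>k\<close> of the slice integrals supplies the finiteness required
  for Fubini. The last two conclusions integrate in time first; they identify pointwise time
  primitives.\<close>

theorem Fubini_Qset:
  fixes g :: "real \<Rightarrow> real \<Rightarrow> real"
  assumes g: "(\<lambda>(t, x). g t x) \<in> borel_measurable (MQ T)"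
    and k: "integrable (I0 T) k"
    and bnd: "AE t in I0 T. integrable M01 (g t) \<and> (LINT x|M01. \<bar>g t x\<bar>) \<le> k t"
  shows "integrable (MQ T) (\<lambda>(t, x). g t x)"
    "integrable (I0 T) (\<lambda>t. LINT x|M01. g t x)"
    "(LINT p|MQ T. g (fst p) (snd p)) = (LINT t|I0 T. LINT x|M01. g t x)"
    "integrable M01 (\<lambda>x. LINT t|I0 T. g t x)"
    "(LINT x|M01. LINT t|I0 T. g t x) = (LINT t|I0 T. LINT x|M01. g t x)"
proof -
  obtain G0 where G0: "G0 \<in> borel_measurable borel" "AE p in lborel. G0 p = indicator (Qset T) p * (\<lambda>(t, x). g t x) p"
    using lebesgue_on_Borel_version_exists[OF Qset_borel g] by metis
  have G0': "(\<lambda>p. G0 p) \<in> borel_measurable (lborel \<Otimes>\<^sub>M lborel)" "case_prod (\<lambda>t x. G0 (t, x)) \<in> borel_measurable (lborel \<Otimes>\<^sub>M lborel)"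
    using G0(1) by (simp_all add: lborel_prod)
  have ind: "indicator (Qset T) (t, x) * g t x = indicator {0<..<T} t * (indicator {0<..<1} x * g t x)"
    "indicator (Qset T) (t, x) * g t x = indicator {0<..<1} x * (indicator {0<..<T} t * g t x)" for t x
    by (auto simp: Qset_def indicator_def)
  have sl1: "G0 \<circ> Pair t \<in> borel_measurable borel" and sl2: "(\<lambda>t. G0 (t, x)) \<in> borel_measurable borel" for t x
    using G0(1) by (auto intro!: measurable_compose[OF _ G0(1)] simp: comp_def borel_prod[symmetric])
  have A1: "AE t in lborel. AE x in lborel. G0 (t, x) = indicator {0<..<T} t * (indicator {0<..<1} x * g t x)"
    using AE_lborel_pair(1)[OF G0(2)] by (simp add: ind(1))
  have A2: "AE x in lborel. AE t in lborel. G0 (t, x) = indicator {0<..<1} x * (indicator {0<..<T} t * g t x)"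
    using AE_lborel_pair(2)[OF G0(2)] by (simp add: ind(2))
  \<comment> \<open>Almost every time slice of the Borel version agrees almost everywhere with
    \<open>g t\<close> extended by 0, and vanishes almost everywhere for t outside (0,T). This
    transfers integrability and integrals slice by slice.\<close>
  have slice1: "AE t in lborel. (integrable M01 (g t) \<and> t \<in> {0<..<T} \<longrightarrow> integrable lborel (\<lambda>x. G0 (t, x)))
      \<and> (LINT x|lborel. G0 (t, x)) = indicator {0<..<T} t * (LINT x|M01. g t x)
      \<and> (LINT x|lborel. \<bar>G0 (t, x)\<bar>) = indicator {0<..<T} t * (LINT x|M01. \<bar>g t x\<bar>) \<and> (t \<notin> {0<..<T} \<longrightarrow> integrable lborel (\<lambda>x. G0 (t, x)))"
    using A1
  proof eventually_elim
    case (elim t)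
    have m: "(\<lambda>x. G0 (t, x)) \<in> borel_measurable borel" using sl1[of t] by (simp add: comp_def)
    show ?case
    proof (cases "t \<in> {0<..<T}")
      case True
      then have e: "AE x in lborel. G0 (t, x) = indicator {0<..<1} x * g t x" using elim by simp
      have e': "AE x in lborel. \<bar>G0 (t, x)\<bar> = indicator {0<..<1} x * \<bar>g t x\<bar>"
        using e by eventually_elim (auto simp: indicator_def)
      have m': "(\<lambda>x. \<bar>G0 (t, x)\<bar>) \<in> borel_measurable borel" using m by simp
      show ?thesis
        using lebesgue_on_Borel_version(2,3)[OF _ m e] lebesgue_on_Borel_version(3)[OF _ m' e'] True by simp
    next
      case False
      then have e: "AE x in lborel. G0 (t, x) = 0" using elim by simp
      have "integrable lborel (\<lambda>x. G0 (t, x)) \<longleftrightarrow> integrable lborel (\<lambda>x::real. 0::real)"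
        using m e by (intro integrable_cong_AE) auto
      moreover have "(LINT x|lborel. \<bar>G0 (t, x)\<bar>) = (LINT x|(lborel::real measure). (0::real))"
        using m e by (intro integral_cong_AE) auto
      moreover have "(LINT x|lborel. G0 (t, x)) = (LINT x|(lborel::real measure). (0::real))"
        using m e by (intro integral_cong_AE) auto
      ultimately show ?thesis using False by simp
    qed
  qed
  obtain k0 where k0: "k0 \<in> borel_measurable borel" "AE t in lborel. k0 t = indicator {0<..<T} t * k t"
    by (rule lebesgue_on_Borel_version_exists[OF borel_open[OF open_greaterThanLessThan] borel_measurable_integrable[OF k]])
  have k0i: "integrable lborel k0"
    using lebesgue_on_Borel_version(2)[OF _ k0] k by simp
  have bnd': "AE t in lborel. t \<in> {0<..<T} \<longrightarrow> integrable M01 (g t) \<and> (LINT x|M01. \<bar>g t x\<bar>) \<le> k t"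
  proof -
    have S: "{0<..<T} \<in> sets lebesgue" by simp
    show ?thesis using bnd unfolding AE_lebesgue_on_iff[OF S] AE_completion_iff .
  qed
  have G0i: "integrable (lborel \<Otimes>\<^sub>M lborel) G0"
  proof (rule lborel_pair.Fubini_integrable[OF G0'(1)])
    show "AE t in lborel. integrable lborel (\<lambda>x. G0 (t, x))"
      using slice1 bnd' by eventually_elim auto
    show "integrable lborel (\<lambda>t. LINT x|lborel. norm (G0 (t, x)))"
    proof (rule Bochner_Integration.integrable_bound[OF k0i])
      show "(\<lambda>t. LINT x|lborel. norm (G0 (t, x))) \<in> borel_measurable lborel"
        using G0'(1) by measurable
      show "AE t in lborel. norm (LINT x|lborel. norm (G0 (t, x))) \<le> norm (k0 t)"
        using slice1 bnd' k0(2) by eventually_elim (auto simp: indicator_def)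
    qed
  qed
  have G0i2: "integrable lborel G0" using G0i by (simp add: lborel_prod)
  note QV = lebesgue_on_Borel_version(2,3)[OF Qset_borel G0]
  show Qi: "integrable (MQ T) (\<lambda>(t, x). g t x)"
    using QV(1) G0i2 by simp
  have cp: "case_prod (\<lambda>t x. G0 (t, x)) = G0" by auto
  have t0: "(\<lambda>t. LINT x|lborel. G0 (t, x)) \<in> borel_measurable borel"
    using G0'(1) by measurable
  have te: "AE t in lborel. (LINT x|lborel. G0 (t, x)) = indicator {0<..<T} t * (LINT x|M01. g t x)"
    using slice1 by eventually_elim simp
  have fst_i: "integrable lborel (\<lambda>t. LINT x|lborel. G0 (t, x))"
    using lborel_pair.integrable_fst[of "\<lambda>t x. G0 (t, x)"] G0i cp by simp
  show ti: "integrable (I0 T) (\<lambda>t. LINT x|M01. g t x)"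
    using lebesgue_on_Borel_version(2)[OF _ t0 te] fst_i by simp
  have tint: "(LINT t|I0 T. LINT x|M01. g t x) = (LINT t|lborel. LINT x|lborel. G0 (t, x))"
    using lebesgue_on_Borel_version(3)[OF _ t0 te] by simp
  have "(LINT p|MQ T. g (fst p) (snd p)) = (LINT p|lborel. G0 p)"
    using QV(2) by (simp add: case_prod_beta')
  also have "\<dots> = (LINT t|lborel. LINT x|lborel. G0 (t, x))"
    using lborel_pair.integral_fst[of "\<lambda>t x. G0 (t, x)"] G0i cp by (simp add: lborel_prod)
  finally show "(LINT p|MQ T. g (fst p) (snd p)) = (LINT t|I0 T. LINT x|M01. g t x)"
    using tint by simp
  have x0: "(\<lambda>x. LINT t|lborel. G0 (t, x)) \<in> borel_measurable borel"
    using G0(1) by (simp add: borel_prod[symmetric])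
  have xe: "AE x in lborel. (LINT t|lborel. G0 (t, x)) = indicator {0<..<1} x * (LINT t|I0 T. g t x)"
    using A2
  proof eventually_elim
    case (elim x)
    show ?case
    proof (cases "x \<in> {0<..<1}")
      case True
      then show ?thesis using lebesgue_on_Borel_version(3)[OF _ sl2[of x], of "{0<..<T}" "\<lambda>t. g t x"] elim by simp
    next
      case False
      then have "AE t in lborel. G0 (t, x) = 0" using elim by simp
      then have "(LINT t|lborel. G0 (t, x)) = (LINT t|(lborel::real measure). (0::real))"
        using sl2[of x] by (intro integral_cong_AE) auto
      then show ?thesis using False by simp
    qed
  qed
  have "integrable lborel (\<lambda>x. LINT t|lborel. G0 (t, x))"
    using lborel_pair.integrable_snd[of "\<lambda>t x. G0 (t, x)"] G0i cp by simp
  then show "integrable M01 (\<lambda>x. LINT t|I0 T. g t x)"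
    using lebesgue_on_Borel_version(2)[OF _ x0 xe] by simp
  have "(LINT x|M01. LINT t|I0 T. g t x) = (LINT x|lborel. LINT t|lborel. G0 (t, x))"
    using lebesgue_on_Borel_version(3)[OF _ x0 xe] by simp
  also have "\<dots> = (LINT t|lborel. LINT x|lborel. G0 (t, x))"
    using lborel_pair.Fubini_integral[of "\<lambda>t x. G0 (t, x)"] G0i cp by simp
  finally show "(LINT x|M01. LINT t|I0 T. g t x) = (LINT t|I0 T. LINT x|M01. g t x)"
    using tint by simp
qed

section \<open>Time primitives of curves\<close>

lemma integrable_lebesgue_on_subset:
  fixes f :: "'a::euclidean_space \<Rightarrow> real"
  assumes "integrable (lebesgue_on S) f" "S' \<subseteq> S" "S \<in> sets lebesgue" "S' \<in> sets lebesgue"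
  shows "integrable (lebesgue_on S') f"
proof -
  have "integrable lebesgue (\<lambda>x. indicator S x *\<^sub>R f x)"
    using assms by (subst (asm) integrable_restrict_space) auto
  from integrable_mult_indicator[OF assms(4) this]
  have "integrable lebesgue (\<lambda>x. indicator S' x *\<^sub>R (indicator S x *\<^sub>R f x))" .
  moreover have "(\<lambda>x. indicator S' x *\<^sub>R (indicator S x *\<^sub>R f x)) = (\<lambda>x. indicator S' x *\<^sub>R f x)"
    using assms(2) by (auto simp: fun_eq_iff split: split_indicator)
  ultimately have "integrable lebesgue (\<lambda>x. indicator S' x *\<^sub>R f x)" by (simp only:)
  then show ?thesis using assms(4) by (subst integrable_restrict_space) auto
qed

lemma AE_lebesgue_on_subset:
  assumes "AE x in lebesgue_on S. P x" "S' \<subseteq> S" "S \<in> sets lebesgue" "S' \<in> sets lebesgue"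
  shows "AE x in lebesgue_on S'. P x"
  using assms(1,2) unfolding AE_lebesgue_on_iff[OF assms(3)] AE_lebesgue_on_iff[OF assms(4)]
  by (auto elim!: eventually_mono)

lemma Qset_mono: "t \<le> T \<Longrightarrow> Qset t \<subseteq> Qset T"
  by (auto simp: Qset_def)

lemma L2_01_abs: "L2_01 v \<Longrightarrow> L2_01 (\<lambda>x. \<bar>v x\<bar>)"
  by (auto simp: L2_01_def)

lemma nrm_abs: "nrm (\<lambda>x. \<bar>v x\<bar>) = nrm v"
  by (simp add: nrm_def L2_01_norm2_def)

lemma L2_01_const: "L2_01 (\<lambda>x. c)"
  by (rule L2_01_bounded[where B="\<bar>c\<bar>"]) auto

text \<open>Integral of the curve over (0,t), computed separately at each x. That it behaves like
  the integral of an L^2-valued function is shown through its pairings with fixed functions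
  (\<open>ip_tprim\<close>).\<close>

definition tprim :: "(real \<Rightarrow> real \<Rightarrow> real) \<Rightarrow> real \<Rightarrow> real \<Rightarrow> real" where
  "tprim W t x = (LINT r|I0 t. W r x)"

text \<open>The hypothesis is shared by curves bounded in \<open>L\<^sup>2\<close> and by \<open>f \<in> L\<^sup>1(0,T;L\<^sup>2)\<close>.\<close>
definition L2_dominated :: "real \<Rightarrow> (real \<Rightarrow> real \<Rightarrow> real) \<Rightarrow> (real \<Rightarrow> real) \<Rightarrow> bool" where
  "L2_dominated T W k \<longleftrightarrow> (\<lambda>(t, x). W t x) \<in> borel_measurable (MQ T) \<and>
     integrable (I0 T) k \<and>
     (AE r in I0 T. L2_01 (W r) \<and> nrm (W r) \<le> k r)"

lemma L2_dominated_subset: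
  assumes "L2_dominated T W k" "t \<le> T" shows "L2_dominated t W k"
  unfolding L2_dominated_def
proof (intro conjI)
  have "{0<..<t} \<subseteq> {0<..<T}" using assms(2) by auto
  then show "integrable (I0 t) k" "AE r in I0 t. L2_01 (W r) \<and> nrm (W r) \<le> k r"
    using assms(1) unfolding L2_dominated_def
    by (auto intro: integrable_lebesgue_on_subset AE_lebesgue_on_subset)
  show "(\<lambda>(t, x). W t x) \<in> borel_measurable (MQ t)"
    using assms(1) Qset_mono[OF assms(2)] unfolding L2_dominated_def by (blast intro: measurable_restrict_mono)
qed

text \<open>Cauchy-Schwarz in x bounds the slice integrals by \<open>B * (k t * nrm z)\<close>,
  which is integrable in t; so \<open>Fubini_Qset\<close> applies to the curve times a product
  function.\<close>

lemma L2_dominated_Fubini: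
  assumes W: "L2_dominated T W k" and z: "L2_01 z" and \<eta>: "\<eta> \<in> borel_measurable borel" "\<And>t. \<bar>\<eta> t\<bar> \<le> B"
  shows "integrable (MQ T) (\<lambda>(t, x). W t x * (\<eta> t * z x))"
    "integrable (I0 T) (\<lambda>t. \<eta> t * ip (W t) z)"
    "(LINT p|MQ T. W (fst p) (snd p) * (\<eta> (fst p) * z (snd p))) = (LINT t|I0 T. \<eta> t * ip (W t) z)"
    "integrable M01 (\<lambda>x. LINT t|I0 T. W t x * (\<eta> t * z x))"
    "(LINT x|M01. LINT t|I0 T. W t x * (\<eta> t * z x)) = (LINT t|I0 T. \<eta> t * ip (W t) z)"
proof -
  have m: "(\<lambda>(t, x). W t x * (\<eta> t * z x)) \<in> borel_measurable (MQ T)"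
  proof -
    have "(\<lambda>p. W (fst p) (snd p)) \<in> borel_measurable (MQ T)"
      using W by (simp add: L2_dominated_def case_prod_beta')
    moreover have "(\<lambda>p. \<eta> (fst p) * z (snd p)) \<in> borel_measurable (MQ T)"
      using measurable_Qset_times[OF L2_01_measurable[OF z] \<eta>(1), of T] by (simp add: case_prod_beta')
    ultimately show ?thesis unfolding case_prod_beta' by (rule borel_measurable_times)
  qed
  have k: "integrable (I0 T) (\<lambda>t. B * (k t * nrm z))"
    using W by (auto simp: L2_dominated_def)
  have "AE t in I0 T. L2_01 (W t) \<and> nrm (W t) \<le> k t"
    using W by (simp add: L2_dominated_def)
  then have bnd: "AE t in I0 T. integrable M01 (\<lambda>x. W t x * (\<eta> t * z x)) \<and>
      (LINT x|M01. \<bar>W t x * (\<eta> t * z x)\<bar>) \<le> B * (k t * nrm z)"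
  proof eventually_elim
    case (elim t)
    have "(LINT x|M01. \<bar>W t x * (\<eta> t * z x)\<bar>) = \<bar>\<eta> t\<bar> * ip (\<lambda>x. \<bar>W t x\<bar>) (\<lambda>x. \<bar>z x\<bar>)"
      by (simp add: ip_def abs_mult ac_simps)
    also have "ip (\<lambda>x. \<bar>W t x\<bar>) (\<lambda>x. \<bar>z x\<bar>) \<le> nrm (W t) * nrm z"
      using ip_Cauchy_Schwarz[OF L2_01_abs L2_01_abs, of "W t" z] elim z by (simp add: nrm_abs)
    also have "\<bar>\<eta> t\<bar> * (nrm (W t) * nrm z) \<le> B * (k t * nrm z)"
      using elim \<eta>(2)[of t] order_trans[OF nrm_nonneg, of "W t" "k t"]
      by (intro mult_mono) (auto intro: mult_right_mono order_trans[OF abs_ge_zero])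
    finally show ?case
      using L2_01_mult_integrable[of "W t" "\<lambda>x. \<eta> t * z x"] elim z by (simp add: L2_01_cmult mult_left_mono)
  qed
  have inner: "(LINT x|M01. W t x * (\<eta> t * z x)) = \<eta> t * ip (W t) z" for t
    using ip_cmult_left[of "\<eta> t" z "W t"] by (simp add: ip_def mult.commute)
  note F = Fubini_Qset[OF m k bnd, unfolded inner]
  show "integrable (MQ T) (\<lambda>(t, x). W t x * (\<eta> t * z x))" by (rule F(1))
  show "integrable (I0 T) (\<lambda>t. \<eta> t * ip (W t) z)" by (rule F(2))
  show "(LINT p|MQ T. W (fst p) (snd p) * (\<eta> (fst p) * z (snd p))) = (LINT t|I0 T. \<eta> t * ip (W t) z)"
    by (rule F(3))
  show "integrable M01 (\<lambda>x. LINT t|I0 T. W t x * (\<eta> t * z x))" by (rule F(4))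
  show "(LINT x|M01. LINT t|I0 T. W t x * (\<eta> t * z x)) = (LINT t|I0 T. \<eta> t * ip (W t) z)"
    by (rule F(5))
qed

lemma ip_tprim:
  assumes W: "L2_dominated T W k" and t: "t \<le> T" and z: "L2_01 z"
  shows "integrable (I0 t) (\<lambda>r. ip (W r) z)"
    "integrable M01 (\<lambda>x. tprim W t x * z x)"
    "ip (tprim W t) z = (LINT r|I0 t. ip (W r) z)"
  using L2_dominated_Fubini(2,4,5)[OF L2_dominated_subset[OF W t] z, of "\<lambda>t. 1" 1]
  by (simp_all add: tprim_def ip_def)

lemma LINT_ip_le:
  assumes W: "L2_dominated T W k" and t: "t \<le> T" and z: "L2_01 z"
  shows "\<bar>LINT r|I0 t. ip (W r) z\<bar> \<le> (LINT r|I0 t. k r) * nrm z"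
proof -
  note Wt = L2_dominated_subset[OF W t]
  have "\<bar>LINT r|I0 t. ip (W r) z\<bar> \<le> (LINT r|I0 t. \<bar>ip (W r) z\<bar>)"
    by (rule integral_abs_bound)
  also have "\<dots> \<le> (LINT r|I0 t. k r * nrm z)"
  proof (rule integral_mono_AE)
    show "integrable (I0 t) (\<lambda>r. \<bar>ip (W r) z\<bar>)"
      using ip_tprim(1)[OF W t z] by simp
    show "integrable (I0 t) (\<lambda>r. k r * nrm z)"
      using Wt by (simp add: L2_dominated_def)
    have "AE r in I0 t. L2_01 (W r) \<and> nrm (W r) \<le> k r"
      using Wt by (simp add: L2_dominated_def)
    then show "AE r in I0 t. \<bar>ip (W r) z\<bar> \<le> k r * nrm z"
    proof eventually_elim
      case (elim r)
      show ?case
        using order_trans[OF ip_Cauchy_Schwarz[OF conjunct1[OF elim] z] mult_right_mono[OF conjunct2[OF elim] nrm_nonneg]] .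
    qed
  qed
  finally show ?thesis by simp
qed

text \<open>Square integrability of the primitive follows by testing with its bounded truncations.\<close>
lemma L2_01_tprim:
  assumes W: "L2_dominated T W k" and t: "t \<le> T"
  shows "L2_01 (tprim W t)"
proof -
  define v where "v = tprim W t"
  define K where "K = (LINT r|I0 t. k r)"
  define z where "z n x = (if \<bar>v x\<bar> \<le> real n then v x else 0)" for n x
  have m: "v \<in> borel_measurable M01"
    using ip_tprim(2)[OF W t L2_01_const[of 1]] by (simp add: v_def borel_measurable_integrable)
  have z: "L2_01 (z n)" for n
    unfolding z_def[abs_def] using m by (intro L2_01_bounded[where B="real n"]) auto
  have zK: "L2_01_norm2 (z n) \<le> K\<^sup>2" for n
  proof -
    have "L2_01_norm2 (z n) = ip v (z n)"
      \<comment> \<open>Each value of \<open>z n\<close> is that of \<open>v\<close> or 0, so its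
        square is \<open>v\<close> times \<open>z n\<close>. The duality bound then limits the norm
        of \<open>z n\<close> by |K|, uniformly in n.\<close>
      unfolding norm2_eq_ip ip_def by (intro Bochner_Integration.integral_cong) (auto simp: z_def)
    also have "\<dots> \<le> K * nrm (z n)"
      using ip_tprim(3)[OF W t z] LINT_ip_le[OF W t z, of n] by (simp add: v_def K_def)
    finally have le: "nrm (z n) * nrm (z n) \<le> K * nrm (z n)" by (simp add: nrm_power2[symmetric] power2_eq_square)
    have "nrm (z n) \<le> \<bar>K\<bar>"
    proof (cases "nrm (z n) = 0")
      case False
      then have "nrm (z n) > 0" using nrm_nonneg[of "z n"] by linarith
      then show ?thesis using le by simp
    qed simp
    then show ?thesis using power_mono[OF _ nrm_nonneg, of "z n" "\<bar>K\<bar>" 2] by (simp add: nrm_power2)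
  qed
  \<comment> \<open>Fatou's lemma removes the truncation: at each x, \<open>z n x\<close> equals
    \<open>v x\<close> for all large n.\<close>
  have "(\<integral>\<^sup>+x. ennreal ((v x)\<^sup>2) \<partial>M01) = (\<integral>\<^sup>+x. liminf (\<lambda>n. ennreal ((z n x)\<^sup>2)) \<partial>M01)"
  proof (intro nn_integral_cong)
    fix x
    obtain N where "\<bar>v x\<bar> \<le> real N" using real_arch_simple by blast
    then have "eventually (\<lambda>n. ennreal ((z n x)\<^sup>2) = ennreal ((v x)\<^sup>2)) sequentially"
      by (intro eventually_sequentiallyI[of N]) (auto simp: z_def)
    then have "(\<lambda>n. ennreal ((z n x)\<^sup>2)) \<longlonglongrightarrow> ennreal ((v x)\<^sup>2)" by (rule tendsto_eventually)
    then show "ennreal ((v x)\<^sup>2) = liminf (\<lambda>n. ennreal ((z n x)\<^sup>2))"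
      by (intro lim_imp_Liminf[symmetric]) auto
  qed
  also have "\<dots> \<le> liminf (\<lambda>n. \<integral>\<^sup>+x. ennreal ((z n x)\<^sup>2) \<partial>M01)"
    using z by (intro nn_integral_liminf) (auto simp: L2_01_def)
  also have "\<dots> \<le> liminf (\<lambda>n. ennreal (K\<^sup>2))"
  proof (intro Liminf_mono always_eventually allI)
    fix n
    have "(\<integral>\<^sup>+x. ennreal ((z n x)\<^sup>2) \<partial>M01) = ennreal (L2_01_norm2 (z n))"
      unfolding L2_01_norm2_def using z[of n] by (intro nn_integral_eq_integral) (auto simp: L2_01_def)
    then show "(\<integral>\<^sup>+x. ennreal ((z n x)\<^sup>2) \<partial>M01) \<le> ennreal (K\<^sup>2)" using zK[of n] by (simp add: ennreal_leI)
  qed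
  also have "\<dots> = ennreal (K\<^sup>2)" by (simp add: Liminf_const)
  finally have "(\<integral>\<^sup>+x. ennreal ((v x)\<^sup>2) \<partial>M01) < \<infinity>"
    by (rule le_less_trans) simp
  then have "integrable M01 (\<lambda>x. (v x)\<^sup>2)"
    using m by (intro integrableI_nonneg) auto
  then show ?thesis using m by (simp add: L2_01_def v_def)
qed

lemma LINT_eq_integral:
  assumes "integrable (I0 t) (\<phi> :: real \<Rightarrow> real)"
  shows "(LINT r|I0 t. \<phi> r) = integral {0..t} \<phi>"
  using lebesgue_integral_eq_integral[OF assms] by (simp add: integral_open_interval_real)

lemma L2_cont_dominated:
  assumes "(\<lambda>(t, x). W t x) \<in> borel_measurable (MQ T)" "L2_cont {0..T} W"
    "\<And>t. t \<in> {0..T} \<Longrightarrow> nrm (W t) \<le> M"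
  shows "L2_dominated T W (\<lambda>t. M)"
  unfolding L2_dominated_def
proof (intro conjI assms(1))
  show "integrable (I0 T) (\<lambda>t. M)"
    by (intro finite_measure.integrable_const finite_measureI) (cases "0 \<le> T"; simp add: emeasure_restrict_space)
  show "AE r in I0 T. L2_01 (W r) \<and> nrm (W r) \<le> M"
    using assms(2,3) by (intro AE_I2) (auto simp: L2_cont_def)
qed

lemma nrm_le_if_norm2_le:
  assumes "L2_01_norm2 z \<le> c * nrm z" "c \<ge> 0" shows "nrm z \<le> c"
proof (cases "nrm z = 0")
  case False
  then have "nrm z > 0" using nrm_nonneg[of z] by linarith
  then show ?thesis using assms by (simp add: nrm_power2[symmetric] power2_eq_square)
qed (use assms in simp)

text \<open>Let z be the error of the difference quotient. The scalar mean value theorem for the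
  pairing with z gives an intermediate time where \<open>W\<close> paired with z equals the paired
  quotient. Hence ||z||^2 is at most ||W(xi) - W(t)|| ||z||, and continuity of \<open>W\<close>
  concludes.\<close>

lemma L2_deriv_tprim:
  assumes m: "(\<lambda>(t, x). W t x) \<in> borel_measurable (MQ T)" and W: "L2_cont {0..T} W"
  shows "L2_deriv {0..T} (tprim W) W"
  unfolding L2_deriv_def
proof (intro conjI ballI)
  obtain M where M: "\<And>t. t \<in> {0..T} \<Longrightarrow> nrm (W t) \<le> M"
    using L2_cont_bounded[OF W] by metis
  have dom: "L2_dominated T W (\<lambda>t. M)" by (rule L2_cont_dominated[OF m W M])
  have L: "L2_01 (tprim W t)" if "t \<in> {0..T}" for t using that by (intro L2_01_tprim[OF dom]) auto
  fix t assume t: "t \<in> {0..T}"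
  show "L2_01 (tprim W t)" by (rule L[OF t])
  show Wt: "L2_01 (W t)" using W t by (simp add: L2_cont_def)
  have key: "\<exists>\<xi>\<in>{0..T}. \<bar>\<xi> - t\<bar> \<le> \<bar>s - t\<bar> \<and> nrm (\<lambda>x. (tprim W s x - tprim W t x) / (s - t) - W t x) \<le> nrm (\<lambda>x. W \<xi> x - W t x)"
    if s: "s \<in> {0..T}" "s \<noteq> t" for s
  proof -
    define z where "z = (\<lambda>x. (tprim W s x - tprim W t x) / (s - t) - W t x)"
    have z: "L2_01 z" unfolding z_def using L s t Wt by (intro L2_01_diff L2_01_divide) auto
    define \<phi> where "\<phi> r = ip (W r) z" for r
    have c: "continuous_on {0..T} \<phi>" unfolding \<phi>_def by (intro L2_cont_ip W L2_cont_const z)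
    define \<Phi> where "\<Phi> r = integral {0..r} \<phi>" for r
    have ipP: "ip (tprim W r) z = \<Phi> r" if "r \<in> {0..T}" for r
      using ip_tprim(1,3)[OF dom _ z, of r] that by (simp add: \<Phi>_def \<phi>_def[abs_def] LINT_eq_integral)
    \<comment> \<open>Ordering the two times treats \<open>s < t\<close> and \<open>s > t\<close>
      together; the quotient is symmetric in them.\<close>
    define a b where "a = min s t" "b = max s t"
    have ab: "a < b" "{a..b} \<subseteq> {0..T}" using s t by (auto simp: a_b_def)
    have "\<exists>\<xi>\<in>{a..b}. \<Phi> b - \<Phi> a = (\<lambda>h. h * \<phi> \<xi>) (b - a)"
    proof (rule mvt_very_simple)
      fix x assume x: "a \<le> x" "x \<le> b"
      have "(\<Phi> has_vector_derivative \<phi> x) (at x within {0..T})"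
        unfolding \<Phi>_def using x ab by (intro integral_has_vector_derivative c) auto
      then have "(\<Phi> has_vector_derivative \<phi> x) (at x within {a..b})"
        using ab(2) by (rule has_vector_derivative_within_subset)
      then show "(\<Phi> has_derivative (\<lambda>h. h * \<phi> x)) (at x within {a..b})"
        by (simp add: has_vector_derivative_def)
    qed (use ab in auto)
    then obtain \<xi> where \<xi>: "\<xi> \<in> {a..b}" "\<Phi> b - \<Phi> a = (b - a) * \<phi> \<xi>" by auto
    have st: "(\<Phi> s - \<Phi> t) / (s - t) = \<phi> \<xi>"
    proof (cases "s < t")
      case True
      then have "\<Phi> t - \<Phi> s = (t - s) * \<phi> \<xi>" using \<xi>(2) by (simp add: a_b_def)
      then have "\<Phi> s - \<Phi> t = (s - t) * \<phi> \<xi>" by (simp add: algebra_simps)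
      then show ?thesis using True by simp
    next
      case False
      then show ?thesis using \<xi>(2) s by (simp add: a_b_def)
    qed
    have \<xi>T: "\<xi> \<in> {0..T}" using \<xi>(1) ab(2) by blast
    have W\<xi>: "L2_01 (W \<xi>)" using W \<xi>T by (simp add: L2_cont_def)
    have "L2_01_norm2 z = ip (\<lambda>x. (tprim W s x - tprim W t x) / (s - t)) z - ip (W t) z"
      unfolding norm2_eq_ip using ip_diff_left[of "\<lambda>x. (tprim W s x - tprim W t x) / (s - t)" "W t" z] L s t Wt z
      by (simp add: z_def[symmetric] L2_01_divide L2_01_diff)
    also have "\<dots> = ip (W \<xi>) z - ip (W t) z"
      using st ipP s t L z by (simp add: ip_divide_left ip_diff_left \<phi>_def)
    also have "\<dots> = ip (\<lambda>x. W \<xi> x - W t x) z"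
      by (simp add: ip_diff_left[OF W\<xi> Wt z])
    also have "\<dots> \<le> nrm (\<lambda>x. W \<xi> x - W t x) * nrm z"
      using ip_Cauchy_Schwarz[OF L2_01_diff[OF W\<xi> Wt] z] by linarith
    finally have "nrm z \<le> nrm (\<lambda>x. W \<xi> x - W t x)"
      by (rule nrm_le_if_norm2_le) simp
    moreover have "\<bar>\<xi> - t\<bar> \<le> \<bar>s - t\<bar>" using \<xi>(1) by (auto simp: a_b_def min_def max_def split: if_splits)
    ultimately show ?thesis using \<xi>T by (auto simp: z_def)
  qed
  have lim: "((\<lambda>s. L2_01_norm2 (\<lambda>x. W s x - W t x)) \<longlongrightarrow> 0) (at t within {0..T})"
    using W t by (simp add: L2_cont_def)
  show "((\<lambda>s. L2_01_norm2 (\<lambda>x. (tprim W s x - tprim W t x) / (s - t) - W t x)) \<longlongrightarrow> 0) (at t within {0..T})"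
    unfolding tendsto_iff eventually_at
  proof (intro allI impI)
    fix e :: real assume e: "e > 0"
    then obtain d where d: "d > 0" "\<And>s. \<lbrakk>s \<in> {0..T}; s \<noteq> t; dist s t < d\<rbrakk> \<Longrightarrow> L2_01_norm2 (\<lambda>x. W s x - W t x) < e"
      using lim unfolding tendsto_iff eventually_at by (auto simp: dist_real_def)
    have d': "L2_01_norm2 (\<lambda>x. W s x - W t x) < e" if "s \<in> {0..T}" "dist s t < d" for s
      using d(2)[of s] that e by (cases "s = t") (auto simp: L2_01_norm2_def)
    show "\<exists>d>0. \<forall>s\<in>{0..T}. s \<noteq> t \<and> dist s t < d \<longrightarrow> dist (L2_01_norm2 (\<lambda>x. (tprim W s x - tprim W t x) / (s - t) - W t x)) 0 < e"
    proof (intro exI[of _ d] conjI ballI impI d(1))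
      fix s assume s: "s \<in> {0..T}" "s \<noteq> t \<and> dist s t < d"
      then obtain \<xi> where \<xi>: "\<xi> \<in> {0..T}" "\<bar>\<xi> - t\<bar> \<le> \<bar>s - t\<bar>"
        "nrm (\<lambda>x. (tprim W s x - tprim W t x) / (s - t) - W t x) \<le> nrm (\<lambda>x. W \<xi> x - W t x)" using key by blast
      have "L2_01_norm2 (\<lambda>x. (tprim W s x - tprim W t x) / (s - t) - W t x) \<le> L2_01_norm2 (\<lambda>x. W \<xi> x - W t x)"
        using \<xi>(3) by (simp add: nrm_def)
      also have "\<dots> < e" using d' \<xi>(1,2) s by (auto simp: dist_real_def)
      finally show "dist (L2_01_norm2 (\<lambda>x. (tprim W s x - tprim W t x) / (s - t) - W t x)) 0 < e"
        by (simp add: dist_real_def)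
    qed
  qed
qed

lemma L2_deriv_const: "L2_01 z \<Longrightarrow> L2_deriv S (\<lambda>t. z) (\<lambda>t x. 0)"
  by (simp add: L2_deriv_def L2_01_const L2_01_norm2_def)

text \<open>Mean value inequality: the scalar mean value theorem is applied to the pairing with the
  increment itself.\<close>

lemma L2_deriv_nrm_diff_le:
  assumes U: "L2_deriv {0..T} U U'" and M: "\<And>t. t \<in> {0..T} \<Longrightarrow> nrm (U' t) \<le> M" "M \<ge> 0"
    and st: "0 \<le> s" "s \<le> t" "t \<le> T"
  shows "nrm (\<lambda>x. U t x - U s x) \<le> M * (t - s)"
proof -
  have L: "L2_01 (U t)" "L2_01 (U s)" using U st by (auto simp: L2_deriv_def)
  define z where "z = (\<lambda>x. U t x - U s x)"
  have z: "L2_01 z" unfolding z_def by (intro L2_01_diff L)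
  have "\<exists>\<xi>\<in>{s..t}. ip (U t) z - ip (U s) z = (\<lambda>h. ip (U' \<xi>) z * h) (t - s)"
  proof (rule mvt_very_simple[OF st(2)])
    fix x assume x: "s \<le> x" "x \<le> t"
    have "((\<lambda>r. ip (U r) z) has_real_derivative (ip (U' x) z + ip (U x) (\<lambda>x. 0))) (at x within {0..T})"
      using x st by (intro L2_deriv_ip[OF U L2_deriv_const[OF z]]) auto
    then have "((\<lambda>r. ip (U r) z) has_real_derivative ip (U' x) z) (at x within {0..T})" by (simp add: ip_def)
    then have "((\<lambda>r. ip (U r) z) has_real_derivative ip (U' x) z) (at x within {s..t})"
      by (rule DERIV_subset) (use st in auto)
    then show "((\<lambda>r. ip (U r) z) has_derivative (\<lambda>h. ip (U' x) z * h)) (at x within {s..t})"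
      by (simp add: has_field_derivative_def)
  qed
  then obtain \<xi> where \<xi>: "\<xi> \<in> {s..t}" "ip (U t) z - ip (U s) z = ip (U' \<xi>) z * (t - s)" by auto
  have L': "L2_01 (U' \<xi>)" "nrm (U' \<xi>) \<le> M" using U M \<xi> st by (auto simp: L2_deriv_def)
  have "L2_01_norm2 z = ip (U t) z - ip (U s) z"
    unfolding norm2_eq_ip using ip_diff_left[OF L z] by (simp add: z_def[symmetric])
  also have "\<dots> \<le> (nrm (U' \<xi>) * nrm z) * (t - s)"
    unfolding \<xi>(2) using ip_Cauchy_Schwarz[OF L'(1) z] st by (intro mult_right_mono) auto
  also have "\<dots> \<le> (M * nrm z) * (t - s)"
    using L' st by (intro mult_right_mono) auto
  finally have "L2_01_norm2 z \<le> (M * (t - s)) * nrm z" by (simp add: ac_simps)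
  then have "nrm z \<le> M * (t - s)" by (rule nrm_le_if_norm2_le) (use M st in auto)
  then show ?thesis by (simp add: z_def)
qed

section \<open>Consequences of the variational identity\<close>

text \<open>Splitting the weight evenly turns the weighted pairing of x-derivatives into a plain L^2
  inner product, so the curve calculus applies to x^(a/2) u_x.\<close>

definition wt :: "real \<Rightarrow> (real \<Rightarrow> real) \<Rightarrow> real \<Rightarrow> real" where
  "wt a w x = x powr (a / 2) * w x"

lemma wt_mult: "x > 0 \<Longrightarrow> wt a v x * wt a w x = x powr a * v x * w x"
  by (simp add: wt_def powr_add[symmetric] mult.assoc mult.left_commute flip: powr_add)

lemma wt_power2: "x > 0 \<Longrightarrow> (wt a w x)\<^sup>2 = x powr a * (w x)\<^sup>2"
  using wt_mult[of x a w w] by (simp add: power2_eq_square mult.assoc)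

lemma norm2_wt: "L2_01_norm2 (wt a w) = (LINT x|M01. x powr a * (w x)\<^sup>2)"
  unfolding L2_01_norm2_def by (intro Bochner_Integration.integral_cong) (auto simp: wt_power2)

lemma powr_borel_measurable_M01: "(\<lambda>x. x powr b) \<in> borel_measurable M01"
  by (intro measurable_restrict_space1 measurable_completion) simp

lemma L2_01_wt:
  assumes "H1a_pair a v w" shows "L2_01 (wt a w)"
  unfolding L2_01_def
proof
  have w: "w \<in> borel_measurable M01" "integrable M01 (\<lambda>x. x powr a * (w x)\<^sup>2)"
    using assms by (auto simp: H1a_pair_def)
  show "wt a w \<in> borel_measurable M01"
    unfolding wt_def[abs_def] using w powr_borel_measurable_M01 by measurable
  have "integrable M01 (\<lambda>x. (wt a w x)\<^sup>2) \<longleftrightarrow> integrable M01 (\<lambda>x. x powr a * (w x)\<^sup>2)"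
    by (intro Bochner_Integration.integrable_cong) (auto simp: wt_power2)
  then show "integrable M01 (\<lambda>x. (wt a w x)\<^sup>2)" using w by simp
qed

lemma wt_H1a_norm2: "H1a_norm2 a v w = L2_01_norm2 v + L2_01_norm2 (wt a w)"
  by (simp add: H1a_norm2_def norm2_wt)

lemma H1a_pair_L2: "H1a_pair a v w \<Longrightarrow> L2_01 v"
  by (simp add: H1a_pair_def)

lemma integrable_weight_iff:
  assumes "w \<in> borel_measurable M01"
  shows "integrable M01 (\<lambda>x. x powr a * (w x)\<^sup>2) \<longleftrightarrow> L2_01 (wt a w)"
proof -
  have "wt a w \<in> borel_measurable M01"
    unfolding wt_def[abs_def] using assms powr_borel_measurable_M01 by measurable
  moreover have "integrable M01 (\<lambda>x. (wt a w x)\<^sup>2) \<longleftrightarrow> integrable M01 (\<lambda>x. x powr a * (w x)\<^sup>2)"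
    by (intro Bochner_Integration.integrable_cong) (auto simp: wt_power2)
  ultimately show ?thesis by (simp add: L2_01_def)
qed

lemma H1a_pair_cmult:
  assumes "H1a_pair a v w" shows "H1a_pair a (\<lambda>x. c * v x) (\<lambda>x. c * w x)"
proof -
  have w: "w \<in> borel_measurable M01" using assms by (simp add: H1a_pair_def)
  have ac: "abs_cont_on p q (\<lambda>x. c * v x)" if "abs_cont_on p q v" for p q
    by (rule abs_cont_on_mult[OF abs_cont_on_const that])
  have "AE x in lebesgue. x \<in> {0<..<1} \<longrightarrow> (v has_real_derivative w x) (at x)"
    using assms by (simp add: H1a_pair_def)
  then have der: "AE x in lebesgue. x \<in> {0<..<1} \<longrightarrow> ((\<lambda>x. c * v x) has_real_derivative c * w x) (at x)"
    by eventually_elim (auto intro: DERIV_cmult)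
  have "wt a (\<lambda>x. c * w x) = (\<lambda>x. c * wt a w x)" by (auto simp: wt_def)
  then have "L2_01 (wt a (\<lambda>x. c * w x))" using L2_01_cmult[OF L2_01_wt[OF assms]] by simp
  moreover have "(\<lambda>x. c * w x) \<in> borel_measurable M01" using w by simp
  ultimately show ?thesis
    using assms der L2_01_cmult[of v c] unfolding H1a_pair_def loc_abs_cont_0_1_def
    by (auto simp: integrable_weight_iff intro: ac)
qed

lemma H1a_pair_diff:
  assumes "H1a_pair a v w" "H1a_pair a v' w'"
  shows "H1a_pair a (\<lambda>x. v x - v' x) (\<lambda>x. w x - w' x)"
proof -
  have w: "w \<in> borel_measurable M01" "w' \<in> borel_measurable M01" using assms by (auto simp: H1a_pair_def)
  have "AE x in lebesgue. x \<in> {0<..<1} \<longrightarrow> (v has_real_derivative w x) (at x)"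
    "AE x in lebesgue. x \<in> {0<..<1} \<longrightarrow> (v' has_real_derivative w' x) (at x)"
    using assms by (auto simp: H1a_pair_def)
  then have der: "AE x in lebesgue. x \<in> {0<..<1} \<longrightarrow> ((\<lambda>x. v x - v' x) has_real_derivative w x - w' x) (at x)"
    by eventually_elim (auto intro: DERIV_diff)
  have "wt a (\<lambda>x. w x - w' x) = (\<lambda>x. wt a w x - wt a w' x)" by (auto simp: wt_def right_diff_distrib)
  then have "L2_01 (wt a (\<lambda>x. w x - w' x))"
    using L2_01_diff[OF L2_01_wt[OF assms(1)] L2_01_wt[OF assms(2)]] by simp
  moreover have "(\<lambda>x. w x - w' x) \<in> borel_measurable M01" using w by simp
  ultimately show ?thesis
    using assms der L2_01_diff[of v v'] unfolding H1a_pair_def loc_abs_cont_0_1_def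
    by (auto simp: integrable_weight_iff intro: abs_cont_on_diff)
qed

section \<open>Cutoffs in time: 1 up to \<open>s\<close>, 0 from \<open>s + \<kappa>\<close> on,
  linear in between\<close>

definition cutoff :: "real \<Rightarrow> real \<Rightarrow> real \<Rightarrow> real" where
  "cutoff s \<kappa> t = 1 - (max 0 (t - s) - max 0 (t - (s + \<kappa>))) / \<kappa>"

definition cutoff' :: "real \<Rightarrow> real \<Rightarrow> real \<Rightarrow> real" where
  "cutoff' s \<kappa> t = (if s < t \<and> t < s + \<kappa> then - 1 / \<kappa> else 0)"

lemma cutoff_measurable [measurable]: "cutoff s \<kappa> \<in> borel_measurable borel" "cutoff' s \<kappa> \<in> borel_measurable borel"
  unfolding cutoff_def[abs_def] cutoff'_def[abs_def] by measurable

lemma cutoff_eq: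
  assumes "\<kappa> > 0" shows "t \<le> s \<Longrightarrow> cutoff s \<kappa> t = 1" "s + \<kappa> \<le> t \<Longrightarrow> cutoff s \<kappa> t = 0"
  using assms by (simp_all add: cutoff_def)

lemma cutoff_bounds:
  assumes "\<kappa> > 0" shows "\<bar>cutoff s \<kappa> t\<bar> \<le> 1" "\<bar>cutoff' s \<kappa> t\<bar> \<le> 1 / \<kappa>"
proof -
  have "0 \<le> (max 0 (t - s) - max 0 (t - (s + \<kappa>))) / \<kappa>" "(max 0 (t - s) - max 0 (t - (s + \<kappa>))) / \<kappa> \<le> 1"
    using assms by (auto simp: max_def)
  then show "\<bar>cutoff s \<kappa> t\<bar> \<le> 1" unfolding cutoff_def by linarith
qed (use assms in \<open>auto simp: cutoff'_def\<close>)

lemma abs_cont_on_cutoff: "abs_cont_on p q (cutoff s \<kappa>)"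
proof -
  have "cutoff s \<kappa> = (\<lambda>t. 1 - (1 / \<kappa>) * (max 0 (t - s) - max 0 (t - (s + \<kappa>))))" by (auto simp: cutoff_def)
  then show ?thesis by (simp only:) (intro abs_cont_on_diff abs_cont_on_mult abs_cont_on_const abs_cont_on_ramp)
qed

lemma cutoff_deriv:
  assumes "\<kappa> > 0" "t \<noteq> s" "t \<noteq> s + \<kappa>"
  shows "(cutoff s \<kappa> has_real_derivative cutoff' s \<kappa> t) (at t)"
proof -
  have "(cutoff s \<kappa> has_real_derivative 0 - ((if s < t then 1 else 0) - (if s + \<kappa> < t then 1 else 0)) / \<kappa>) (at t)"
    unfolding cutoff_def[abs_def] using assms by (intro DERIV_diff DERIV_cdivide DERIV_const ramp_deriv)
  moreover have "0 - ((if s < t then 1 else 0) - (if s + \<kappa> < t then 1 else 0)) / \<kappa> = cutoff' s \<kappa> t"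
    using assms by (auto simp: cutoff'_def)
  ultimately show ?thesis by simp
qed

lemma L2_dominated_const:
  assumes "L2_01 z" shows "L2_dominated T (\<lambda>t. z) (\<lambda>t. nrm z)"
proof (rule L2_cont_dominated)
  show "(\<lambda>(t, x). z x) \<in> borel_measurable (MQ T)"
    using measurable_Qset_times[OF L2_01_measurable[OF assms], of "\<lambda>t. 1"] by simp
qed (auto intro: L2_cont_const assms)

text \<open>Since the cutoff has reached 0 at \<open>s + \<kappa>\<close>, which is at most
  \<open>T\<close>, the product vanishes at the final time as a test function must.\<close>

lemma test_fun_cutoff:
  assumes \<psi>: "H1a_pair a \<psi> \<psi>'" and \<kappa>: "\<kappa> > 0" and s: "0 \<le> s" "s + \<kappa> \<le> T"
  shows "test_fun a T (\<lambda>t x. cutoff s \<kappa> t * \<psi> x) (\<lambda>t x. cutoff' s \<kappa> t * \<psi> x) (\<lambda>t x. cutoff s \<kappa> t * \<psi>' x)"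
  unfolding test_fun_def
proof (intro conjI)
  have L: "L2_01 \<psi>" "L2_01 (wt a \<psi>')" using \<psi> by (auto intro: H1a_pair_L2 L2_01_wt)
  have m: "\<psi> \<in> borel_measurable M01" "\<psi>' \<in> borel_measurable M01"
    using \<psi> L by (auto simp: H1a_pair_def L2_01_def)
  show "(\<lambda>(t, x). cutoff s \<kappa> t * \<psi> x) \<in> borel_measurable (MQ T)"
    "(\<lambda>(t, x). cutoff s \<kappa> t * \<psi>' x) \<in> borel_measurable (MQ T)"
    "(\<lambda>(t, x). cutoff' s \<kappa> t * \<psi> x) \<in> borel_measurable (MQ T)"
    by (intro measurable_Qset_times m cutoff_measurable)+
  show "AE t in lebesgue. t \<in> {0<..<T} \<longrightarrow> H1a_pair a (\<lambda>x. cutoff s \<kappa> t * \<psi> x) (\<lambda>x. cutoff s \<kappa> t * \<psi>' x)"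
    by (intro AE_I2 impI H1a_pair_cmult[OF \<psi>])
  \<comment> \<open>Integrability over the cylinder is read off from the Fubini lemma for a curve
    constant in time, with the squared cutoff as time factor.\<close>
  have sq1: "(\<lambda>t. (cutoff s \<kappa> t)\<^sup>2) \<in> borel_measurable borel" "\<bar>(cutoff s \<kappa> t)\<^sup>2\<bar> \<le> 1" for t
    using cutoff_bounds(1)[OF \<kappa>, of s t] by (auto simp: abs_square_le_1)
  have i1: "integrable (MQ T) (\<lambda>(t, x). \<psi> x * ((cutoff s \<kappa> t)\<^sup>2 * \<psi> x))"
    by (rule L2_dominated_Fubini(1)[OF L2_dominated_const[OF L(1)] L(1) sq1])
  have i2: "integrable (MQ T) (\<lambda>(t, x). wt a \<psi>' x * ((cutoff s \<kappa> t)\<^sup>2 * wt a \<psi>' x))"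
    by (rule L2_dominated_Fubini(1)[OF L2_dominated_const[OF L(2)] L(2) sq1])
  have i12: "integrable (MQ T) (\<lambda>p. (case p of (t, x) \<Rightarrow> \<psi> x * ((cutoff s \<kappa> t)\<^sup>2 * \<psi> x))
      + (case p of (t, x) \<Rightarrow> wt a \<psi>' x * ((cutoff s \<kappa> t)\<^sup>2 * wt a \<psi>' x)))"
    by (rule Bochner_Integration.integrable_add[OF i1 i2])
  have "(case p of (t, x) \<Rightarrow> \<psi> x * ((cutoff s \<kappa> t)\<^sup>2 * \<psi> x)) + (case p of (t, x) \<Rightarrow> wt a \<psi>' x * ((cutoff s \<kappa> t)\<^sup>2 * wt a \<psi>' x))
      = (case p of (t, x) \<Rightarrow> (cutoff s \<kappa> t * \<psi> x)\<^sup>2 + x powr a * (cutoff s \<kappa> t * \<psi>' x)\<^sup>2)"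
    if "p \<in> space (MQ T)" for p
  proof -
    have "snd p > 0" using that by (auto simp: Qset_def)
    then show ?thesis
      using wt_power2[of "snd p" a \<psi>'] by (cases p) (simp add: power2_eq_square ac_simps)
  qed
  note cg = this
  show "integrable (MQ T) (\<lambda>(t, x). (cutoff s \<kappa> t * \<psi> x)\<^sup>2 + x powr a * (cutoff s \<kappa> t * \<psi>' x)\<^sup>2)"
    by (rule iffD1[OF Bochner_Integration.integrable_cong[OF refl] i12], rule cg)
  have sq2: "(\<lambda>t. (cutoff' s \<kappa> t)\<^sup>2) \<in> borel_measurable borel" "\<bar>(cutoff' s \<kappa> t)\<^sup>2\<bar> \<le> (1/\<kappa>)\<^sup>2" for t
    using power_mono[OF cutoff_bounds(2)[OF \<kappa>, of s t], of 2] unfolding power2_abs by auto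
  have "integrable (MQ T) (\<lambda>(t, x). \<psi> x * ((cutoff' s \<kappa> t)\<^sup>2 * \<psi> x))"
    by (rule L2_dominated_Fubini(1)[OF L2_dominated_const[OF L(1)] L(1) sq2])
  then show "integrable (MQ T) (\<lambda>(t, x). (cutoff' s \<kappa> t * \<psi> x)\<^sup>2)"
    by (simp add: power2_eq_square ac_simps)
  show "AE x in lebesgue. x \<in> {0<..<1} \<longrightarrow> abs_cont_on 0 T (\<lambda>t. cutoff s \<kappa> t * \<psi> x) \<and>
      (AE t in lebesgue. t \<in> {0<..<T} \<longrightarrow> ((\<lambda>t. cutoff s \<kappa> t * \<psi> x) has_real_derivative cutoff' s \<kappa> t * \<psi> x) (at t)) \<and>
      cutoff s \<kappa> T * \<psi> x = 0"
  proof (rule AE_I2, intro impI conjI)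
    fix x :: real
    show "abs_cont_on 0 T (\<lambda>t. cutoff s \<kappa> t * \<psi> x)"
      by (intro abs_cont_on_mult abs_cont_on_const abs_cont_on_cutoff)
    have "AE t in lebesgue. t \<notin> {s, s + \<kappa>}" by (rule AE_lebesgue_notin_finite) simp
    then show "AE t in lebesgue. t \<in> {0<..<T} \<longrightarrow> ((\<lambda>t. cutoff s \<kappa> t * \<psi> x) has_real_derivative cutoff' s \<kappa> t * \<psi> x) (at t)"
      by eventually_elim (use \<kappa> in \<open>auto intro!: DERIV_cmult_right cutoff_deriv\<close>)
    show "cutoff s \<kappa> T * \<psi> x = 0" using cutoff_eq(2)[OF \<kappa> s(2)] by simp
  qed
qed

section \<open>The weak solution as a pair of curves \<open>ut\<close> and \<open>W\<close>\<close>

locale weak_sol =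
  fixes a T :: real and f :: "real \<Rightarrow> real \<Rightarrow> real" and u0 w0 u1 :: "real \<Rightarrow> real"
    and u ut ux :: "real \<Rightarrow> real \<Rightarrow> real"
  assumes T: "T > 0" and a: "0 < a" "a < 2"
    and data: "H1a_pair a u0 w0" "L2_01 u1" "L1L2 T f"
    and weak: "weak_solution a T f u0 u1 u ut ux"
begin

definition W :: "real \<Rightarrow> real \<Rightarrow> real" where "W t = wt a (ux t)"

lemma H1a_u: "t \<in> {0..T} \<Longrightarrow> H1a_pair a (u t) (ux t)"
  using weak by (simp add: weak_solution_def)

lemma L2_deriv_u: "L2_deriv {0..T} u ut"
  using weak H1a_pair_L2[OF H1a_u] unfolding weak_solution_def L2_deriv_def by simp

lemma L2_cont_ut: "L2_cont {0..T} ut"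
  using weak unfolding weak_solution_def L2_cont_def by simp

lemma L2_cont_W: "L2_cont {0..T} W"
  unfolding L2_cont_def
proof (intro conjI ballI)
  fix t assume t: "t \<in> {0..T}"
  show "L2_01 (W t)" unfolding W_def by (rule L2_01_wt[OF H1a_u[OF t]])
  have lim: "((\<lambda>s. H1a_norm2 a (\<lambda>x. u s x - u t x) (\<lambda>x. ux s x - ux t x)) \<longlongrightarrow> 0) (at t within {0..T})"
    using weak t by (simp add: weak_solution_def)
  have "norm (L2_01_norm2 (\<lambda>x. W s x - W t x)) \<le> H1a_norm2 a (\<lambda>x. u s x - u t x) (\<lambda>x. ux s x - ux t x)" for s
  proof -
    have "(\<lambda>x. W s x - W t x) = wt a (\<lambda>x. ux s x - ux t x)"
      by (auto simp: W_def wt_def right_diff_distrib)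
    then show ?thesis by (simp add: wt_H1a_norm2)
  qed
  then show "((\<lambda>s. L2_01_norm2 (\<lambda>x. W s x - W t x)) \<longlongrightarrow> 0) (at t within {0..T})"
    by (intro Lim_null_comparison[OF _ lim] always_eventually allI)
qed

lemma measurable_ut: "(\<lambda>(t, x). ut t x) \<in> borel_measurable (MQ T)"
  using weak by (simp add: weak_solution_def)

lemma measurable_W: "(\<lambda>(t, x). W t x) \<in> borel_measurable (MQ T)"
proof -
  have "(\<lambda>(t, x). ux t x) \<in> borel_measurable (MQ T)"
    using weak by (simp add: weak_solution_def)
  moreover have "(\<lambda>(t, x). 1 * x powr (a / 2)) \<in> borel_measurable (MQ T)"
    by (rule measurable_Qset_times[OF powr_borel_measurable_M01]) simp
  ultimately show ?thesis
    unfolding W_def wt_def case_prod_beta' by (simp add: borel_measurable_times)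
qed

text \<open>\<open>Mt\<close> and \<open>Mx\<close> are finite because the norms are continuous on a
  compact interval. They are carried through the estimates as unknown numbers until
  \<open>energy_bound\<close> compares them with the data.\<close>

definition Mt :: real where "Mt = (SUP t\<in>{0..T}. nrm (ut t))"
definition Mx :: real where "Mx = (SUP t\<in>{0..T}. nrm (W t))"

lemma le_Mt: "t \<in> {0..T} \<Longrightarrow> nrm (ut t) \<le> Mt"
proof -
  assume t: "t \<in> {0..T}"
  obtain M where "\<And>t. t \<in> {0..T} \<Longrightarrow> nrm (ut t) \<le> M"
    using L2_cont_bounded[OF L2_cont_ut] by metis
  then have "bdd_above ((\<lambda>t. nrm (ut t)) ` {0..T})" by (rule bdd_aboveI2)
  then show ?thesis unfolding Mt_def using t by (rule cSUP_upper[rotated])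
qed

lemma le_Mx: "t \<in> {0..T} \<Longrightarrow> nrm (W t) \<le> Mx"
proof -
  assume t: "t \<in> {0..T}"
  obtain M where "\<And>t. t \<in> {0..T} \<Longrightarrow> nrm (W t) \<le> M"
    using L2_cont_bounded[OF L2_cont_W] by metis
  then have "bdd_above ((\<lambda>t. nrm (W t)) ` {0..T})" by (rule bdd_aboveI2)
  then show ?thesis unfolding Mx_def using t by (rule cSUP_upper[rotated])
qed

lemma Mt_nonneg: "Mt \<ge> 0" and Mx_nonneg: "Mx \<ge> 0"
  using order_trans[OF nrm_nonneg le_Mt[of 0]] order_trans[OF nrm_nonneg le_Mx[of 0]] T by auto

lemma dom_ut: "L2_dominated T ut (\<lambda>t. Mt)"
  by (rule L2_cont_dominated[OF measurable_ut L2_cont_ut le_Mt])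

lemma dom_W: "L2_dominated T W (\<lambda>t. Mx)"
  by (rule L2_cont_dominated[OF measurable_W L2_cont_W le_Mx])

lemma dom_f: "L2_dominated T f (\<lambda>t. nrm (f t))"
proof -
  have S: "{0<..<T} \<in> sets lebesgue" by simp
  show ?thesis
    using data(3) unfolding L1L2_def L2_dominated_def AE_lebesgue_on_iff[OF S] nrm_def
    by (auto elim: eventually_mono)
qed

lemma variational_cutoff:
  assumes \<psi>: "H1a_pair a \<psi> \<psi>'" and \<kappa>: "\<kappa> > 0" and s: "0 \<le> s" "s + \<kappa> \<le> T"
  shows "- (LINT t|I0 T. cutoff' s \<kappa> t * ip (ut t) \<psi>)
    + (LINT t|I0 T. cutoff s \<kappa> t * ip (W t) (wt a \<psi>')) - ip u1 \<psi>
    = (LINT t|I0 T. cutoff s \<kappa> t * ip (f t) \<psi>)"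
proof -
  have L: "L2_01 \<psi>" "L2_01 (wt a \<psi>')" using \<psi> by (auto intro: H1a_pair_L2 L2_01_wt)
  have Q: "test_fun a T phi phit phix \<Longrightarrow>
        (LINT p|MQ T.
            - ut (fst p) (snd p) * phit (fst p) (snd p)
            + (snd p) powr a * ux (fst p) (snd p) * phix (fst p) (snd p))
        - (LINT x|lebesgue_on {0<..<1}. u1 x * phi 0 x)
        = (LINT p|MQ T. f (fst p) (snd p) * phi (fst p) (snd p))" for phi phit phix
    using weak by (simp add: weak_solution_def)
  note V = Q[OF test_fun_cutoff[OF \<psi> \<kappa> s]]
  note F1 = L2_dominated_Fubini[OF dom_ut L(1) cutoff_measurable(2) cutoff_bounds(2)[OF \<kappa>], of s]
  note F2 = L2_dominated_Fubini[OF dom_W L(2) cutoff_measurable(1) cutoff_bounds(1)[OF \<kappa>], of s]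
  note F3 = L2_dominated_Fubini[OF dom_f L(1) cutoff_measurable(1) cutoff_bounds(1)[OF \<kappa>], of s]
  have "(LINT p|MQ T. - ut (fst p) (snd p) * (cutoff' s \<kappa> (fst p) * \<psi> (snd p))
      + (snd p) powr a * ux (fst p) (snd p) * (cutoff s \<kappa> (fst p) * \<psi>' (snd p)))
    = (LINT p|MQ T. - (ut (fst p) (snd p) * (cutoff' s \<kappa> (fst p) * \<psi> (snd p)))
      + W (fst p) (snd p) * (cutoff s \<kappa> (fst p) * wt a \<psi>' (snd p)))"
  proof (rule Bochner_Integration.integral_cong[OF refl])
    fix p assume "p \<in> space (MQ T)"
    then have "snd p > 0" by (auto simp: Qset_def)
    from wt_mult[OF this, of a "ux (fst p)" \<psi>']
    show "- ut (fst p) (snd p) * (cutoff' s \<kappa> (fst p) * \<psi> (snd p))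
      + (snd p) powr a * ux (fst p) (snd p) * (cutoff s \<kappa> (fst p) * \<psi>' (snd p))
      = - (ut (fst p) (snd p) * (cutoff' s \<kappa> (fst p) * \<psi> (snd p)))
      + W (fst p) (snd p) * (cutoff s \<kappa> (fst p) * wt a \<psi>' (snd p))"
      unfolding W_def by (simp add: algebra_simps)
  qed
  also have "\<dots> = - (LINT t|I0 T. cutoff' s \<kappa> t * ip (ut t) \<psi>)
    + (LINT t|I0 T. cutoff s \<kappa> t * ip (W t) (wt a \<psi>'))"
    using F1(1,3) F2(1,3) unfolding case_prod_beta' by (subst Bochner_Integration.integral_add) auto
  finally have V1: "(LINT p|MQ T. - ut (fst p) (snd p) * (cutoff' s \<kappa> (fst p) * \<psi> (snd p))
      + (snd p) powr a * ux (fst p) (snd p) * (cutoff s \<kappa> (fst p) * \<psi>' (snd p))) = \<dots>" .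
  have "cutoff s \<kappa> 0 = 1" by (rule cutoff_eq(1)[OF \<kappa> s(1)])
  then show ?thesis using V unfolding V1 F3(3) by (simp add: ip_def)
qed

text \<open>Limit of \<open>variational_cutoff\<close> for vanishing cutoff width. The term with
  \<open>cutoff'\<close> is, up to sign, the mean of a continuous function over (s, s + kappa) and
  tends to its value at \<open>s\<close>; the other terms converge to integrals over (0,s) by
  domination. The condition \<open>s < T\<close> leaves room for the cutoff.\<close>

lemma weak_identity:
  assumes \<psi>: "H1a_pair a \<psi> \<psi>'" and s: "0 \<le> s" "s < T"
  shows "ip (ut s) \<psi> - ip u1 \<psi> + ip (tprim W s) (wt a \<psi>') = ip (tprim f s) \<psi>"
proof -
  have L: "L2_01 \<psi>" "L2_01 (wt a \<psi>')" using \<psi> by (auto intro: H1a_pair_L2 L2_01_wt)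
  define y where "y t = ip (ut t) \<psi>" for t
  define b where "b t = ip (f t) \<psi> - ip (W t) (wt a \<psi>')" for t
  obtain \<kappa> where \<kappa>1: "\<And>n. \<kappa> n > 0" "\<And>n. \<kappa> n < T - s" and \<kappa>0: "\<kappa> \<longlonglongrightarrow> 0"
    using vanishing_sequence[of "T - s"] s by auto
  have \<kappa>: "\<kappa> n > 0" "s + \<kappa> n \<le> T" for n using \<kappa>1[of n] by auto
  have bi: "integrable (I0 T) b"
    unfolding b_def[abs_def] using ip_tprim(1)[OF dom_f order_refl L(1)] ip_tprim(1)[OF dom_W order_refl L(2)]
    by (rule Bochner_Integration.integrable_diff)
  have yc: "continuous_on {0..T} y" unfolding y_def by (intro L2_cont_ip L2_cont_ut L2_cont_const L)
  have eq: "- (LINT t|I0 T. cutoff' s (\<kappa> n) t * y t) - ip u1 \<psi> = (LINT t|I0 T. cutoff s (\<kappa> n) t * b t)" for n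
  proof -
    note F2 = L2_dominated_Fubini(2)[OF dom_W L(2) cutoff_measurable(1) cutoff_bounds(1)[OF \<kappa>(1)], of s n]
    note F3 = L2_dominated_Fubini(2)[OF dom_f L(1) cutoff_measurable(1) cutoff_bounds(1)[OF \<kappa>(1)], of s n]
    have "(LINT t|I0 T. cutoff s (\<kappa> n) t * b t)
      = (LINT t|I0 T. cutoff s (\<kappa> n) t * ip (f t) \<psi>) - (LINT t|I0 T. cutoff s (\<kappa> n) t * ip (W t) (wt a \<psi>'))"
      unfolding b_def right_diff_distrib by (rule Bochner_Integration.integral_diff[OF F3 F2])
    then show ?thesis using variational_cutoff[OF \<psi> \<kappa>(1)[of n] s(1) \<kappa>(2)[of n]] by (simp add: y_def)
  qed
  define Y where "Y t = integral {0..t} y" for t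
  have lhs: "- (LINT t|I0 T. cutoff' s (\<kappa> n) t * y t) = (Y (s + \<kappa> n) - Y s) / \<kappa> n" for n
  proof -
    have sub: "{s<..<s + \<kappa> n} \<subseteq> {0<..<T}" using s \<kappa>(2)[of n] by auto
    have yi: "y absolutely_integrable_on {s<..<s + \<kappa> n}"
      using s \<kappa>[of n] absolutely_integrable_continuous_real[OF continuous_on_subset[OF yc, of "{s..s + \<kappa> n}"]]
      by (auto simp: absolutely_integrable_on_Icc_iff_Ioo)
    have "(LINT t|I0 T. cutoff' s (\<kappa> n) t * y t)
      = (LINT t|lebesgue. indicator {0<..<T} t * (cutoff' s (\<kappa> n) t * y t))"
      by (subst integral_restrict_space) auto
    also have "\<dots> = (LINT t|lebesgue. (- 1 / \<kappa> n) * (indicator {s<..<s + \<kappa> n} t * y t))"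
      using sub by (intro Bochner_Integration.integral_cong) (auto simp: cutoff'_def split: split_indicator)
    also have "\<dots> = (- 1 / \<kappa> n) * (LINT t|lebesgue. indicator {s<..<s + \<kappa> n} t * y t)"
      by (rule integral_mult_right_zero)
    also have "(LINT t|lebesgue. indicator {s<..<s + \<kappa> n} t * y t) = integral {s<..<s + \<kappa> n} y"
      using set_lebesgue_integral_eq_integral(2)[OF yi] by (simp add: set_lebesgue_integral_def)
    also have "\<dots> = integral {s..s + \<kappa> n} y" by (simp add: integral_open_interval_real)
    also have "\<dots> = Y (s + \<kappa> n) - Y s"
    proof -
      have "y integrable_on {0..s + \<kappa> n}"
        using s \<kappa>[of n] by (intro integrable_continuous_real continuous_on_subset[OF yc]) auto
      then show ?thesis
        using Henstock_Kurzweil_Integration.integral_combine[of 0 s "s + \<kappa> n" y] s \<kappa>(1)[of n] by (simp add: Y_def)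
    qed
    finally show ?thesis by simp
  qed
  have lim1: "(\<lambda>n. (Y (s + \<kappa> n) - Y s) / \<kappa> n) \<longlonglongrightarrow> y s"
  proof -
    have "(Y has_vector_derivative y s) (at s within {0..T})"
      unfolding Y_def using s by (intro integral_has_vector_derivative yc) auto
    then have "((\<lambda>t. (Y t - Y s) / (t - s)) \<longlongrightarrow> y s) (at s within {0..T})"
      by (simp add: has_real_derivative_iff_has_vector_derivative[symmetric] has_field_derivative_iff)
    moreover have "filterlim (\<lambda>n. s + \<kappa> n) (at s within {0..T}) sequentially"
      unfolding filterlim_at
    proof
      show "\<forall>\<^sub>F n in sequentially. s + \<kappa> n \<in> {0..T} \<and> s + \<kappa> n \<noteq> s"
        using s \<kappa> by (intro always_eventually allI) (auto simp: less_imp_neq[symmetric] add_nonneg_nonneg less_imp_le)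
      show "(\<lambda>n. s + \<kappa> n) \<longlonglongrightarrow> s" using tendsto_add[OF tendsto_const \<kappa>0, of s] by simp
    qed
    ultimately show ?thesis
      using filterlim_compose[of "\<lambda>t. (Y t - Y s) / (t - s)" "nhds (y s)" "at s within {0..T}" "\<lambda>n. s + \<kappa> n" sequentially] by simp
  qed
  have S: "{0<..<T} \<in> sets lebesgue" by simp
  \<comment> \<open>The cutoffs converge to the indicator of times before \<open>s\<close> at every
    time other than \<open>s\<close>, and |b| dominates because the cutoffs are bounded by
    1.\<close>
  have lim2: "(\<lambda>n. LINT t|I0 T. cutoff s (\<kappa> n) t * b t) \<longlonglongrightarrow> (LINT t|I0 T. indicator {..<s} t * b t)"
  proof (rule integral_dominated_convergence[where w="\<lambda>t. \<bar>b t\<bar>"])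
    have "AE t in lebesgue. t \<notin> {s}" by (rule AE_lebesgue_notin_finite) simp
    then show "AE t in I0 T. (\<lambda>n. cutoff s (\<kappa> n) t * b t) \<longlonglongrightarrow> indicator {..<s} t * b t"
      unfolding AE_lebesgue_on_iff[OF S]
    proof eventually_elim
      case (elim t)
      have "\<forall>\<^sub>F n in sequentially. cutoff s (\<kappa> n) t = indicator {..<s} t"
      proof (cases "t < s")
        case True
        then show ?thesis using cutoff_eq(1)[OF \<kappa>(1)] by simp
      next
        case False
        then have "\<forall>\<^sub>F n in sequentially. \<kappa> n < t - s" using \<kappa>0 elim by (intro order_tendstoD) auto
        then show ?thesis by eventually_elim (use False cutoff_eq(2)[OF \<kappa>(1)] in auto)
      qed
      then show ?case by (intro impI tendsto_mult tendsto_const tendsto_eventually)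
    qed
    show "AE t in I0 T. norm (cutoff s (\<kappa> n) t * b t) \<le> \<bar>b t\<bar>" for n
      using cutoff_bounds(1)[OF \<kappa>(1)[of n], of s] by (intro AE_I2) (auto simp: abs_mult mult_left_le_one_le)
    have bm: "b \<in> borel_measurable (I0 T)" using bi by (rule borel_measurable_integrable)
    have id: "(\<lambda>t. t) \<in> measurable (I0 T) borel"
      by (intro measurable_restrict_space1) (auto intro: measurable_completion)
    show "(\<lambda>t. indicator {..<s} t * b t) \<in> borel_measurable (I0 T)"
      using bm id by measurable
    show "(\<lambda>t. cutoff s (\<kappa> n) t * b t) \<in> borel_measurable (I0 T)" for n
      using bm measurable_compose[OF id cutoff_measurable(1)] by (rule borel_measurable_times[rotated])
    show "integrable (I0 T) (\<lambda>t. \<bar>b t\<bar>)" using bi by simp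
  qed
  have "(\<lambda>n. (Y (s + \<kappa> n) - Y s) / \<kappa> n - ip u1 \<psi>) \<longlonglongrightarrow> y s - ip u1 \<psi>"
    by (intro tendsto_diff lim1 tendsto_const)
  then have "(\<lambda>n. LINT t|I0 T. cutoff s (\<kappa> n) t * b t) \<longlonglongrightarrow> y s - ip u1 \<psi>"
    using eq unfolding lhs by simp
  from LIMSEQ_unique[OF this lim2]
  have "y s - ip u1 \<psi> = (LINT t|I0 T. indicator {..<s} t * b t)" .
  also have "\<dots> = (LINT t|lebesgue. indicator {0<..<T} t * (indicator {..<s} t * b t))"
    by (subst integral_restrict_space) auto
  also have "\<dots> = (LINT t|lebesgue. indicator {0<..<s} t * b t)"
    using s by (intro Bochner_Integration.integral_cong) (auto split: split_indicator)
  also have "\<dots> = (LINT t|I0 s. b t)"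
    by (subst integral_restrict_space) auto
  also have "\<dots> = ip (tprim f s) \<psi> - ip (tprim W s) (wt a \<psi>')"
    unfolding b_def ip_tprim(3)[OF dom_f less_imp_le[OF s(2)] L(1)] ip_tprim(3)[OF dom_W less_imp_le[OF s(2)] L(2)]
    by (intro Bochner_Integration.integral_diff ip_tprim(1)[OF dom_f less_imp_le[OF s(2)] L(1)] ip_tprim(1)[OF dom_W less_imp_le[OF s(2)] L(2)])
  finally show ?thesis by (simp add: y_def)
qed

end

section \<open>Energy estimate\<close>

lemma H1a_pair_abs_cont:
  assumes "H1a_pair a v w" "0 < c" "c \<le> 1" shows "abs_cont_on c 1 v"
  using assms abs_cont_on_subset[of 0 1 v c 1]
  by (auto simp: H1a_pair_def loc_abs_cont_0_1_def split: if_splits)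

lemma H1a_pair_at_1: "H1a_pair a v w \<Longrightarrow> v 1 = 0"
  by (auto simp: H1a_pair_def split: if_splits)

lemma H1a_pair_continuous:
  assumes "H1a_pair a v w" shows "continuous_on {0<..<1} v"
proof (rule continuous_at_imp_continuous_on, intro ballI)
  fix x :: real assume x: "x \<in> {0<..<1}"
  have "continuous_on {x/2..1} v"
    using x by (intro abs_cont_on_imp_continuous_on H1a_pair_abs_cont[OF assms]) auto
  then have "continuous_on {x/2<..<1} v" by (rule continuous_on_subset) auto
  then show "isCont v x" using x by (simp add: continuous_on_eq_continuous_at)
qed

text \<open>The points where the two functions differ form an open set by continuity; being null, it
  is empty. Equal functions have equal derivatives. This is used for the initial datum, which is
  attained only almost everywhere.\<close>

lemma H1a_pair_deriv_unique:
  assumes v: "H1a_pair a v w" and v': "H1a_pair a v' w'"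
    and eq: "AE x in lebesgue. x \<in> {0<..<1} \<longrightarrow> v x = v' x"
  shows "AE x in M01. w x = w' x"
proof -
  define S where "S = (\<lambda>x. v x - v' x) -` (- {0}) \<inter> {0<..<1}"
  have "continuous_on {0<..<1} (\<lambda>x. v x - v' x)"
    by (intro continuous_intros H1a_pair_continuous[OF v] H1a_pair_continuous[OF v'])
  then have "open S"
    unfolding S_def by (intro continuous_on_open_vimage[THEN iffD1, rule_format]) auto
  moreover have "negligible S"
  proof -
    obtain N where N: "{x. \<not> (x \<in> {0<..<1} \<longrightarrow> v x = v' x)} \<subseteq> N" "N \<in> null_sets lebesgue"
      using eq by (auto simp: eventually_ae_filter)
    have "S \<subseteq> N" using N(1) by (auto simp: S_def)
    then show ?thesis using N(2) by (meson negligible_iff_null_sets negligible_subset)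
  qed
  ultimately have "S = {}" using open_not_negligible by blast
  then have same: "v x = v' x" if "x \<in> {0<..<1}" for x using that by (auto simp: S_def)
  have S: "{0<..<1::real} \<in> sets lebesgue" by simp
  have "AE x in lebesgue. x \<in> {0<..<1} \<longrightarrow> (v has_real_derivative w x) (at x)"
    "AE x in lebesgue. x \<in> {0<..<1} \<longrightarrow> (v' has_real_derivative w' x) (at x)"
    using v v' by (auto simp: H1a_pair_def)
  then show ?thesis unfolding AE_lebesgue_on_iff[OF S]
  proof eventually_elim
    case (elim x)
    show ?case
    proof
      assume x: "x \<in> {0<..<1}"
      then have "(v has_real_derivative w x) (at x)" using elim by simp
      then have "(v' has_real_derivative w x) (at x)"
        by (rule has_field_derivative_transform_within_open[where S="{0<..<1}"]) (use x same in auto)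
      then show "w x = w' x" using elim x by (auto intro: DERIV_unique)
    qed
  qed
qed

lemma LINT_mono_interval:
  fixes g :: "real \<Rightarrow> real"
  assumes g: "integrable (I0 T) g" and nn: "AE r in I0 T. 0 \<le> g r"
    and st: "s \<le> t" "t \<le> T"
  shows "(LINT r|I0 s. g r) \<le> (LINT r|I0 t. g r)"
proof -
  have i: "integrable (I0 r) g" if "r \<le> T" for r
    using that by (intro integrable_lebesgue_on_subset[OF g]) auto
  have i': "integrable lebesgue (\<lambda>x. indicator {0<..<r} x * g x)" if "r \<le> T" for r
    using i[OF that] by (subst (asm) integrable_restrict_space) auto
  have e: "(LINT r|I0 r'. g r) = (LINT x|lebesgue. indicator {0<..<r'} x * g x)" for r'
    by (subst integral_restrict_space) auto
  have S: "{0<..<T} \<in> sets lebesgue" by simp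
  show ?thesis unfolding e
  proof (rule integral_mono_AE)
    show "AE x in lebesgue. indicator {0<..<s} x * g x \<le> indicator {0<..<t} x * g x"
      using nn unfolding AE_lebesgue_on_iff[OF S]
      by eventually_elim (use st in \<open>auto split: split_indicator\<close>)
  qed (use i' st in auto)
qed

lemma L2_deriv_quot_tendsto:
  assumes U: "L2_deriv {0..T} U U'" and t: "0 \<le> t" and h: "\<And>n. h n > 0" "\<And>n. t + h n \<le> T" "h \<longlonglongrightarrow> 0"
  shows "(\<lambda>n. L2_01_norm2 (\<lambda>x. (U (t + h n) x - U t x) / h n - U' t x)) \<longlonglongrightarrow> 0"
proof -
  have tT: "t \<in> {0..T}" using t h(1,2)[of 0] by auto
  have lim: "((\<lambda>s. L2_01_norm2 (\<lambda>x. (U s x - U t x) / (s - t) - U' t x)) \<longlongrightarrow> 0) (at t within {0..T})"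
    using U tT by (simp add: L2_deriv_def)
  have "filterlim (\<lambda>n. t + h n) (at t within {0..T}) sequentially"
    unfolding filterlim_at
  proof
    show "\<forall>\<^sub>F n in sequentially. t + h n \<in> {0..T} \<and> t + h n \<noteq> t"
      using t h(1,2) by (intro always_eventually allI) (auto simp: less_imp_neq[symmetric] add_nonneg_nonneg less_imp_le)
    show "(\<lambda>n. t + h n) \<longlonglongrightarrow> t" using tendsto_add[OF tendsto_const h(3), of t] by simp
  qed
  from filterlim_compose[OF lim this] show ?thesis by simp
qed

lemma L2_deriv_quot_ip_tendsto:
  assumes U: "L2_deriv {0..T} U U'" and V: "L2_deriv {0..T} V V'"
    and t: "0 \<le> t" and h: "\<And>n. h n > 0" "\<And>n. t + h n \<le> T" "h \<longlonglongrightarrow> 0"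
  shows "(\<lambda>n. ip (\<lambda>x. (U (t + h n) x - U t x) / h n) (\<lambda>x. (V (t + h n) x - V t x) / h n)) \<longlonglongrightarrow> ip (U' t) (V' t)"
proof (rule ip_tendsto)
  have tT: "t \<in> {0..T}" "\<And>n. t + h n \<in> {0..T}" using t h(1,2) by (auto intro: order_trans[OF _ h(2)[of 0]] simp: add_nonneg_nonneg less_imp_le)
  show "L2_01 (U' t)" "L2_01 (V' t)" using U V tT by (auto simp: L2_deriv_def)
  show "\<forall>\<^sub>F n in sequentially. L2_01 (\<lambda>x. (U (t + h n) x - U t x) / h n)"
    "\<forall>\<^sub>F n in sequentially. L2_01 (\<lambda>x. (V (t + h n) x - V t x) / h n)"
    using U V tT by (auto simp: L2_deriv_def intro!: always_eventually L2_01_divide L2_01_diff)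
qed (rule L2_deriv_quot_tendsto[OF U t h] L2_deriv_quot_tendsto[OF V t h])+

lemma has_real_derivative_average:
  assumes F: "continuous_on {0..T} F" and h: "h > 0" and t: "0 < t" "t + h < T"
  shows "((\<lambda>t. (integral {0..t + h} F - integral {0..t} F) / h) has_real_derivative (F (t + h) - F t) / h) (at t)"
proof -
  have P: "((\<lambda>s. integral {0..s} F) has_real_derivative F x) (at x)" if "0 < x" "x < T" for x
  proof -
    have "((\<lambda>s. integral {0..s} F) has_vector_derivative F x) (at x within {0..T})"
      using that by (intro integral_has_vector_derivative F) auto
    then show ?thesis
      using that by (simp add: has_real_derivative_iff_has_vector_derivative at_within_Icc_at)
  qed
  have "((\<lambda>s. integral {0..s + h} F) has_real_derivative F (t + h)) (at t)"
    using DERIV_shift[of "\<lambda>s. integral {0..s} F" "F (t + h)" t h] P[of "t + h"] t h by (simp add: add.commute)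
  moreover have "((\<lambda>s. integral {0..s} F) has_real_derivative F t) (at t)" using P t h by simp
  ultimately show ?thesis by (intro DERIV_cdivide DERIV_diff)
qed

section \<open>Steklov averages of the weak solution\<close>

context weak_sol
begin

text \<open>For the Steklov average \<open>v\<close> of \<open>u\<close> over \<open>(t, t + h)\<close>: \<open>D = v\<^sub>t\<close>, \<open>D' = v\<^sub>t\<^sub>t\<close>,
  \<open>V = x\<^bsup>a/2\<^esup> v\<^sub>x\<close>, and \<open>G\<close> is the average of \<open>f\<close>.\<close>
definition D :: "real \<Rightarrow> real \<Rightarrow> real \<Rightarrow> real" where "D h t x = (u (t + h) x - u t x) / h"
definition D' :: "real \<Rightarrow> real \<Rightarrow> real \<Rightarrow> real" where "D' h t x = (ut (t + h) x - ut t x) / h"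
definition Dx :: "real \<Rightarrow> real \<Rightarrow> real \<Rightarrow> real" where "Dx h t x = (ux (t + h) x - ux t x) / h"
definition V :: "real \<Rightarrow> real \<Rightarrow> real \<Rightarrow> real" where "V h t x = (tprim W (t + h) x - tprim W t x) / h"
definition V' :: "real \<Rightarrow> real \<Rightarrow> real \<Rightarrow> real" where "V' h t x = (W (t + h) x - W t x) / h"
definition G :: "real \<Rightarrow> real \<Rightarrow> real \<Rightarrow> real" where "G h t x = (tprim f (t + h) x - tprim f t x) / h"
definition F :: "real \<Rightarrow> real" where "F t = (LINT r|I0 t. nrm (f r))"

lemma L2_deriv_W: "L2_deriv {0..T} (tprim W) W"
  by (rule L2_deriv_tprim[OF measurable_W L2_cont_W])

lemma L2_deriv_D: "h > 0 \<Longrightarrow> L2_deriv {0..T - h} (D h) (D' h)"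
  unfolding D_def[abs_def] D'_def[abs_def] by (rule L2_deriv_diff_quot[OF L2_deriv_u])

lemma L2_deriv_V: "h > 0 \<Longrightarrow> L2_deriv {0..T - h} (V h) (V' h)"
  unfolding V_def[abs_def] V'_def[abs_def] by (rule L2_deriv_diff_quot[OF L2_deriv_W])

lemma H1a_D: "\<lbrakk>h > 0; 0 \<le> t; t + h \<le> T\<rbrakk> \<Longrightarrow> H1a_pair a (D h t) (Dx h t)"
  using H1a_pair_cmult[OF H1a_pair_diff[OF H1a_u[of "t + h"] H1a_u[of t]], of "1 / h"]
  by (simp add: D_def[abs_def] Dx_def[abs_def])

lemma wt_Dx: "wt a (Dx h t) = V' h t"
  by (auto simp: wt_def Dx_def V'_def W_def right_diff_distrib diff_divide_distrib)

lemma L2_G: "\<lbrakk>h > 0; 0 \<le> t; t + h \<le> T\<rbrakk> \<Longrightarrow> L2_01 (G h t)"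
  unfolding G_def[abs_def] by (intro L2_01_divide L2_01_diff L2_01_tprim[OF dom_f]) auto

text \<open>Subtracting \<open>weak_identity\<close> at \<open>t\<close> from the one at
  \<open>t + h\<close> eliminates \<open>u1\<close>. The outcome is the weak form of the averaged
  equation at every fixed time, not merely in the sense of distributions in t.\<close>

lemma weak_identity_quot:
  assumes \<psi>: "H1a_pair a \<psi> \<psi>'" and t: "h > 0" "0 \<le> t" "t + h < T"
  shows "ip (D' h t) \<psi> + ip (V h t) (wt a \<psi>') = ip (G h t) \<psi>"
proof -
  have L: "L2_01 \<psi>" "L2_01 (wt a \<psi>')" using \<psi> by (auto intro: H1a_pair_L2 L2_01_wt)
  have L': "L2_01 (ut t)" "L2_01 (ut (t + h))" using t L2_cont_ut by (auto simp: L2_cont_def)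
  have LW: "L2_01 (tprim W t)" "L2_01 (tprim W (t + h))" using t by (auto intro!: L2_01_tprim[OF dom_W])
  have Lf: "L2_01 (tprim f t)" "L2_01 (tprim f (t + h))" using t by (auto intro!: L2_01_tprim[OF dom_f])
  have 1: "ip (ut t) \<psi> - ip u1 \<psi> + ip (tprim W t) (wt a \<psi>') = ip (tprim f t) \<psi>"
    by (rule weak_identity[OF \<psi>]) (use t in auto)
  have 2: "ip (ut (t + h)) \<psi> - ip u1 \<psi> + ip (tprim W (t + h)) (wt a \<psi>') = ip (tprim f (t + h)) \<psi>"
    by (rule weak_identity[OF \<psi>]) (use t in auto)
  have "ip (D' h t) \<psi> = (ip (ut (t + h)) \<psi> - ip (ut t) \<psi>) / h"
    unfolding D'_def[abs_def] by (simp add: ip_divide_left ip_diff_left[OF L'(2,1) L(1)])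
  moreover have "ip (V h t) (wt a \<psi>') = (ip (tprim W (t + h)) (wt a \<psi>') - ip (tprim W t) (wt a \<psi>')) / h"
    unfolding V_def[abs_def] by (simp add: ip_divide_left ip_diff_left[OF LW(2,1) L(2)])
  moreover have "ip (G h t) \<psi> = (ip (tprim f (t + h)) \<psi> - ip (tprim f t) \<psi>) / h"
    unfolding G_def[abs_def] by (simp add: ip_divide_left ip_diff_left[OF Lf(2,1) L(1)])
  moreover have "(ip (ut (t + h)) \<psi> - ip (ut t) \<psi>) + (ip (tprim W (t + h)) (wt a \<psi>') - ip (tprim W t) (wt a \<psi>'))
      = ip (tprim f (t + h)) \<psi> - ip (tprim f t) \<psi>" using 1 2 by linarith
  ultimately show ?thesis by (simp only: add_divide_distrib[symmetric])
qed

lemma F_T: "F T = L1L2_norm T f"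
  by (simp add: F_def L1L2_norm_def nrm_def)

lemma integrable_nrm_f: "t \<le> T \<Longrightarrow> integrable (I0 t) (\<lambda>r. nrm (f r))"
  using L2_dominated_subset[OF dom_f] by (simp add: L2_dominated_def)

lemma F_mono: "s \<le> t \<Longrightarrow> t \<le> T \<Longrightarrow> F s \<le> F t"
  unfolding F_def by (rule LINT_mono_interval[OF integrable_nrm_f[OF order_refl]]) auto

lemma F_nonneg: "0 \<le> F t"
  unfolding F_def by (intro integral_nonneg_AE) auto

lemma F_continuous: "continuous_on {0..T} F"
proof -
  have "continuous_on {0..T} (\<lambda>t. integral {0..t} (\<lambda>r. nrm (f r)))"
  proof (rule indefinite_integral_continuous_1)
    have "(\<lambda>r. nrm (f r)) integrable_on {0<..<T}"
      by (rule integrable_on_lebesgue_on[OF integrable_nrm_f[OF order_refl]]) auto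
    then show "(\<lambda>r. nrm (f r)) integrable_on {0..T}" by (simp add: integrable_on_open_interval_real)
  qed
  moreover have "integral {0..t} (\<lambda>r. nrm (f r)) = F t" if "t \<in> {0..T}" for t
    unfolding F_def using that by (intro LINT_eq_integral[symmetric] integrable_nrm_f) auto
  ultimately show ?thesis by (rule continuous_on_eq)
qed

text \<open>The integrands k + phi and k - phi are nonnegative almost everywhere, so their integrals
  over (0,t) increase with t. This bounds the increment of the pairing by that of
  \<open>F\<close>.\<close>

lemma ip_G_le:
  assumes z: "L2_01 z" and t: "h > 0" "0 \<le> t" "t + h \<le> T"
  shows "\<bar>ip (G h t) z\<bar> \<le> (F (t + h) - F t) / h * nrm z"
proof -
  have Lf: "L2_01 (tprim f t)" "L2_01 (tprim f (t + h))" using t by (auto intro!: L2_01_tprim[OF dom_f])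
  define \<phi> where "\<phi> r = ip (f r) z" for r
  define k where "k r = nrm (f r) * nrm z" for r
  have \<phi>i: "integrable (I0 s) \<phi>" if "s \<le> T" for s
    unfolding \<phi>_def[abs_def] by (rule ip_tprim(1)[OF dom_f that z])
  have ki: "integrable (I0 s) k" if "s \<le> T" for s
    unfolding k_def[abs_def] using integrable_nrm_f[OF that] by simp
  have "AE r in I0 T. L2_01 (f r) \<and> nrm (f r) \<le> nrm (f r)"
    using dom_f by (simp add: L2_dominated_def)
  then have le: "AE r in I0 T. \<bar>\<phi> r\<bar> \<le> k r"
    by eventually_elim (auto simp: \<phi>_def k_def intro!: ip_Cauchy_Schwarz z)
  have "(LINT r|I0 t. k r - \<phi> r) \<le> (LINT r|I0 (t + h). k r - \<phi> r)"
    by (rule LINT_mono_interval[where T=T]) (use \<phi>i ki t in \<open>auto intro: eventually_mono[OF le]\<close>)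
  moreover have "(LINT r|I0 t. k r + \<phi> r) \<le> (LINT r|I0 (t + h). k r + \<phi> r)"
    by (rule LINT_mono_interval[where T=T]) (use \<phi>i ki t in \<open>auto intro: eventually_mono[OF le]\<close>)
  moreover have "(LINT r|I0 s. k r) = F s * nrm z" for s
    by (simp add: k_def F_def)
  moreover have "(LINT r|I0 s. \<phi> r) = ip (tprim f s) z" if "s \<le> T" for s
    using ip_tprim(3)[OF dom_f that z] by (simp add: \<phi>_def)
  ultimately have "\<bar>ip (tprim f (t + h)) z - ip (tprim f t) z\<bar> \<le> F (t + h) * nrm z - F t * nrm z"
    using t \<phi>i[of t] \<phi>i[of "t + h"] ki[of t] ki[of "t + h"]
    by (simp add: Bochner_Integration.integral_diff Bochner_Integration.integral_add)
  then have "\<bar>ip (tprim f (t + h)) z - ip (tprim f t) z\<bar> / h \<le> (F (t + h) * nrm z - F t * nrm z) / h"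
    using t by (intro divide_right_mono) auto
  moreover have "ip (G h t) z = (ip (tprim f (t + h)) z - ip (tprim f t) z) / h"
    unfolding G_def[abs_def] by (simp add: ip_divide_left ip_diff_left[OF Lf(2,1) z])
  ultimately show ?thesis using t by (simp add: left_diff_distrib)
qed

lemma nrm_D_le: "\<lbrakk>h > 0; 0 \<le> t; t + h \<le> T\<rbrakk> \<Longrightarrow> nrm (D h t) \<le> Mt"
proof -
  assume t: "h > 0" "0 \<le> t" "t + h \<le> T"
  have "nrm (\<lambda>x. u (t + h) x - u t x) \<le> Mt * h"
    using L2_deriv_nrm_diff_le[OF L2_deriv_u le_Mt Mt_nonneg, of t "t + h"] t by simp
  moreover have "nrm (D h t) = nrm (\<lambda>x. u (t + h) x - u t x) / h"
    using norm2_cmult[of "1/h" "\<lambda>x. u (t + h) x - u t x"] t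
    by (simp add: D_def[abs_def] nrm_def real_sqrt_mult real_sqrt_divide)
  ultimately show ?thesis by (simp only: pos_divide_le_eq[OF t(1)])
qed

lemma nrm_V_le: "\<lbrakk>h > 0; 0 \<le> t; t + h \<le> T\<rbrakk> \<Longrightarrow> nrm (V h t) \<le> Mx"
proof -
  assume t: "h > 0" "0 \<le> t" "t + h \<le> T"
  have "nrm (\<lambda>x. tprim W (t + h) x - tprim W t x) \<le> Mx * h"
    using L2_deriv_nrm_diff_le[OF L2_deriv_W le_Mx Mx_nonneg, of t "t + h"] t by simp
  moreover have "nrm (V h t) = nrm (\<lambda>x. tprim W (t + h) x - tprim W t x) / h"
    using norm2_cmult[of "1/h" "\<lambda>x. tprim W (t + h) x - tprim W t x"] t
    by (simp add: V_def[abs_def] nrm_def real_sqrt_mult real_sqrt_divide)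
  ultimately show ?thesis by (simp only: pos_divide_le_eq[OF t(1)])
qed

text \<open>Sliding mean of \<open>F\<close> over (t, t + h). \<open>F\<close> is merely continuous,
  but this mean is differentiable, and its derivative is exactly the bound of
  \<open>ip_G_le\<close>; its values stay between 0 and \<open>F T\<close>.\<close>

definition F_avg :: "real \<Rightarrow> real \<Rightarrow> real" where
  "F_avg h t = (integral {0..t + h} F - integral {0..t} F) / h"

lemma F_avg_bounds:
  assumes "h > 0" "0 \<le> t" "t + h \<le> T" shows "0 \<le> F_avg h t" "F_avg h t \<le> F T"
proof -
  have i: "F integrable_on {p..q}" if "{p..q} \<subseteq> {0..T}" for p q
    using that by (intro integrable_continuous_real continuous_on_subset[OF F_continuous])
  have "integral {0..t} F + integral {t..t + h} F = integral {0..t + h} F"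
    using assms i[of 0 "t + h"] by (intro Henstock_Kurzweil_Integration.integral_combine) auto
  then have e: "F_avg h t = integral {t..t + h} F / h" by (simp add: F_avg_def)
  have it: "F integrable_on {t..t + h}" using assms by (intro i) auto
  have "0 \<le> integral {t..t + h} F"
    by (intro Henstock_Kurzweil_Integration.integral_nonneg it F_nonneg)
  then show "0 \<le> F_avg h t" unfolding e using assms by simp
  have "integral {t..t + h} F \<le> integral {t..t + h} (\<lambda>x. F T)"
    using assms by (intro integral_le it F_mono) auto
  then show "F_avg h t \<le> F T" unfolding e using assms by (simp add: divide_simps mult.commute)
qed

lemma F_avg_deriv: "\<lbrakk>h > 0; 0 < t; t + h < T\<rbrakk> \<Longrightarrow> (F_avg h has_real_derivative (F (t + h) - F t) / h) (at t)"
  unfolding F_avg_def[abs_def] by (rule has_real_derivative_average[OF F_continuous])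

lemma F_avg_continuous:
  assumes "h > 0" "\<tau> + h \<le> T" shows "continuous_on {0..\<tau>} (F_avg h)"
proof -
  have c: "continuous_on {0..T} (\<lambda>t. integral {0..t} F)"
    by (intro indefinite_integral_continuous_1 integrable_continuous_real F_continuous)
  have "continuous_on {0..\<tau>} (\<lambda>t. integral {0..t + h} F)"
    by (rule continuous_on_compose2[OF c, of _ "\<lambda>t. t + h"]) (use assms in \<open>auto intro!: continuous_intros\<close>)
  moreover have "continuous_on {0..\<tau>} (\<lambda>t. integral {0..t} F)"
    using assms by (intro continuous_on_subset[OF c]) auto
  ultimately show ?thesis unfolding F_avg_def[abs_def] using assms by (intro continuous_intros) auto
qed

text \<open>The test function is \<open>D h t\<close>. Its weighted x-derivative is
  \<open>V' h t\<close>, so the left side of the averaged equation becomes half the time derivative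
  of the energy. Subtracting a multiple of \<open>F_avg\<close> absorbs the source, and the
  corrected energy \<open>E\<close> decreases.\<close>

lemma energy_quot:
  assumes h: "h > 0" and \<tau>: "0 \<le> \<tau>" "\<tau> + h < T"
  shows "ip (D h \<tau>) (D h \<tau>) + ip (V h \<tau>) (V h \<tau>) \<le> ip (D h 0) (D h 0) + ip (V h 0) (V h 0) + 2 * Mt * F T"
proof -
  define E where "E t = ip (D h t) (D h t) + ip (V h t) (V h t) - 2 * Mt * F_avg h t" for t
  have LD: "L2_deriv {0..T - h} (D h) (D' h)" and LV: "L2_deriv {0..T - h} (V h) (V' h)"
    using L2_deriv_D L2_deriv_V h by auto
  have "E \<tau> \<le> E 0"
  proof (rule DERIV_nonpos_imp_decreasing_open[OF \<tau>(1)])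
    fix t assume t: "0 < t" "t < \<tau>"
    then have tt: "t \<in> {0..T - h}" "0 \<le> t" "t + h < T" using \<tau> by auto
    have w: "at t within {0..T - h} = at t" using t \<tau> by (intro at_within_Icc_at) auto
    have "((\<lambda>t. ip (D h t) (D h t)) has_real_derivative 2 * ip (D' h t) (D h t)) (at t)"
      using L2_deriv_ip[OF LD LD tt(1)] unfolding w by (simp add: ip_commute[of "D h t"])
    moreover have "((\<lambda>t. ip (V h t) (V h t)) has_real_derivative 2 * ip (V h t) (V' h t)) (at t)"
      using L2_deriv_ip[OF LV LV tt(1)] unfolding w by (simp add: ip_commute[of "V' h t"])
    ultimately have "(E has_real_derivative 2 * ip (D' h t) (D h t) + 2 * ip (V h t) (V' h t) - 2 * Mt * ((F (t + h) - F t) / h)) (at t)"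
      unfolding E_def[abs_def] using F_avg_deriv[OF h t(1) tt(3)]
      by (intro DERIV_diff DERIV_add DERIV_cmult)
    moreover have "2 * ip (D' h t) (D h t) + 2 * ip (V h t) (V' h t) - 2 * Mt * ((F (t + h) - F t) / h) \<le> 0"
    proof -
      have "ip (D' h t) (D h t) + ip (V h t) (V' h t) = ip (G h t) (D h t)"
        using weak_identity_quot[OF H1a_D[OF h tt(2) less_imp_le[OF tt(3)]] h tt(2,3)] by (simp add: wt_Dx)
      also have "\<dots> \<le> (F (t + h) - F t) / h * nrm (D h t)"
        by (rule order_trans[OF abs_ge_self ip_G_le[OF H1a_pair_L2[OF H1a_D] h]]) (use h tt in auto)
      also have "\<dots> \<le> (F (t + h) - F t) / h * Mt"
        using nrm_D_le[OF h tt(2)] F_mono[of t "t + h"] tt h by (intro mult_left_mono) auto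
      finally show ?thesis by (simp add: mult.commute)
    qed
    ultimately show "\<exists>y. (E has_real_derivative y) (at t) \<and> y \<le> 0" by blast
  next
    have "L2_cont {0..\<tau>} (D h)" "L2_cont {0..\<tau>} (V h)"
      using \<tau> by (auto intro!: L2_cont_subset[OF L2_deriv_imp_cont[OF LD]] L2_cont_subset[OF L2_deriv_imp_cont[OF LV]])
    then show "continuous_on {0..\<tau>} E"
      unfolding E_def using F_avg_continuous[OF h, of \<tau>] \<tau> by (intro continuous_intros L2_cont_ip) auto
  qed
  moreover have "Mt * F_avg h \<tau> \<le> Mt * F T" "0 \<le> Mt * F_avg h 0"
    using F_avg_bounds[OF h, of \<tau>] F_avg_bounds[OF h, of 0] \<tau> Mt_nonneg by (auto intro: mult_left_mono)
  ultimately show ?thesis unfolding E_def by linarith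
qed

text \<open>The averages need \<open>\<tau> + h < T\<close>, so the limit of vanishing
  \<open>h\<close> is taken at times before \<open>T\<close>; the final time follows by
  continuity.\<close>

lemma energy_le:
  assumes t: "t \<in> {0..T}"
  shows "ip (ut t) (ut t) + ip (W t) (W t) \<le> ip (ut 0) (ut 0) + ip (W 0) (W 0) + 2 * Mt * F T"
proof -
  define C where "C = ip (ut 0) (ut 0) + ip (W 0) (W 0) + 2 * Mt * F T"
  have le: "ip (ut \<tau>) (ut \<tau>) + ip (W \<tau>) (W \<tau>) \<le> C" if \<tau>: "\<tau> \<in> {0..<T}" for \<tau>
  proof -
    obtain h where h1: "\<And>n. h n > 0" "\<And>n. h n < T - \<tau>" and h0: "h \<longlonglongrightarrow> 0"
      using vanishing_sequence[of "T - \<tau>"] \<tau> by auto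
    have h: "h n > 0" "\<tau> + h n < T" for n using h1[of n] by auto
    have hle: "\<tau> + h n \<le> T" "0 + h n \<le> T" for n using h(2)[of n] \<tau> by auto
    have "(\<lambda>n. ip (D (h n) \<tau>) (D (h n) \<tau>) + ip (V (h n) \<tau>) (V (h n) \<tau>)) \<longlonglongrightarrow> ip (ut \<tau>) (ut \<tau>) + ip (W \<tau>) (W \<tau>)"
      unfolding D_def[abs_def] V_def[abs_def] using \<tau>
      by (intro tendsto_add L2_deriv_quot_ip_tendsto[OF L2_deriv_u L2_deriv_u] L2_deriv_quot_ip_tendsto[OF L2_deriv_W L2_deriv_W] h hle h0) auto
    moreover have "(\<lambda>n. ip (D (h n) 0) (D (h n) 0) + ip (V (h n) 0) (V (h n) 0) + 2 * Mt * F T) \<longlonglongrightarrow> C"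
      unfolding D_def[abs_def] V_def[abs_def] C_def
      by (intro tendsto_add tendsto_const L2_deriv_quot_ip_tendsto[OF L2_deriv_u L2_deriv_u] L2_deriv_quot_ip_tendsto[OF L2_deriv_W L2_deriv_W] h hle h0) auto
    ultimately show ?thesis
      by (rule LIMSEQ_le) (use energy_quot[OF h(1) _ h(2)] \<tau> in auto)
  qed
  have c: "continuous_on (closure {0..<T}) (\<lambda>t. ip (ut t) (ut t) + ip (W t) (W t))"
    using T by (simp add: continuous_on_add L2_cont_ip L2_cont_ut L2_cont_W)
  have m: "t \<in> closure {0..<T}" using t T by simp
  show ?thesis unfolding C_def[symmetric] by (rule continuous_le_on_closure[OF c m le])
qed

text \<open>The initial velocity enters only through the variational identity. At time 0 that
  identity equates the pairings of \<open>ut 0\<close> and \<open>u1\<close> with every H^1_a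
  function. The quotients \<open>D (h n) 0\<close> are such functions and converge to
  \<open>ut 0\<close>, which avoids a density argument.\<close>

lemma initial_velocity: "nrm (ut 0) \<le> nrm u1"
proof -
  obtain h where h1: "\<And>n. h n > 0" "\<And>n. h n < T" and h0: "h \<longlonglongrightarrow> 0"
    using vanishing_sequence[OF T] by auto
  have h: "h n > 0" "0 + h n \<le> T" for n using h1[of n] by auto
  have LD: "L2_01 (D (h n) 0)" for n by (rule H1a_pair_L2[OF H1a_D[OF h(1) _ h(2)]]) simp
  have t0: "tprim g 0 = (\<lambda>x. 0)" for g by (auto simp: tprim_def lebesgue_integral_eq_integral)
  have eq: "ip (ut 0) (D (h n) 0) = ip u1 (D (h n) 0)" for n
    using weak_identity[OF H1a_D[OF h(1) _ h(2), of n], of 0] T by (simp add: t0 ip_def)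
  have L0: "L2_01 (ut 0)" using L2_cont_ut T by (auto simp: L2_cont_def)
  have lim: "(\<lambda>n. L2_01_norm2 (\<lambda>x. D (h n) 0 x - ut 0 x)) \<longlonglongrightarrow> 0"
    unfolding D_def[abs_def] by (rule L2_deriv_quot_tendsto[OF L2_deriv_u order_refl h h0])
  have "(\<lambda>n. ip z (D (h n) 0)) \<longlonglongrightarrow> ip z (ut 0)" if "L2_01 z" for z
    by (rule ip_tendsto) (use that LD L0 lim in \<open>auto simp: L2_01_norm2_def\<close>)
  from this[OF L0] this[OF data(2)] have "ip (ut 0) (ut 0) = ip u1 (ut 0)"
    unfolding eq by (rule LIMSEQ_unique)
  also have "\<dots> \<le> nrm u1 * nrm (ut 0)" using ip_Cauchy_Schwarz[OF data(2) L0] by linarith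
  finally show ?thesis by (intro nrm_le_if_norm2_le) (auto simp: norm2_eq_ip)
qed

lemma initial_gradient: "L2_01_norm2 (W 0) \<le> H1a_norm2 a u0 w0"
proof -
  have "AE x in M01. ux 0 x = w0 x"
    using weak T by (intro H1a_pair_deriv_unique[OF H1a_u[of 0] data(1)]) (auto simp: weak_solution_def)
  then have ae: "AE x in M01. (W 0 x)\<^sup>2 = (wt a w0 x)\<^sup>2" by eventually_elim (simp add: W_def wt_def)
  have "L2_01 (W 0)" "L2_01 (wt a w0)" using L2_cont_W T L2_01_wt[OF data(1)] by (auto simp: L2_cont_def)
  then have "L2_01_norm2 (W 0) = L2_01_norm2 (wt a w0)"
    unfolding L2_01_norm2_def using ae by (intro integral_cong_AE) (auto simp: L2_01_def)
  then show ?thesis by (simp add: wt_H1a_norm2)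
qed

definition datanorm :: real where
  "datanorm = (L1L2_norm T f)\<^sup>2 + H1a_norm2 a u0 w0 + L2_01_norm2 u1"

lemma energy_bound: "Mt\<^sup>2 \<le> 4 * datanorm" "Mx\<^sup>2 \<le> 6 * datanorm" "(F T)\<^sup>2 \<le> datanorm"
proof -
  define K where "K = H1a_norm2 a u0 w0 + L2_01_norm2 u1"
  have K0: "K \<ge> 0" unfolding K_def wt_H1a_norm2 by simp
  have dn: "datanorm = (F T)\<^sup>2 + K" by (simp add: datanorm_def K_def F_T)
  have "L2_01_norm2 (ut 0) \<le> L2_01_norm2 u1" using initial_velocity by (simp add: nrm_def)
  then have e0: "ip (ut 0) (ut 0) + ip (W 0) (W 0) \<le> K"
    using initial_gradient by (simp add: K_def norm2_eq_ip[symmetric])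
  define P where "P = 2 * Mt * F T"
  define B where "B = K + P"
  have B: "ip (ut t) (ut t) + ip (W t) (W t) \<le> B" if "t \<in> {0..T}" for t
    using energy_le[OF that] e0 unfolding B_def P_def by linarith
  have nn: "ip v v \<ge> 0" for v using norm2_nonneg[of v] by (simp add: norm2_eq_ip)
  have "nrm (ut t) \<le> sqrt B" "nrm (W t) \<le> sqrt B" if "t \<in> {0..T}" for t
    using B[OF that] nn[of "ut t"] nn[of "W t"] by (auto simp: nrm_def norm2_eq_ip intro!: real_sqrt_le_mono)
  then have "Mt \<le> sqrt B" "Mx \<le> sqrt B"
    unfolding Mt_def Mx_def using T by (auto intro!: cSUP_least)
  moreover have "B \<ge> 0" using K0 Mt_nonneg F_nonneg[of T] by (simp add: B_def P_def)
  ultimately have MB: "Mt\<^sup>2 \<le> B" "Mx\<^sup>2 \<le> B"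
    using Mt_nonneg Mx_nonneg real_sqrt_pow2[of B] power_mono[of Mt "sqrt B" 2] power_mono[of Mx "sqrt B" 2] by auto
  \<comment> \<open>Young's inequality, weighted so that P is at most half of
    \<open>Mt\<^sup>2\<close> plus twice the squared source norm. The half is absorbed on the left
    side of the bound for \<open>Mt\<close>; the resulting constants are then rounded up.\<close>
  have ag: "2 * P \<le> Mt\<^sup>2 + 4 * (F T)\<^sup>2"
    using sum_squares_bound[of Mt "2 * F T"] by (simp add: P_def power_mult_distrib)
  have F0: "0 \<le> (F T)\<^sup>2" by simp
  have "Mt\<^sup>2 \<le> 2 * K + 4 * (F T)\<^sup>2" "Mx\<^sup>2 \<le> 2 * K + 4 * (F T)\<^sup>2"
    using MB ag unfolding B_def by linarith+
  then have "Mt\<^sup>2 \<le> 4 * (F T)\<^sup>2 + 4 * K" "Mx\<^sup>2 \<le> 6 * (F T)\<^sup>2 + 6 * K"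
    using K0 F0 by linarith+
  then show "Mt\<^sup>2 \<le> 4 * datanorm" "Mx\<^sup>2 \<le> 6 * datanorm"
    by (simp_all add: dn)
  show "(F T)\<^sup>2 \<le> datanorm" using K0 by (simp add: dn)
qed

end

section \<open>Multiplier identities\<close>

text \<open>Every integration by parts in x below has this form: the derivative of a product
  vanishing at \<open>c\<close> and at 1 integrates to 0. As \<open>g\<close> vanishes up to
  \<open>c\<close>, the integral over (0,1) reduces to [c,1], away from the degeneracy.\<close>

lemma LINT_deriv_eq_0:
  assumes c: "0 < c" "c < 1" and ac: "abs_cont_on c 1 f" and f: "f c = 0" "f 1 = 0"
    and der: "AE x in lebesgue. x \<in> {c<..<1} \<longrightarrow> (f has_real_derivative g x) (at x)"
    and g: "integrable M01 g" "\<And>x. x \<le> c \<Longrightarrow> g x = 0"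
  shows "(LINT x|M01. g x) = 0"
proof -
  obtain N where N: "{x. \<not> (x \<in> {c<..<1} \<longrightarrow> (f has_real_derivative g x) (at x))} \<subseteq> N" "N \<in> null_sets lebesgue"
    using der by (auto simp: eventually_ae_filter)
  \<comment> \<open>Derivatives are known only inside the interval, so its end points join the
    exceptional set.\<close>
  have neg: "negligible (N \<union> {c, 1})" using N(2) by (simp add: negligible_iff_null_sets[symmetric])
  have "(g has_integral (f 1 - f c)) {c..1}"
  proof (rule fundamental_theorem_of_calculus_abs_cont[OF ac c(2) neg])
    fix x assume "x \<in> {c..1} - (N \<union> {c, 1})"
    then have "x \<in> {c<..<1}" "x \<notin> N" by auto
    then show "(f has_real_derivative g x) (at x)" using N(1) by blast
  qed
  then have hi: "integral {c..1} g = 0" using f by (simp add: integral_unique)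
  have i1: "integrable lebesgue (\<lambda>x. indicator {0<..<1} x * g x)"
    using g(1) by (subst (asm) integrable_restrict_space) auto
  have eq: "indicator {0<..<1} x * g x = indicator {c<..<1} x * g x" for x
    using g(2)[of x] c by (auto split: split_indicator)
  have "(LINT x|M01. g x) = (LINT x|lebesgue. indicator {c<..<1} x * g x)"
    unfolding eq[symmetric] by (subst integral_restrict_space) auto
  also have "\<dots> = integral {c<..<1} g"
    using set_lebesgue_integral_eq_integral(2)[of "{c<..<1}" g] i1
    unfolding eq by (simp add: set_integrable_def set_lebesgue_integral_def)
  also have "\<dots> = 0" using hi by (simp add: integral_open_interval_real)
  finally show ?thesis .
qed

text \<open>Vanishing up to \<open>c\<close> keeps all powers of x bounded on the support and
  removes the end point 0; \<open>m 1 = 0\<close> removes the boundary term at 1. Boundedness of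
  \<open>m'\<close> makes it a multiplier of L^2.\<close>

definition multiplier :: "real \<Rightarrow> (real \<Rightarrow> real) \<Rightarrow> (real \<Rightarrow> real) \<Rightarrow> bool" where
  "multiplier c m m' \<longleftrightarrow> 0 < c \<and> c < 1 \<and> abs_cont_on 0 1 m \<and> m \<in> borel_measurable borel \<and> m' \<in> borel_measurable borel \<and>
     (\<forall>x\<le>c. m x = 0 \<and> m' x = 0) \<and> m 1 = 0 \<and> (\<forall>x\<in>{0<..<1}. 0 \<le> m x \<and> m x \<le> 1) \<and> bounded (range m') \<and>
     (AE x in lebesgue. x \<in> {0<..<1} \<longrightarrow> (m has_real_derivative m' x) (at x))"

lemma borel_imp_M01: "b \<in> borel_measurable borel \<Longrightarrow> b \<in> borel_measurable M01"
  by (intro measurable_restrict_space1 measurable_completion) simp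

lemma multiplier_D:
  assumes "multiplier c m m'"
  shows "0 < c" "c < 1" "abs_cont_on c 1 m" "m \<in> borel_measurable M01" "m' \<in> borel_measurable M01" "m 1 = 0"
    "x \<le> c \<Longrightarrow> m x = 0" "x \<le> c \<Longrightarrow> m' x = 0" "x \<in> {0<..<1} \<Longrightarrow> 0 \<le> m x" "x \<in> {0<..<1} \<Longrightarrow> m x \<le> 1"
    "AE x in lebesgue. x \<in> {0<..<1} \<longrightarrow> (m has_real_derivative m' x) (at x)"
    "\<exists>B. \<forall>x. \<bar>m' x\<bar> \<le> B"
  using assms abs_cont_on_subset[of 0 1 m c 1] unfolding multiplier_def
  by (auto intro: borel_imp_M01 simp: bounded_iff)

lemma multiplier_powr_bound:
  assumes m: "multiplier c m m'" and x: "x \<in> {0<..<1}" and b: "b \<ge> 0"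
  shows "\<bar>m x * x powr - b\<bar> \<le> c powr - b"
proof (cases "x \<le> c")
  case True then show ?thesis using multiplier_D(7)[OF m] by simp
next
  case False
  have c: "0 < c" using multiplier_D[OF m] by simp
  have "x powr - b \<le> c powr - b" using False c b by (intro powr_mono2') auto
  moreover have "\<bar>m x\<bar> \<le> 1" using multiplier_D(9,10)[OF m x] by simp
  ultimately have "\<bar>m x\<bar> * x powr - b \<le> 1 * c powr - b" by (intro mult_mono) auto
  then show ?thesis by (simp add: abs_mult)
qed

lemma L2_01_mult_integrable3:
  assumes "L2_01 v" "L2_01 w" "b \<in> borel_measurable M01" "\<And>x. x \<in> {0<..<1} \<Longrightarrow> \<bar>b x\<bar> \<le> B"
  shows "integrable M01 (\<lambda>x. b x * (v x * w x))"
  using L2_01_mult_integrable[OF L2_01_bounded_mult[OF assms(1,3,4)] assms(2)] by (simp add: mult.assoc)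

text \<open>As the powers of \<open>x\<close> cancel, this reads \<open>\<integral> m v v\<^sub>x = - (1/2) \<integral> m' v\<^sup>2\<close>.\<close>
lemma multiplier_H1a:
  assumes m: "multiplier c m m'" and v: "H1a_pair a v w" and a: "a > 0"
  shows "ip v (\<lambda>x. (m x * x powr - (a / 2)) * wt a w x) = - (1 / 2) * (LINT x|M01. m' x * (v x)\<^sup>2)"
proof -
  note mD = multiplier_D[OF m]
  obtain B where B: "\<And>x. \<bar>m' x\<bar> \<le> B" using mD(12) by blast
  have Lv: "L2_01 v" and Lw: "L2_01 (wt a w)" using v by (auto intro: H1a_pair_L2 L2_01_wt)
  define b where "b x = m x * x powr - (a / 2)" for x
  have b: "b \<in> borel_measurable M01" "\<And>x. x \<in> {0<..<1} \<Longrightarrow> \<bar>b x\<bar> \<le> c powr - (a / 2)"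
    using mD(4) powr_borel_measurable_M01[of "- (a / 2)"] multiplier_powr_bound[OF m, of _ "a / 2"] a
    unfolding b_def[abs_def] by auto
  have i1: "integrable M01 (\<lambda>x. m' x * (v x * v x))"
    by (rule L2_01_mult_integrable3[OF Lv Lv mD(5) B])
  have i2: "integrable M01 (\<lambda>x. b x * (v x * wt a w x))"
    by (rule L2_01_mult_integrable3[OF Lv Lw b])
  have ac: "abs_cont_on c 1 v" using H1a_pair_abs_cont[OF v] mD(1,2) by simp
  define g where "g x = m' x * (v x * v x) + 2 * (b x * (v x * wt a w x))" for x
  have "(LINT x|M01. g x) = 0"
  proof (rule LINT_deriv_eq_0[OF mD(1,2)])
    show "abs_cont_on c 1 (\<lambda>x. m x * (v x * v x))" by (intro abs_cont_on_mult mD(3) ac)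
    have "AE x in lebesgue. x \<in> {0<..<1} \<longrightarrow> (v has_real_derivative w x) (at x)" using v by (simp add: H1a_pair_def)
    then show "AE x in lebesgue. x \<in> {c<..<1} \<longrightarrow> ((\<lambda>x. m x * (v x * v x)) has_real_derivative g x) (at x)"
      using mD(11)
    proof eventually_elim
      case (elim x)
      show ?case
      proof
        assume x: "x \<in> {c<..<1}"
        then have x0: "x > 0" "x \<in> {0<..<1}" using mD(1) by auto
        have "((\<lambda>x. m x * (v x * v x)) has_real_derivative m' x * (v x * v x) + (w x * v x + w x * v x) * m x) (at x)"
          using elim x0 by (intro DERIV_mult) auto
        moreover have "b x * wt a w x = m x * w x"
          using x0 by (simp add: b_def wt_def powr_minus)
        then have "g x = m' x * (v x * v x) + (w x * v x + w x * v x) * m x"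
          unfolding g_def by (simp add: algebra_simps)
        ultimately show "((\<lambda>x. m x * (v x * v x)) has_real_derivative g x) (at x)" by simp
      qed
    qed
    show "integrable M01 g" unfolding g_def[abs_def] using i1 i2 by simp
  qed (use mD(6-8) in \<open>auto simp: g_def b_def\<close>)
  also have "(LINT x|M01. g x) = (LINT x|M01. m' x * (v x * v x)) + 2 * (LINT x|M01. b x * (v x * wt a w x))"
    unfolding g_def using i1 i2 by simp
  finally show ?thesis
    by (simp add: ip_def b_def power2_eq_square mult.left_commute)
qed

section \<open>Regularity of the flux\<close>

lemma integrable_M01_extend:
  fixes g :: "real \<Rightarrow> real"
  assumes "integrable M01 g" shows "integrable lebesgue (\<lambda>x. indicator {0<..<1} x * g x)"
  using assms by (subst (asm) integrable_restrict_space) auto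

lemma continuous_imp_M01_bounded:
  fixes v :: "real \<Rightarrow> real"
  assumes "continuous_on {0..1} v"
  shows "v \<in> borel_measurable M01" "\<exists>B. \<forall>x\<in>{0..1}. \<bar>v x\<bar> \<le> B"
proof -
  have "continuous_on {0<..<1} v" using assms by (rule continuous_on_subset) auto
  then show "v \<in> borel_measurable M01" by (intro continuous_imp_measurable_on_sets_lebesgue) auto
  have "bounded (v ` {0..1})" using assms by (intro compact_imp_bounded compact_continuous_image) auto
  then show "\<exists>B. \<forall>x\<in>{0..1}. \<bar>v x\<bar> \<le> B" by (auto simp: bounded_iff)
qed

text \<open>Because \<open>\<theta>\<close> has mean 0, the primitive vanishes at 0 and at 1 and so
  meets the boundary conditions of both degeneracy cases. It supplies the test functions for the du
  Bois-Reymond argument.\<close>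

lemma H1a_pair_primitive:
  assumes \<theta>: "L2_01 \<theta>" "\<And>x. x \<notin> {0<..<1} \<Longrightarrow> \<theta> x = 0" "(LINT x|M01. \<theta> x) = 0" and a: "a > 0"
  shows "H1a_pair a (\<lambda>x. integral {0..x} \<theta>) \<theta>"
proof -
  have i: "integrable lebesgue \<theta>"
  proof -
    have "(\<lambda>x. indicator {0<..<1} x * \<theta> x) = \<theta>" using \<theta>(2) by (auto simp: fun_eq_iff split: split_indicator)
    then show ?thesis using integrable_M01_extend[OF L2_01_integrable[OF \<theta>(1)]] by simp
  qed
  define \<psi> where "\<psi> = (\<lambda>x. integral {0..x} \<theta>)"
  have ac: "abs_cont_on p 1 \<psi>" if "0 \<le> p" for p
    using abs_cont_on_subset[OF abs_cont_on_integral[OF i, of 0 1]] that unfolding \<psi>_def by auto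
  have cont: "continuous_on {0..1} \<psi>" by (rule abs_cont_on_imp_continuous_on[OF ac]) simp
  obtain B where B: "\<And>x. x \<in> {0..1} \<Longrightarrow> \<bar>\<psi> x\<bar> \<le> B" using continuous_imp_M01_bounded(2)[OF cont] by blast
  have L: "L2_01 \<psi>" by (rule L2_01_bounded[OF continuous_imp_M01_bounded(1)[OF cont] B]) auto
  have "\<psi> 1 = integral {0<..<1} \<theta>" by (simp add: \<psi>_def integral_open_interval_real)
  also have "\<dots> = (LINT x|M01. \<theta> x)"
    using lebesgue_integral_eq_integral[OF L2_01_integrable[OF \<theta>(1)]] by simp
  finally have \<psi>1: "\<psi> 1 = 0" using \<theta>(3) by simp
  have \<psi>0: "\<psi> 0 = 0" by (simp add: \<psi>_def)
  have der: "AE x in lebesgue. x \<in> {0<..<1} \<longrightarrow> (\<psi> has_real_derivative \<theta> x) (at x)"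
    using lebesgue_differentiation[OF i] by eventually_elim (auto simp: \<psi>_def)
  have "\<And>x. x \<in> {0<..<1} \<Longrightarrow> \<bar>x powr (a / 2)\<bar> \<le> 1" using a by (auto intro: powr_le1)
  then have "L2_01 (wt a \<theta>)"
    unfolding wt_def[abs_def] by (rule L2_01_bounded_mult[OF \<theta>(1) powr_borel_measurable_M01])
  then show ?thesis
    using L \<psi>0 \<psi>1 der ac L2_01_measurable[OF \<theta>(1)] unfolding \<psi>_def[symmetric] H1a_pair_def loc_abs_cont_0_1_def
    by (simp add: integrable_weight_iff)
qed

lemma L2_01_AE_0:
  assumes "L2_01 \<theta>" "ip \<theta> \<theta> = 0" shows "AE x in M01. \<theta> x = 0"
proof -
  have "AE x in M01. \<theta> x * \<theta> x = 0"
    using assms L2_01_mult_integrable[OF assms(1,1)]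
    by (subst integral_nonneg_eq_0_iff_AE[symmetric]) (auto simp: ip_def)
  then show ?thesis by simp
qed

text \<open>Weakly, \<open>(x\<^sup>a v\<^sub>x)\<^sub>x = g\<close>, where the hypothesis is stated for \<open>v = x\<^bsup>a/2\<^esup> v\<^sub>x\<close>; hence the flux
  coincides with an absolutely continuous function away from 0 (du Bois-Reymond).\<close>
lemma flux_regularity:
  assumes g: "L2_01 g" and v: "L2_01 v" and a: "a > 0" and c: "0 < c" "c < 1"
    and weak: "\<And>\<psi> \<psi>'. H1a_pair a \<psi> \<psi>' \<Longrightarrow> ip g \<psi> + ip v (wt a \<psi>') = 0"
  obtains p where "abs_cont_on 0 1 p"
    "AE x in lebesgue. x \<in> {c<..<1} \<longrightarrow> (p has_real_derivative g x) (at x)"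
    "AE x in M01. x \<in> {c<..<1} \<longrightarrow> p x = x powr (a / 2) * v x"
proof -
  \<comment> \<open>After cutting off \<open>g\<close> below \<open>c\<close>, the primitive
    \<open>\<Gamma>\<close> vanishes at \<open>c\<close>, so there is no boundary term
    there.\<close>
  define g1 where "g1 = (\<lambda>y. indicator {c<..<1} y * g y)"
  have ind: "indicator {c<..<1} \<in> borel_measurable M01" "\<And>x. \<bar>indicator {c<..<1} x\<bar> \<le> (1::real)"
    by (auto intro: borel_imp_M01 simp: indicator_def)
  have Lg1: "L2_01 g1" unfolding g1_def by (rule L2_01_bounded_mult[OF g ind])
  have g1: "integrable lebesgue g1"
  proof -
    have "(\<lambda>x. indicator {0<..<1} x * g1 x) = g1" using c by (auto simp: fun_eq_iff g1_def split: split_indicator)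
    then show ?thesis using integrable_M01_extend[OF L2_01_integrable[OF Lg1]] by simp
  qed
  define \<Gamma> where "\<Gamma> = (\<lambda>x. integral {0..x} g1)"
  define P where "P = (\<lambda>x. x powr (a / 2) * v x)"
  have "\<And>x. x \<in> {0<..<1} \<Longrightarrow> \<bar>x powr (a / 2)\<bar> \<le> 1" using a by (auto intro: powr_le1)
  then have LP: "L2_01 P" unfolding P_def by (rule L2_01_bounded_mult[OF v powr_borel_measurable_M01])
  have \<Gamma>ac: "abs_cont_on 0 1 \<Gamma>" unfolding \<Gamma>_def by (rule abs_cont_on_integral[OF g1])
  have \<Gamma>c: "continuous_on {0..1} \<Gamma>" by (rule abs_cont_on_imp_continuous_on[OF \<Gamma>ac])
  obtain B where B: "\<And>x. x \<in> {0..1} \<Longrightarrow> \<bar>\<Gamma> x\<bar> \<le> B" using continuous_imp_M01_bounded(2)[OF \<Gamma>c] by blast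
  have L\<Gamma>: "L2_01 \<Gamma>" by (rule L2_01_bounded[OF continuous_imp_M01_bounded(1)[OF \<Gamma>c] B]) auto
  have \<Gamma>0: "\<Gamma> c = 0"
  proof -
    have "\<Gamma> c = integral {0..c} (\<lambda>x. 0::real)" unfolding \<Gamma>_def by (rule Henstock_Kurzweil_Integration.integral_cong) (auto simp: g1_def)
    then show ?thesis by simp
  qed
  define q where "q = (\<lambda>x. P x - \<Gamma> x)"
  have Lq: "L2_01 q" unfolding q_def by (rule L2_01_diff[OF LP L\<Gamma>])
  \<comment> \<open>\<open>A\<close> is the mean of \<open>q\<close> over (c,1). Subtracting it
    gives \<open>\<theta>\<close> mean 0, so \<open>\<theta>\<close> is the derivative of an
    admissible test function.\<close>
  define A where "A = (LINT x|M01. indicator {c<..<1} x * q x) / (1 - c)"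
  define \<theta> where "\<theta> = (\<lambda>x. indicator {c<..<1} x * (q x - A))"
  have L\<theta>: "L2_01 \<theta>" unfolding \<theta>_def by (rule L2_01_bounded_mult[OF L2_01_diff[OF Lq L2_01_const] ind])
  have \<theta>out: "\<theta> x = 0" if "x \<notin> {0<..<1}" for x using that c by (auto simp: \<theta>_def)
  have I1: "(LINT x|M01. indicator {c<..<1} x) = 1 - c"
  proof -
    have "(LINT x|M01. indicator {c<..<1} x) = (LINT x|lebesgue. indicator {0<..<1} x * (indicator {c<..<1} x :: real))"
      by (subst integral_restrict_space) auto
    also have "\<dots> = (LINT x|lebesgue. indicator {c<..<1} x)"
      using c by (intro Bochner_Integration.integral_cong) (auto split: split_indicator)
    finally show ?thesis using c by simp
  qed
  have \<theta>int: "(LINT x|M01. \<theta> x) = 0"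
  proof -
    have "integrable M01 (\<lambda>x. indicator {c<..<1} x * q x)" "integrable M01 (\<lambda>x. indicator {c<..<1} x * A)"
      by (intro L2_01_integrable L2_01_bounded_mult[OF Lq ind] L2_01_bounded_mult[OF L2_01_const ind])+
    then have "(LINT x|M01. \<theta> x) = (LINT x|M01. indicator {c<..<1} x * q x) - (LINT x|M01. indicator {c<..<1} x * A)"
      unfolding \<theta>_def right_diff_distrib by (rule Bochner_Integration.integral_diff)
    then show ?thesis using I1 c by (simp add: A_def)
  qed
  define \<psi> where "\<psi> = (\<lambda>x. integral {0..x} \<theta>)"
  have \<psi>: "H1a_pair a \<psi> \<theta>" unfolding \<psi>_def by (rule H1a_pair_primitive[OF L\<theta> \<theta>out \<theta>int a])
  have L\<psi>: "L2_01 \<psi>" by (rule H1a_pair_L2[OF \<psi>])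
  have \<psi>c: "\<psi> x = 0" if "x \<le> c" for x
  proof -
    have "\<psi> x = integral {0..x} (\<lambda>x. 0::real)" unfolding \<psi>_def by (rule Henstock_Kurzweil_Integration.integral_cong) (use that in \<open>auto simp: \<theta>_def\<close>)
    then show ?thesis by simp
  qed
  have \<Gamma>': "AE x in lebesgue. x \<in> {c<..<1} \<longrightarrow> (\<Gamma> has_real_derivative g1 x) (at x)"
    using lebesgue_differentiation[OF g1] by eventually_elim (use c in \<open>auto simp: \<Gamma>_def\<close>)
  \<comment> \<open>Integration by parts moves the source from \<open>\<psi>\<close> to its
    derivative, replacing \<open>g1\<close> by its primitive.\<close>
  have "(LINT x|M01. g1 x * \<psi> x + \<theta> x * \<Gamma> x) = 0"
  proof (rule LINT_deriv_eq_0[OF c])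
    show "abs_cont_on c 1 (\<lambda>x. \<Gamma> x * \<psi> x)"
      using c by (intro abs_cont_on_mult abs_cont_on_subset[OF \<Gamma>ac] H1a_pair_abs_cont[OF \<psi>]) auto
    have "AE x in lebesgue. x \<in> {0<..<1} \<longrightarrow> (\<psi> has_real_derivative \<theta> x) (at x)"
      using \<psi> by (simp add: H1a_pair_def)
    then show "AE x in lebesgue. x \<in> {c<..<1} \<longrightarrow> ((\<lambda>x. \<Gamma> x * \<psi> x) has_real_derivative g1 x * \<psi> x + \<theta> x * \<Gamma> x) (at x)"
      using \<Gamma>' by eventually_elim (use c in \<open>auto intro!: DERIV_mult\<close>)
    show "integrable M01 (\<lambda>x. g1 x * \<psi> x + \<theta> x * \<Gamma> x)"
      using L2_01_mult_integrable[OF Lg1 L\<psi>] L2_01_mult_integrable[OF L\<theta> L\<Gamma>] by simp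
  qed (use \<Gamma>0 H1a_pair_at_1[OF \<psi>] in \<open>auto simp: g1_def \<theta>_def\<close>)
  then have e1: "ip g1 \<psi> + ip \<theta> \<Gamma> = 0"
    using L2_01_mult_integrable[OF Lg1 L\<psi>] L2_01_mult_integrable[OF L\<theta> L\<Gamma>] by (simp add: ip_def)
  have e2: "ip g1 \<psi> = ip g \<psi>"
    unfolding ip_def by (intro Bochner_Integration.integral_cong) (use \<psi>c in \<open>auto simp: g1_def split: split_indicator\<close>)
  have e3: "ip v (wt a \<theta>) = ip \<theta> P"
    unfolding ip_def by (intro Bochner_Integration.integral_cong) (auto simp: wt_def P_def)
  \<comment> \<open>With the weak equation this says that flux minus \<open>\<Gamma>\<close> is
    orthogonal to \<open>\<theta>\<close>. So are constants, hence \<open>\<theta>\<close> is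
    orthogonal to itself and flux minus \<open>\<Gamma>\<close> equals \<open>A\<close> almost
    everywhere on (c,1).\<close>
  have "ip \<theta> q = 0"
    using e1 e2 e3 weak[OF \<psi>] unfolding q_def by (simp add: ip_diff_right[OF LP L\<Gamma> L\<theta>])
  moreover have "ip \<theta> \<theta> = ip \<theta> (\<lambda>x. q x - A)"
    unfolding ip_def by (intro Bochner_Integration.integral_cong) (auto simp: \<theta>_def split: split_indicator)
  moreover have "ip \<theta> (\<lambda>x. A) = 0" using \<theta>int by (simp add: ip_def)
  ultimately have "ip \<theta> \<theta> = 0" by (simp add: ip_diff_right[OF Lq L2_01_const L\<theta>])
  from L2_01_AE_0[OF L\<theta> this]
  have "AE x in M01. x \<in> {c<..<1} \<longrightarrow> \<Gamma> x + A = x powr (a / 2) * v x"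
    by eventually_elim (auto simp: \<theta>_def q_def P_def)
  moreover have "abs_cont_on 0 1 (\<lambda>x. \<Gamma> x + A)" by (intro abs_cont_on_add abs_cont_on_const \<Gamma>ac)
  moreover have "AE x in lebesgue. x \<in> {c<..<1} \<longrightarrow> ((\<lambda>x. \<Gamma> x + A) has_real_derivative g x) (at x)"
    using \<Gamma>' by eventually_elim (auto simp: g1_def intro!: derivative_eq_intros)
  ultimately show ?thesis by (intro that)
qed

lemma abs_cont_on_powr:
  assumes "0 < c" shows "abs_cont_on c 1 (\<lambda>x. x powr - a)"
proof (rule abs_cont_on_lipschitz)
  fix x y :: real assume xy: "c \<le> x" "x \<le> y" "y \<le> 1"
  have "norm (y powr - a - x powr - a) \<le> (\<bar>a\<bar> * (c powr (- a - 1) + 1)) * norm (y - x)"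
  proof (rule field_differentiable_bound[of "{x..y}"])
    fix z assume z: "z \<in> {x..y}"
    then show "((\<lambda>x. x powr - a) has_field_derivative (- a * z powr (- a - 1))) (at z within {x..y})"
      using xy assms by (auto intro!: derivative_eq_intros)
    \<comment> \<open>The sum covers both signs of the exponent: a decreasing power is largest at
      \<open>c\<close>, an increasing one is at most 1.\<close>
    have "z powr (- a - 1) \<le> c powr (- a - 1) + 1"
    proof (cases "- a - 1 \<le> 0")
      case True
      then have "z powr (- a - 1) \<le> c powr (- a - 1)" using z xy assms by (intro powr_mono2') auto
      then show ?thesis by simp
    next
      case False
      then have "z powr (- a - 1) \<le> 1" using z xy assms by (intro powr_le1) auto
      then show ?thesis using powr_ge_zero[of c "- a - 1"] by linarith
    qed
    then show "norm (- a * z powr (- a - 1)) \<le> \<bar>a\<bar> * (c powr (- a - 1) + 1)"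
      by (simp add: abs_mult mult_left_mono)
  qed (use xy in auto)
  then show "\<bar>y powr - a - x powr - a\<bar> \<le> (\<bar>a\<bar> * (c powr (- a - 1) + 1)) * (y - x)" using xy by simp
qed

text \<open>Integrate the derivative of m x^(-a) p^2, where p is the absolutely continuous
  representative of the flux, so p = x^(a/2) \<open>v\<close> almost everywhere on (c,1).
  Differentiating x^(-a) produces the extra term with a m / x.\<close>

lemma multiplier_flux:
  assumes m: "multiplier c m m'" and g: "L2_01 g" and v: "L2_01 v" and a: "a > 0"
    and weak: "\<And>\<psi> \<psi>'. H1a_pair a \<psi> \<psi>' \<Longrightarrow> ip g \<psi> + ip v (wt a \<psi>') = 0"
  shows "ip g (\<lambda>x. (m x * x powr - (a / 2)) * v x) = - (1 / 2) * (LINT x|M01. (m' x - a * (m x * x powr - 1)) * (v x)\<^sup>2)"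
proof -
  note mD = multiplier_D[OF m]
  obtain p where pac: "abs_cont_on 0 1 p"
    and pd: "AE x in lebesgue. x \<in> {c<..<1} \<longrightarrow> (p has_real_derivative g x) (at x)"
    and pv: "AE x in M01. x \<in> {c<..<1} \<longrightarrow> p x = x powr (a / 2) * v x"
    using flux_regularity[OF g v a mD(1,2) weak] by blast
  have ind: "indicator {c<..<1} \<in> borel_measurable M01" by (auto intro: borel_imp_M01)
  have pc: "continuous_on {0..1} p" by (rule abs_cont_on_imp_continuous_on[OF pac])
  obtain B where B: "\<And>x. x \<in> {0..1} \<Longrightarrow> \<bar>p x\<bar> \<le> B" using continuous_imp_M01_bounded(2)[OF pc] by blast
  have pm: "p \<in> borel_measurable M01" by (rule continuous_imp_M01_bounded(1)[OF pc])
  have Lp: "L2_01 p" by (rule L2_01_bounded[OF pm B]) auto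
  define k where "k x = m x * x powr - a" for x
  \<comment> \<open>The derivative of m x^(-a). The indicator keeps the power bounded near 0 and
    changes nothing there, since \<open>m'\<close> vanishes up to \<open>c\<close>.\<close>
  define k' where "k' x = m' x * (indicator {c<..<1} x * x powr - a) - a * (m x * x powr - (a + 1))" for x
  have kb: "k \<in> borel_measurable M01" "\<And>x. x \<in> {0<..<1} \<Longrightarrow> \<bar>k x\<bar> \<le> c powr - a"
    using mD(4) powr_borel_measurable_M01[of "- a"] multiplier_powr_bound[OF m, of _ a] a
    unfolding k_def[abs_def] by auto
  obtain B' where B': "\<And>x. \<bar>m' x\<bar> \<le> B'" using mD(12) by blast
  have k'm: "k' \<in> borel_measurable M01"
    unfolding k'_def[abs_def] using mD(4,5) powr_borel_measurable_M01[of "- a"] powr_borel_measurable_M01[of "- (a + 1)"] ind by measurable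
  have k'b: "\<bar>k' x\<bar> \<le> B' * c powr - a + a * c powr - (a + 1)" if x: "x \<in> {0<..<1}" for x
  proof -
    have "indicator {c<..<1} x * x powr - a \<le> c powr - a"
      using powr_mono2'[of "- a" c x] a mD(1) by (auto split: split_indicator)
    then have "\<bar>m' x * (indicator {c<..<1} x * x powr - a)\<bar> \<le> B' * c powr - a"
      unfolding abs_mult using B'[of x] by (intro mult_mono) (auto simp: abs_mult order_trans[OF abs_ge_zero])
    moreover have "\<bar>a * (m x * x powr - (a + 1))\<bar> \<le> a * c powr - (a + 1)"
      using multiplier_powr_bound[OF m x, of "a + 1"] a by (simp add: abs_mult mult_left_mono)
    ultimately show ?thesis unfolding k'_def by linarith
  qed
  have i1: "integrable M01 (\<lambda>x. k' x * (p x * p x))" by (rule L2_01_mult_integrable3[OF Lp Lp k'm k'b])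
  have i2: "integrable M01 (\<lambda>x. k x * (g x * p x))" by (rule L2_01_mult_integrable3[OF g Lp kb])
  have "(LINT x|M01. k' x * (p x * p x) + 2 * (k x * (g x * p x))) = 0"
  proof (rule LINT_deriv_eq_0[OF mD(1,2)])
    show "abs_cont_on c 1 (\<lambda>x. (m x * x powr - a) * (p x * p x))"
      using mD(1) by (intro abs_cont_on_mult mD(3) abs_cont_on_powr abs_cont_on_subset[OF pac]) auto
    show "AE x in lebesgue. x \<in> {c<..<1} \<longrightarrow> ((\<lambda>x. (m x * x powr - a) * (p x * p x)) has_real_derivative k' x * (p x * p x) + 2 * (k x * (g x * p x))) (at x)"
      using mD(11) pd
    proof eventually_elim
      case (elim x)
      show ?case
      proof
        assume x: "x \<in> {c<..<1}"
        then have x0: "x > 0" "x \<in> {0<..<1}" using mD(1) by auto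
        have dp: "(p has_real_derivative g x) (at x)" using elim(2) x by blast
        have dw: "((\<lambda>x. x powr - a) has_real_derivative - a * x powr - (a + 1)) (at x)"
        proof -
          have e: "- (a + 1) = - a - 1" by simp
          show ?thesis unfolding e using x0 by (auto intro!: derivative_eq_intros)
        qed
        have dm: "(m has_real_derivative m' x) (at x)" using elim(1) x0 by blast
        have "((\<lambda>x. (m x * x powr - a) * (p x * p x)) has_real_derivative
          (m' x * x powr - a + (- a * x powr - (a + 1)) * m x) * (p x * p x) + (g x * p x + g x * p x) * (m x * x powr - a)) (at x)"
          by (intro DERIV_mult dm dw dp)
        moreover have "(m' x * x powr - a + (- a * x powr - (a + 1)) * m x) * (p x * p x) + (g x * p x + g x * p x) * (m x * x powr - a)
          = k' x * (p x * p x) + 2 * (k x * (g x * p x))"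
          using x by (simp add: k'_def k_def algebra_simps)
        ultimately show "((\<lambda>x. (m x * x powr - a) * (p x * p x)) has_real_derivative k' x * (p x * p x) + 2 * (k x * (g x * p x))) (at x)"
          by simp
      qed
    qed
    show "integrable M01 (\<lambda>x. k' x * (p x * p x) + 2 * (k x * (g x * p x)))" using i1 i2 by simp
  qed (use mD(6-8) in \<open>auto simp: k'_def k_def\<close>)
  then have main: "(LINT x|M01. k x * (g x * p x)) = - (1 / 2) * (LINT x|M01. k' x * (p x * p x))"
    using i1 i2 by simp
  have "ip g (\<lambda>x. (m x * x powr - (a / 2)) * v x) = (LINT x|M01. k x * (g x * p x))"
    unfolding ip_def
  proof (rule integral_cong_AE)
    have b: "(\<lambda>x. (m x * x powr - (a / 2))) \<in> borel_measurable M01" "\<And>x. x \<in> {0<..<1} \<Longrightarrow> \<bar>m x * x powr - (a / 2)\<bar> \<le> c powr - (a / 2)"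
      using mD(4) powr_borel_measurable_M01[of "- (a / 2)"] multiplier_powr_bound[OF m, of _ "a / 2"] a by auto
    show "(\<lambda>x. g x * ((m x * x powr - (a / 2)) * v x)) \<in> borel_measurable M01"
      using L2_01_mult_integrable[OF g L2_01_bounded_mult[OF v b]] by (rule borel_measurable_integrable)
    show "(\<lambda>x. k x * (g x * p x)) \<in> borel_measurable M01" using i2 by (rule borel_measurable_integrable)
    have "AE x in M01. x \<in> {0<..<1}" by (rule AE_I2) simp
    with pv show "AE x in M01. g x * ((m x * x powr - (a / 2)) * v x) = k x * (g x * p x)"
    proof eventually_elim
      case (elim x)
      show ?case
      proof (cases "x \<le> c")
        case True then show ?thesis by (simp add: k_def mD(7))
      next
        case False
        then have xc: "x \<in> {c<..<1}" using elim by auto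
        then have pe: "p x = x powr (a / 2) * v x" using elim by blast
        have x0: "x > 0" using xc mD(1) by auto
        have "x powr - a * x powr (a / 2) = x powr - (a / 2)" by (simp add: powr_add[symmetric])
        then show ?thesis unfolding pe k_def using xc by (simp add: mult.assoc mult.left_commute)
      qed
    qed
  qed
  moreover have "(LINT x|M01. (m' x - a * (m x * x powr - 1)) * (v x)\<^sup>2) = (LINT x|M01. k' x * (p x * p x))"
  proof (rule integral_cong_AE)
    show "(\<lambda>x. k' x * (p x * p x)) \<in> borel_measurable M01" using i1 by (rule borel_measurable_integrable)
    show "(\<lambda>x. (m' x - a * (m x * x powr - 1)) * (v x)\<^sup>2) \<in> borel_measurable M01"
      using mD(4,5) powr_borel_measurable_M01[of "- 1"] L2_01_measurable[OF v] by measurable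
    have "AE x in M01. x \<in> {0<..<1}" by (rule AE_I2) simp
    with pv show "AE x in M01. (m' x - a * (m x * x powr - 1)) * (v x)\<^sup>2 = k' x * (p x * p x)"
    proof eventually_elim
      case (elim x)
      show ?case
      proof (cases "x \<le> c")
        case True then show ?thesis by (simp add: k'_def mD(7,8))
      next
        case False
        then have xc: "x \<in> {c<..<1}" using elim by auto
        then have pe: "p x = x powr (a / 2) * v x" using elim by blast
        have x0: "x > 0" using xc mD(1) by auto
        have pp: "p x * p x = x powr a * (v x)\<^sup>2"
          unfolding pe using wt_power2[OF x0, of a v] by (simp add: wt_def power2_eq_square)
        have 1: "x powr - a * x powr a = 1" "x powr - (a + 1) * x powr a = x powr - 1"
          using x0 by (simp_all add: powr_add[symmetric])
        have "k' x * (p x * p x) = (m' x * (x powr - a * x powr a) - a * (m x * (x powr - (a + 1) * x powr a))) * (v x)\<^sup>2"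
          unfolding pp k'_def using xc by (simp add: algebra_simps)
        then show ?thesis unfolding 1 by simp
      qed
    qed
  qed
  ultimately show ?thesis using main by simp
qed

section \<open>Estimate in the boundary layer\<close>

text \<open>The inner ramp rises on [c, 2c] with slope 1/c, independent of
  \<open>\<epsilon>\<close>. The condition \<open>2 * c \<le> 1 - \<epsilon>\<close> imposed below
  keeps it from overlapping the outer ramp.\<close>

definition ramp_mult :: "real \<Rightarrow> real \<Rightarrow> real \<Rightarrow> real" where
  "ramp_mult c \<epsilon> x = (max 0 (x - c) - max 0 (x - 2 * c)) / c - max 0 (x - (1 - \<epsilon>)) / \<epsilon>"

definition ramp_mult' :: "real \<Rightarrow> real \<Rightarrow> real \<Rightarrow> real" where
  "ramp_mult' c \<epsilon> x = ((if c < x then 1 else 0) - (if 2 * c < x then 1 else 0)) / c - (if 1 - \<epsilon> < x then 1 else 0) / \<epsilon>"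

lemma multiplier_ramp:
  assumes c: "0 < c" and e: "0 < \<epsilon>" "2 * c \<le> 1 - \<epsilon>"
  shows "multiplier c (ramp_mult c \<epsilon>) (ramp_mult' c \<epsilon>)"
  unfolding multiplier_def
proof (intro conjI)
  show "0 < c" "c < 1" using c e by auto
  have eq: "ramp_mult c \<epsilon> = (\<lambda>x. (1 / c) * (max 0 (x - c) - max 0 (x - 2 * c)) - (1 / \<epsilon>) * max 0 (x - (1 - \<epsilon>)))"
    by (auto simp: ramp_mult_def)
  show "abs_cont_on 0 1 (ramp_mult c \<epsilon>)"
    unfolding eq by (intro abs_cont_on_diff abs_cont_on_mult abs_cont_on_const abs_cont_on_ramp)
  show "ramp_mult c \<epsilon> \<in> borel_measurable borel" "ramp_mult' c \<epsilon> \<in> borel_measurable borel"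
    unfolding ramp_mult_def[abs_def] ramp_mult'_def[abs_def] by measurable
  show "\<forall>x\<le>c. ramp_mult c \<epsilon> x = 0 \<and> ramp_mult' c \<epsilon> x = 0"
    using c e by (auto simp: ramp_mult_def ramp_mult'_def)
  show "ramp_mult c \<epsilon> 1 = 0"
    using c e by (simp add: ramp_mult_def)
  show "\<forall>x\<in>{0<..<1}. 0 \<le> ramp_mult c \<epsilon> x \<and> ramp_mult c \<epsilon> x \<le> 1"
  proof
    fix x :: real assume x: "x \<in> {0<..<1}"
    consider "x \<le> c" | "c < x" "x \<le> 2 * c" | "2 * c < x" "x \<le> 1 - \<epsilon>" | "1 - \<epsilon> < x" by linarith
    then show "0 \<le> ramp_mult c \<epsilon> x \<and> ramp_mult c \<epsilon> x \<le> 1"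
    proof cases
      case 1 then show ?thesis using c e by (simp add: ramp_mult_def)
    next
      case 2
      then have "ramp_mult c \<epsilon> x = (x - c) / c" using c e by (simp add: ramp_mult_def)
      moreover have "0 \<le> (x - c) / c" "(x - c) / c \<le> 1" using 2 c by (auto simp: divide_simps)
      ultimately show ?thesis by simp
    next
      case 3
      then have "ramp_mult c \<epsilon> x = 1" using c e by (simp add: ramp_mult_def)
      then show ?thesis by simp
    next
      case 4
      then have "ramp_mult c \<epsilon> x = 1 - (x - (1 - \<epsilon>)) / \<epsilon>" using c e by (simp add: ramp_mult_def)
      moreover have "0 \<le> (x - (1 - \<epsilon>)) / \<epsilon>" "(x - (1 - \<epsilon>)) / \<epsilon> \<le> 1" using 4 x e by (auto simp: divide_simps)
      ultimately show ?thesis by simp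
    qed
  qed
  have "\<bar>ramp_mult' c \<epsilon> x\<bar> \<le> 1 / c + 1 / \<epsilon>" for x
    using c e by (auto simp: ramp_mult'_def)
  then show "bounded (range (ramp_mult' c \<epsilon>))" by (auto simp: bounded_iff)
  have "AE x in lebesgue. x \<notin> {c, 2 * c, 1 - \<epsilon>}" by (rule AE_lebesgue_notin_finite) simp
  then show "AE x in lebesgue. x \<in> {0<..<1} \<longrightarrow> (ramp_mult c \<epsilon> has_real_derivative ramp_mult' c \<epsilon> x) (at x)"
  proof eventually_elim
    case (elim x)
    then show ?case
      unfolding ramp_mult_def[abs_def] ramp_mult'_def
      by (intro impI DERIV_diff DERIV_cdivide ramp_deriv) auto
  qed
qed

text \<open>Only an upper bound of the slope is required, because the slope enters the multiplier
  identities with a negative factor; the steep outer ramp then appears as the gain 1/eps on the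
  layer.\<close>

lemma ramp_mult'_le:
  assumes "0 < c" "0 < \<epsilon>"
  shows "ramp_mult' c \<epsilon> x \<le> 1 / c - (1 / \<epsilon>) * indicator {1 - \<epsilon><..} x"
  using assms by (auto simp: ramp_mult'_def split: split_indicator)

lemma LINT_square_mono:
  assumes v: "L2_01 v" and p: "p \<in> borel_measurable M01" "\<And>x. x \<in> {0<..<1} \<Longrightarrow> \<bar>p x\<bar> \<le> B"
    and q: "q \<in> borel_measurable M01" "\<And>x. x \<in> {0<..<1} \<Longrightarrow> \<bar>q x\<bar> \<le> B'"
    and le: "\<And>x. x \<in> {0<..<1} \<Longrightarrow> p x \<le> q x"
  shows "(LINT x|M01. p x * (v x)\<^sup>2) \<le> (LINT x|M01. q x * (v x)\<^sup>2)"
  using L2_01_mult_integrable3[OF v v p] L2_01_mult_integrable3[OF v v q] le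
  by (intro integral_mono) (auto simp: power2_eq_square intro!: mult_right_mono)

section \<open>Layer estimate for the averages and passage to the solution\<close>

context weak_sol
begin

definition layer :: "real \<Rightarrow> (real \<Rightarrow> real) \<Rightarrow> real \<Rightarrow> real" where
  "layer \<epsilon> v x = indicator {1 - \<epsilon><..} x * v x"

lemma ind_layer: "indicator {1 - \<epsilon><..} \<in> borel_measurable M01" "\<bar>indicator {1 - \<epsilon><..} x\<bar> \<le> (1::real)"
  by (auto intro: borel_imp_M01 simp: indicator_def)

lemma L2_layer: "L2_01 v \<Longrightarrow> L2_01 (layer \<epsilon> v)"
  unfolding layer_def[abs_def] by (rule L2_01_bounded_mult[OF _ ind_layer])

text \<open>The left side is the time derivative of the pairing of \<open>D\<close> with b times
  \<open>V\<close>, that is, of the integral of m v_t v_x. The two multiplier identities turn it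
  into -1/2 times integrals of the slope of m against v_t^2 and x^a v_x^2, plus the source and the
  weight term.\<close>

lemma multiplier_quot:
  assumes c: "0 < c" and e: "0 < \<epsilon>" "2 * c \<le> 1 - \<epsilon>" and h: "h > 0" and t: "0 \<le> t" "t + h < T"
  defines "b \<equiv> \<lambda>x. ramp_mult c \<epsilon> x * x powr - (a / 2)"
  shows "ip (D' h t) (\<lambda>x. b x * V h t x) + ip (D h t) (\<lambda>x. b x * V' h t x)
    \<ge> (1 / (2 * \<epsilon>)) * ip (layer \<epsilon> (V h t)) (layer \<epsilon> (V h t)) - (1 / (2 * c)) * (Mt\<^sup>2 + Mx\<^sup>2)
      - c powr - (a / 2) * Mx * ((F (t + h) - F t) / h)"
proof -
  define m where "m = ramp_mult c \<epsilon>"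
  define m' where "m' = ramp_mult' c \<epsilon>"
  have mult: "multiplier c m m'" unfolding m_def m'_def by (rule multiplier_ramp[OF c e])
  note mD = multiplier_D[OF mult]
  obtain B where B: "\<And>x. \<bar>m' x\<bar> \<le> B" using mD(12) by blast
  have tT: "t \<in> {0..T - h}" "t + h \<le> T" using t by auto
  have LD: "L2_01 (D h t)" "L2_01 (D' h t)" using L2_deriv_D[OF h] tT by (auto simp: L2_deriv_def)
  have LV: "L2_01 (V h t)" "L2_01 (V' h t)" using L2_deriv_V[OF h] tT by (auto simp: L2_deriv_def)
  have LG: "L2_01 (G h t)" by (rule L2_G[OF h t(1) tT(2)])
  have bm: "b \<in> borel_measurable M01" "\<And>x. x \<in> {0<..<1} \<Longrightarrow> \<bar>b x\<bar> \<le> c powr - (a / 2)"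
    using mD(4) powr_borel_measurable_M01[of "- (a / 2)"] multiplier_powr_bound[OF mult, of _ "a / 2"] a
    unfolding b_def m_def by auto
  have LbV: "L2_01 (\<lambda>x. b x * V h t x)" by (rule L2_01_bounded_mult[OF LV(1) bm])
  \<comment> \<open>With the source moved to the left, the averaged equation has the form expected
    by \<open>multiplier_flux\<close>.\<close>
  have weak': "ip (\<lambda>x. D' h t x - G h t x) \<psi> + ip (V h t) (wt a \<psi>') = 0" if "H1a_pair a \<psi> \<psi>'" for \<psi> \<psi>'
    using weak_identity_quot[OF that h t] ip_diff_left[OF LD(2) LG H1a_pair_L2[OF that]] by simp
  have 1: "ip (\<lambda>x. D' h t x - G h t x) (\<lambda>x. b x * V h t x)
      = - (1 / 2) * (LINT x|M01. (m' x - a * (m x * x powr - 1)) * (V h t x)\<^sup>2)"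
    unfolding b_def m_def[symmetric] by (rule multiplier_flux[OF mult L2_01_diff[OF LD(2) LG] LV(1) a(1) weak'])
  have 2: "ip (D h t) (\<lambda>x. b x * V' h t x) = - (1 / 2) * (LINT x|M01. m' x * (D h t x)\<^sup>2)"
    using multiplier_H1a[OF mult H1a_D[OF h t(1) tT(2)] a(1)] by (simp add: b_def m_def wt_Dx)
  \<comment> \<open>In the velocity part the contribution of the layer has a favourable sign and is
    dropped; only the inner slope 1/c remains.\<close>
  have 3: "(LINT x|M01. m' x * (D h t x)\<^sup>2) \<le> (1 / c) * Mt\<^sup>2"
  proof -
    have "(LINT x|M01. m' x * (D h t x)\<^sup>2) \<le> (LINT x|M01. (1 / c) * (D h t x)\<^sup>2)"
    proof (rule LINT_square_mono[OF LD(1) mD(5) B, where B'="\<bar>1/c\<bar>"])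
      fix x
      have "m' x \<le> 1 / c - (1 / \<epsilon>) * indicator {1 - \<epsilon><..} x" unfolding m'_def by (rule ramp_mult'_le[OF c e(1)])
      also have "\<dots> \<le> 1 / c" using e by (auto split: split_indicator)
      finally show "m' x \<le> 1 / c" .
    qed auto
    also have "\<dots> = (1 / c) * L2_01_norm2 (D h t)" by (simp add: L2_01_norm2_def)
    also have "\<dots> \<le> (1 / c) * Mt\<^sup>2"
      using nrm_D_le[OF h t(1) tT(2)] c power_mono[OF _ nrm_nonneg, of "D h t" Mt 2]
      by (intro mult_left_mono) (auto simp: nrm_power2)
    finally show ?thesis .
  qed
  have 4: "(LINT x|M01. (m' x - a * (m x * x powr - 1)) * (V h t x)\<^sup>2)
      \<le> (1 / c) * Mx\<^sup>2 - (1 / \<epsilon>) * ip (layer \<epsilon> (V h t)) (layer \<epsilon> (V h t))"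
  proof -
    have "(LINT x|M01. (m' x - a * (m x * x powr - 1)) * (V h t x)\<^sup>2)
      \<le> (LINT x|M01. (1 / c - (1 / \<epsilon>) * indicator {1 - \<epsilon><..} x) * (V h t x)\<^sup>2)"
    proof (rule LINT_square_mono[OF LV(1), where B="B + a * c powr - 1" and B'="1 / c + 1 / \<epsilon>"])
      show "(\<lambda>x. m' x - a * (m x * x powr - 1)) \<in> borel_measurable M01"
        using mD(4,5) powr_borel_measurable_M01[of "- 1"] by measurable
      show "(\<lambda>x. 1 / c - (1 / \<epsilon>) * indicator {1 - \<epsilon><..} x) \<in> borel_measurable M01"
        using ind_layer(1) by measurable
      fix x :: real assume x: "x \<in> {0<..<1}"
      have "\<bar>a * (m x * x powr - 1)\<bar> \<le> a * c powr - 1"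
        unfolding abs_mult[of a] abs_of_pos[OF a(1)]
        using multiplier_powr_bound[OF mult x, of 1] a by (intro mult_left_mono) auto
      then show "\<bar>m' x - a * (m x * x powr - 1)\<bar> \<le> B + a * c powr - 1" using B[of x] by linarith
      show "\<bar>1 / c - (1 / \<epsilon>) * indicator {1 - \<epsilon><..} x\<bar> \<le> 1 / c + 1 / \<epsilon>"
        using c e by (auto split: split_indicator simp: abs_le_iff add_nonneg_nonneg)
      \<comment> \<open>Since m is nonnegative, the derivative of the weight only lowers the
        coefficient and is discarded in the upper bound.\<close>
      have "0 \<le> a * (m x * x powr - 1)" using mD(9)[OF x] a by (intro mult_nonneg_nonneg) auto
      then show "m' x - a * (m x * x powr - 1) \<le> 1 / c - (1 / \<epsilon>) * indicator {1 - \<epsilon><..} x"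
        using ramp_mult'_le[OF c e(1), of x] unfolding m'_def by linarith
    qed
    also have "\<dots> = (LINT x|M01. (1 / c) * (V h t x)\<^sup>2 - (1 / \<epsilon>) * (layer \<epsilon> (V h t) x)\<^sup>2)"
      by (intro Bochner_Integration.integral_cong) (auto simp: layer_def algebra_simps split: split_indicator)
    also have "\<dots> = (1 / c) * L2_01_norm2 (V h t) - (1 / \<epsilon>) * L2_01_norm2 (layer \<epsilon> (V h t))"
    proof -
      have "integrable M01 (\<lambda>x. (1 / c) * (V h t x)\<^sup>2)" "integrable M01 (\<lambda>x. (1 / \<epsilon>) * (layer \<epsilon> (V h t) x)\<^sup>2)"
        using LV(1) L2_layer[OF LV(1), of \<epsilon>] by (auto simp: L2_01_def)
      from Bochner_Integration.integral_diff[OF this] show ?thesis by (simp add: L2_01_norm2_def)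
    qed
    also have "\<dots> \<le> (1 / c) * Mx\<^sup>2 - (1 / \<epsilon>) * L2_01_norm2 (layer \<epsilon> (V h t))"
      using nrm_V_le[OF h t(1) tT(2)] c power_mono[OF _ nrm_nonneg, of "V h t" Mx 2]
      by (intro diff_right_mono mult_left_mono) (auto simp: nrm_power2)
    finally show ?thesis by (simp add: norm2_eq_ip)
  qed
  have 5: "\<bar>ip (G h t) (\<lambda>x. b x * V h t x)\<bar> \<le> c powr - (a / 2) * Mx * ((F (t + h) - F t) / h)"
  proof -
    have "nrm (\<lambda>x. b x * V h t x) \<le> c powr - (a / 2) * nrm (V h t)"
      by (rule nrm_bounded_mult_le[OF LV(1) bm]) auto
    also have "\<dots> \<le> c powr - (a / 2) * Mx"
      using nrm_V_le[OF h t(1) tT(2)] by (intro mult_left_mono) auto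
    finally have "(F (t + h) - F t) / h * nrm (\<lambda>x. b x * V h t x) \<le> (F (t + h) - F t) / h * (c powr - (a / 2) * Mx)"
      using F_mono[of t "t + h"] h tT by (intro mult_left_mono) auto
    then show ?thesis using ip_G_le[OF LbV h t(1) tT(2)] by (simp add: mult.commute)
  qed
  have "ip (D' h t) (\<lambda>x. b x * V h t x) = ip (\<lambda>x. D' h t x - G h t x) (\<lambda>x. b x * V h t x) + ip (G h t) (\<lambda>x. b x * V h t x)"
    by (simp add: ip_diff_left[OF LD(2) LG LbV])
  note 0 = this
  have arith: "- (1 / 2) * r2 - (1 / 2) * r1 - k \<le> x + y"
    if "x = p + g" "p = - (1 / 2) * A" "y = - (1 / 2) * B" "B \<le> r1" "A \<le> r2" "\<bar>g\<bar> \<le> k" for x y p g A B r1 r2 k :: real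
    using that by linarith
  from arith[OF 0 1 2 3 4 5]
  show ?thesis by (simp add: algebra_simps)
qed

text \<open>\<open>multiplier_quot\<close> is integrated in time by monotonicity of
  \<open>\<Phi>\<close>. What remains are the values of the pairing \<open>J\<close> at the two end
  times, bounded by Cauchy-Schwarz with \<open>Mt\<close> and \<open>Mx\<close>.\<close>

lemma layer_quot_bound:
  assumes c: "0 < c" and e: "0 < \<epsilon>" "2 * c \<le> 1 - \<epsilon>" and h: "h > 0" and \<tau>: "0 \<le> \<tau>" "\<tau> + h < T"
  shows "(1 / (2 * \<epsilon>)) * integral {0..\<tau>} (\<lambda>t. ip (layer \<epsilon> (V h t)) (layer \<epsilon> (V h t)))
    \<le> 2 * (c powr - (a / 2) * (Mt * Mx)) + (1 / (2 * c)) * (Mt\<^sup>2 + Mx\<^sup>2) * T + c powr - (a / 2) * Mx * F T"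
proof -
  define m where "m = ramp_mult c \<epsilon>"
  define m' where "m' = ramp_mult' c \<epsilon>"
  have mult: "multiplier c m m'" unfolding m_def m'_def by (rule multiplier_ramp[OF c e])
  define b where "b = (\<lambda>x. ramp_mult c \<epsilon> x * x powr - (a / 2))"
  define Cb where "Cb = c powr - (a / 2)"
  have bm: "b \<in> borel_measurable M01" "\<And>x. x \<in> {0<..<1} \<Longrightarrow> \<bar>b x\<bar> \<le> Cb"
    using multiplier_D(4)[OF mult] powr_borel_measurable_M01[of "- (a / 2)"] multiplier_powr_bound[OF mult, of _ "a / 2"] a
    unfolding b_def m_def Cb_def by auto
  have Cb: "Cb \<ge> 0" by (simp add: Cb_def)
  have LD: "L2_deriv {0..T - h} (D h) (D' h)" and LV: "L2_deriv {0..T - h} (V h) (V' h)"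
    using L2_deriv_D L2_deriv_V h by auto
  have LbV: "L2_deriv {0..T - h} (\<lambda>t x. b x * V h t x) (\<lambda>t x. b x * V' h t x)"
    by (rule L2_deriv_bounded_mult[OF LV bm])
  define J where "J t = ip (D h t) (\<lambda>x. b x * V h t x)" for t
  have Jb: "\<bar>J t\<bar> \<le> Cb * (Mt * Mx)" if "0 \<le> t" "t + h \<le> T" for t
  proof -
    have L: "L2_01 (D h t)" "L2_01 (V h t)" using LD LV that by (auto simp: L2_deriv_def)
    have "\<bar>J t\<bar> \<le> nrm (D h t) * nrm (\<lambda>x. b x * V h t x)"
      unfolding J_def by (rule ip_Cauchy_Schwarz[OF L(1) L2_01_bounded_mult[OF L(2) bm]])
    also have "\<dots> \<le> Mt * (Cb * Mx)"
    proof (rule mult_mono[OF nrm_D_le[OF h that] _ Mt_nonneg nrm_nonneg])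
      have "nrm (\<lambda>x. b x * V h t x) \<le> Cb * nrm (V h t)" by (rule nrm_bounded_mult_le[OF L(2) bm Cb])
      also have "\<dots> \<le> Cb * Mx" using nrm_V_le[OF h that] Cb by (rule mult_left_mono)
      finally show "nrm (\<lambda>x. b x * V h t x) \<le> Cb * Mx" .
    qed
    finally show ?thesis by (simp add: ac_simps)
  qed
  define q where "q t = ip (layer \<epsilon> (V h t)) (layer \<epsilon> (V h t))" for t
  have qc: "continuous_on {0..T - h} q"
  proof -
    have "L2_cont {0..T - h} (\<lambda>t. layer \<epsilon> (V h t))"
      using L2_cont_bounded_mult[OF L2_deriv_imp_cont[OF LV] ind_layer] by (simp add: layer_def[abs_def])
    then show ?thesis unfolding q_def[abs_def] by (intro L2_cont_ip)
  qed
  define K where "K = (1 / (2 * c)) * (Mt\<^sup>2 + Mx\<^sup>2)"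
  have K: "K \<ge> 0" using c by (simp add: K_def)
  \<comment> \<open>\<open>J\<close> minus the integrated layer term, corrected by a linear term for
    the quadratic errors and by \<open>F_avg\<close> for the source, so that its derivative is
    nonnegative by \<open>multiplier_quot\<close>.\<close>
  define \<Phi> where "\<Phi> t = J t - (1 / (2 * \<epsilon>)) * integral {0..t} q + K * t + Cb * Mx * F_avg h t" for t
  have "\<Phi> 0 \<le> \<Phi> \<tau>"
  proof (rule DERIV_nonneg_imp_increasing_open[OF \<tau>(1)])
    fix t assume t: "0 < t" "t < \<tau>"
    then have tt: "t \<in> {0..T - h}" "0 \<le> t" "t + h < T" using \<tau> by auto
    have w: "at t within {0..T - h} = at t" using t \<tau> by (intro at_within_Icc_at) auto
    have "((\<lambda>t. integral {0..t} q) has_vector_derivative q t) (at t within {0..T - h})"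
      by (intro integral_has_vector_derivative qc tt)
    then have "((\<lambda>t. integral {0..t} q) has_real_derivative q t) (at t)"
      unfolding w by (simp add: has_real_derivative_iff_has_vector_derivative)
    moreover have "(J has_real_derivative (ip (D' h t) (\<lambda>x. b x * V h t x) + ip (D h t) (\<lambda>x. b x * V' h t x))) (at t)"
      using L2_deriv_ip[OF LD LbV tt(1)] unfolding w J_def[abs_def] .
    ultimately have "(\<Phi> has_real_derivative (ip (D' h t) (\<lambda>x. b x * V h t x) + ip (D h t) (\<lambda>x. b x * V' h t x))
       - (1 / (2 * \<epsilon>)) * q t + K * 1 + Cb * Mx * ((F (t + h) - F t) / h)) (at t)"
      unfolding \<Phi>_def[abs_def] using F_avg_deriv[OF h t(1) tt(3)]
      by (intro DERIV_diff DERIV_add DERIV_cmult DERIV_ident)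
    moreover have "(ip (D' h t) (\<lambda>x. b x * V h t x) + ip (D h t) (\<lambda>x. b x * V' h t x))
       - (1 / (2 * \<epsilon>)) * q t + K * 1 + Cb * Mx * ((F (t + h) - F t) / h) \<ge> 0"
      using multiplier_quot[OF c e h tt(2,3)] unfolding q_def K_def Cb_def b_def by linarith
    ultimately show "\<exists>y. (\<Phi> has_real_derivative y) (at t) \<and> 0 \<le> y" by blast
  next
    have sub: "{0..\<tau>} \<subseteq> {0..T - h}" using \<tau> by auto
    have "continuous_on {0..\<tau>} J"
      unfolding J_def[abs_def]
      by (intro L2_cont_ip L2_cont_subset[OF L2_deriv_imp_cont[OF LD] sub] L2_cont_subset[OF L2_deriv_imp_cont[OF LbV] sub])
    moreover have "continuous_on {0..\<tau>} (\<lambda>t. integral {0..t} q)"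
      by (intro indefinite_integral_continuous_1 integrable_continuous_real continuous_on_subset[OF qc sub])
    moreover have "continuous_on {0..\<tau>} (F_avg h)" using \<tau> by (intro F_avg_continuous[OF h]) auto
    ultimately show "continuous_on {0..\<tau>} \<Phi>"
      unfolding \<Phi>_def[abs_def] by (intro continuous_intros)
  qed
  moreover have "K * \<tau> \<le> K * T" using K \<tau> h by (intro mult_left_mono) auto
  moreover have "Cb * Mx * F_avg h \<tau> \<le> Cb * Mx * F T" "0 \<le> Cb * Mx * F_avg h 0"
    using F_avg_bounds[OF h, of \<tau>] F_avg_bounds[OF h, of 0] \<tau> Mx_nonneg Cb by (auto intro: mult_left_mono)
  moreover have "\<bar>J 0\<bar> \<le> Cb * (Mt * Mx)" "\<bar>J \<tau>\<bar> \<le> Cb * (Mt * Mx)" using Jb \<tau> by auto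
  moreover have "\<Phi> 0 = J 0 + Cb * Mx * F_avg h 0" by (simp add: \<Phi>_def)
  ultimately show ?thesis
    unfolding \<Phi>_def[of \<tau>] K_def[symmetric] Cb_def[symmetric] q_def[abs_def, symmetric] by linarith
qed

text \<open>The right side of \<open>layer_quot_bound\<close> does not contain \<open>h\<close>. On
  the left the averages converge at every time to the layer energy of \<open>W\<close>, with
  \<open>Mx\<^sup>2\<close> as a majorant.\<close>

lemma layer_bound_time:
  assumes c: "0 < c" and e: "0 < \<epsilon>" "2 * c \<le> 1 - \<epsilon>" and \<tau>: "0 \<le> \<tau>" "\<tau> < T"
  shows "(1 / (2 * \<epsilon>)) * integral {0..\<tau>} (\<lambda>t. ip (layer \<epsilon> (W t)) (layer \<epsilon> (W t)))
    \<le> 2 * (c powr - (a / 2) * (Mt * Mx)) + (1 / (2 * c)) * (Mt\<^sup>2 + Mx\<^sup>2) * T + c powr - (a / 2) * Mx * F T"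
proof -
  obtain h where h1: "\<And>n. h n > 0" "\<And>n. h n < T - \<tau>" and h0: "h \<longlonglongrightarrow> 0"
    using vanishing_sequence[of "T - \<tau>"] \<tau> by auto
  have h: "h n > 0" "\<tau> + h n < T" for n using h1[of n] by auto
  have LL: "L2_deriv {0..T} (\<lambda>t x. indicator {1 - \<epsilon><..} x * tprim W t x) (\<lambda>t x. indicator {1 - \<epsilon><..} x * W t x)"
    by (rule L2_deriv_bounded_mult[OF L2_deriv_W ind_layer])
  have lay: "layer \<epsilon> (V h t) = (\<lambda>x. (indicator {1 - \<epsilon><..} x * tprim W (t + h) x - indicator {1 - \<epsilon><..} x * tprim W t x) / h)" for h t
    by (auto simp: layer_def V_def right_diff_distrib)
  have layW: "layer \<epsilon> (W t) = (\<lambda>x. indicator {1 - \<epsilon><..} x * W t x)" for t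
    by (auto simp: layer_def)
  have lim: "(\<lambda>n. integral {0..\<tau>} (\<lambda>t. ip (layer \<epsilon> (V (h n) t)) (layer \<epsilon> (V (h n) t)))) \<longlonglongrightarrow> integral {0..\<tau>} (\<lambda>t. ip (layer \<epsilon> (W t)) (layer \<epsilon> (W t)))"
  proof (rule dominated_convergence(2)[where h="\<lambda>t. Mx\<^sup>2"])
    fix n
    have "L2_cont {0..T - h n} (\<lambda>t. layer \<epsilon> (V (h n) t))"
      using L2_cont_bounded_mult[OF L2_deriv_imp_cont[OF L2_deriv_V[OF h(1)]] ind_layer] by (simp add: layer_def[abs_def])
    then have "continuous_on {0..T - h n} (\<lambda>t. ip (layer \<epsilon> (V (h n) t)) (layer \<epsilon> (V (h n) t)))" by (intro L2_cont_ip)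
    then have "continuous_on {0..\<tau>} (\<lambda>t. ip (layer \<epsilon> (V (h n) t)) (layer \<epsilon> (V (h n) t)))"
      by (rule continuous_on_subset) (use h(2)[of n] in auto)
    then show "(\<lambda>t. ip (layer \<epsilon> (V (h n) t)) (layer \<epsilon> (V (h n) t))) integrable_on {0..\<tau>}" by (rule integrable_continuous_real)
    show "(\<lambda>t. Mx\<^sup>2) integrable_on {0..\<tau>}" by (rule integrable_const_ivl)
    fix t assume t: "t \<in> {0..\<tau>}"
    then have t': "0 \<le> t" "t + h n \<le> T" using h(2)[of n] by auto
    have LV: "L2_01 (V (h n) t)" using L2_deriv_V[OF h(1)[of n]] t' by (auto simp: L2_deriv_def)
    have "nrm (layer \<epsilon> (V (h n) t)) \<le> 1 * nrm (V (h n) t)"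
      unfolding layer_def[abs_def] by (rule nrm_bounded_mult_le[OF LV ind_layer]) simp
    also have "\<dots> \<le> Mx" using nrm_V_le[OF h(1) t'] by simp
    finally have "(nrm (layer \<epsilon> (V (h n) t)))\<^sup>2 \<le> Mx\<^sup>2" by (intro power_mono) auto
    then show "norm (ip (layer \<epsilon> (V (h n) t)) (layer \<epsilon> (V (h n) t))) \<le> Mx\<^sup>2"
      by (simp add: nrm_power2 norm2_eq_ip[symmetric])
  next
    fix t assume t: "t \<in> {0..\<tau>}"
    have "t + h n \<le> T" for n using t h(2)[of n] by auto
    then show "(\<lambda>n. ip (layer \<epsilon> (V (h n) t)) (layer \<epsilon> (V (h n) t))) \<longlonglongrightarrow> ip (layer \<epsilon> (W t)) (layer \<epsilon> (W t))"
      unfolding lay layW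
      using t by (intro L2_deriv_quot_ip_tendsto[OF LL LL _ h(1) _ h0]) auto
  qed
  from tendsto_mult[OF tendsto_const this]
  show ?thesis
    by (rule LIMSEQ_le_const2) (use layer_quot_bound[OF c e h(1) \<tau>(1) h(2)] in auto)
qed

lemma layer_continuous: "continuous_on {0..T} (\<lambda>t. ip (layer \<epsilon> (W t)) (layer \<epsilon> (W t)))"
proof -
  have "L2_cont {0..T} (\<lambda>t. layer \<epsilon> (W t))"
    using L2_cont_bounded_mult[OF L2_cont_W ind_layer] by (simp add: layer_def[abs_def])
  then show ?thesis by (intro L2_cont_ip)
qed

text \<open>The factors 4, 6 and 1 of \<open>energy_bound\<close> combine as 10 = 4 + 6 for the
  quadratic terms and 7 = 6 + 1 for the source term. Doubling the estimate gives 27 = 2 * 10 +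
  7.\<close>

lemma layer_bound:
  assumes c: "0 < c" and e: "0 < \<epsilon>" "2 * c \<le> 1 - \<epsilon>"
  shows "(1 / \<epsilon>) * integral {0..T} (\<lambda>t. ip (layer \<epsilon> (W t)) (layer \<epsilon> (W t)))
    \<le> (27 * c powr - (a / 2) + 10 * T / c) * datanorm"
proof -
  define Cb where "Cb = c powr - (a / 2)"
  have Cb: "Cb \<ge> 0" by (simp add: Cb_def)
  define R where "R = 2 * (Cb * (Mt * Mx)) + (1 / (2 * c)) * (Mt\<^sup>2 + Mx\<^sup>2) * T + Cb * Mx * F T"
  have cont: "continuous_on (closure {0..<T}) (\<lambda>\<tau>. (1 / (2 * \<epsilon>)) * integral {0..\<tau>} (\<lambda>t. ip (layer \<epsilon> (W t)) (layer \<epsilon> (W t))))"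
    using T e by (auto intro!: continuous_intros indefinite_integral_continuous_1 integrable_continuous_real layer_continuous)
  have "T \<in> closure {0..<T}" using T by simp
  from continuous_le_on_closure[OF cont this]
  have le: "(1 / (2 * \<epsilon>)) * integral {0..T} (\<lambda>t. ip (layer \<epsilon> (W t)) (layer \<epsilon> (W t))) \<le> R"
    using layer_bound_time[OF c e] unfolding R_def Cb_def by auto
  have "2 * (Mt * Mx) \<le> Mt\<^sup>2 + Mx\<^sup>2" using sum_squares_bound[of Mt Mx] by simp
  then have 1: "Cb * (2 * (Mt * Mx)) \<le> Cb * (10 * datanorm)"
    using energy_bound Cb by (intro mult_left_mono) auto
  have "2 * (Mx * F T) \<le> Mx\<^sup>2 + (F T)\<^sup>2" using sum_squares_bound[of Mx "F T"] by simp
  then have 2: "Cb * (2 * (Mx * F T)) \<le> Cb * (7 * datanorm)"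
    using energy_bound Cb by (intro mult_left_mono) auto
  have 3: "(T / c) * (Mt\<^sup>2 + Mx\<^sup>2) \<le> (T / c) * (10 * datanorm)"
    using energy_bound c T by (intro mult_left_mono) auto
  have "2 * R = 2 * (Cb * (2 * (Mt * Mx))) + (T / c) * (Mt\<^sup>2 + Mx\<^sup>2) + Cb * (2 * (Mx * F T))"
    unfolding R_def using c by (simp add: field_simps)
  also have "\<dots> \<le> 2 * (Cb * (10 * datanorm)) + (T / c) * (10 * datanorm) + Cb * (7 * datanorm)"
    using 1 2 3 by linarith
  also have "\<dots> = (27 * Cb + 10 * T / c) * datanorm" by (simp add: algebra_simps)
  finally have "2 * R \<le> (27 * Cb + 10 * T / c) * datanorm" .
  moreover have "(1 / \<epsilon>) * integral {0..T} (\<lambda>t. ip (layer \<epsilon> (W t)) (layer \<epsilon> (W t)))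
      = 2 * ((1 / (2 * \<epsilon>)) * integral {0..T} (\<lambda>t. ip (layer \<epsilon> (W t)) (layer \<epsilon> (W t))))" by simp
  ultimately show ?thesis using le unfolding Cb_def by linarith
qed

text \<open>Links the extended nonnegative integral over the strip, whose finiteness is thereby
  established, with the integral over time of a continuous function. The condition
  \<open>\<epsilon> < 1\<close> keeps the strip inside the cylinder, where x is positive and the
  split weight recombines.\<close>

lemma nn_integral_layer:
  assumes e: "0 < \<epsilon>" "\<epsilon> < 1"
  shows "(\<integral>\<^sup>+ p \<in> {0<..<T} \<times> {1 - \<epsilon><..<1}. ennreal ((snd p) powr a * (ux (fst p) (snd p))\<^sup>2) \<partial>lebesgue)
    = ennreal (integral {0..T} (\<lambda>t. ip (layer \<epsilon> (W t)) (layer \<epsilon> (W t))))"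
proof -
  define g where "g t x = layer \<epsilon> (W t) x * layer \<epsilon> (W t) x" for t x
  have lay_m: "(\<lambda>(t, x). layer \<epsilon> (W t) x) \<in> borel_measurable (MQ T)"
  proof -
    have "(\<lambda>(t, x). 1 * (indicator {1 - \<epsilon><..} x :: real)) \<in> borel_measurable (MQ T)"
      by (rule measurable_Qset_times[OF ind_layer(1)]) simp
    then show ?thesis
      using measurable_W unfolding layer_def case_prod_beta' by (simp add: borel_measurable_times)
  qed
  have gm: "(\<lambda>(t, x). g t x) \<in> borel_measurable (MQ T)"
    using lay_m unfolding g_def case_prod_beta' by (intro borel_measurable_times)
  have k: "integrable (I0 T) (\<lambda>t. Mx\<^sup>2)"
    using T by (intro finite_measure.integrable_const finite_measureI) (simp add: emeasure_restrict_space)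
  have bnd: "AE t in I0 T. integrable M01 (g t) \<and> (LINT x|M01. \<bar>g t x\<bar>) \<le> Mx\<^sup>2"
  proof (rule AE_I2)
    fix t assume "t \<in> space (I0 T)"
    then have t: "t \<in> {0..T}" by simp
    have LW: "L2_01 (W t)" using L2_cont_W t by (simp add: L2_cont_def)
    have L: "L2_01 (layer \<epsilon> (W t))" by (rule L2_layer[OF LW])
    have "nrm (layer \<epsilon> (W t)) \<le> 1 * nrm (W t)"
      unfolding layer_def[abs_def] by (rule nrm_bounded_mult_le[OF LW ind_layer]) simp
    also have "\<dots> \<le> Mx" using le_Mx[OF t] by simp
    finally have "(nrm (layer \<epsilon> (W t)))\<^sup>2 \<le> Mx\<^sup>2" by (intro power_mono) auto
    moreover have "(LINT x|M01. \<bar>g t x\<bar>) = (nrm (layer \<epsilon> (W t)))\<^sup>2"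
      by (simp add: nrm_power2 norm2_eq_ip ip_def g_def)
    ultimately show "integrable M01 (g t) \<and> (LINT x|M01. \<bar>g t x\<bar>) \<le> Mx\<^sup>2"
      using L2_01_mult_integrable[OF L L] by (simp add: g_def[abs_def])
  qed
  note Fub = Fubini_Qset[OF gm k bnd]
  have ipg: "(LINT x|M01. g t x) = ip (layer \<epsilon> (W t)) (layer \<epsilon> (W t))" for t by (simp add: g_def ip_def)
  have Qs: "Qset T \<inter> space lebesgue \<in> sets lebesgue" by auto
  have "(\<integral>\<^sup>+ p \<in> {0<..<T} \<times> {1 - \<epsilon><..<1}. ennreal ((snd p) powr a * (ux (fst p) (snd p))\<^sup>2) \<partial>lebesgue)
    = (\<integral>\<^sup>+ p. ennreal (g (fst p) (snd p)) * indicator (Qset T) p \<partial>lebesgue)"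
  proof (rule nn_integral_cong)
    fix p :: "real \<times> real"
    obtain t x where p: "p = (t, x)" by (cases p)
    show "ennreal ((snd p) powr a * (ux (fst p) (snd p))\<^sup>2) * indicator ({0<..<T} \<times> {1 - \<epsilon><..<1}) p
      = ennreal (g (fst p) (snd p)) * indicator (Qset T) p"
    proof (cases "p \<in> Qset T \<and> 1 - \<epsilon> < x")
      case True
      then have "x > 0" "p \<in> {0<..<T} \<times> {1 - \<epsilon><..<1}" by (auto simp: p Qset_def)
      moreover have "g t x = (W t x)\<^sup>2" using True by (simp add: g_def layer_def power2_eq_square)
      ultimately show ?thesis using True wt_power2[of x a "ux t"] by (simp add: p W_def)
    next
      case False
      then show ?thesis using e by (auto simp: p Qset_def g_def layer_def split: split_indicator)
    qed
  qed
  also have "\<dots> = (\<integral>\<^sup>+ p. ennreal (g (fst p) (snd p)) \<partial>MQ T)"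
    by (rule nn_integral_restrict_space[OF Qs, symmetric])
  also have "\<dots> = ennreal (LINT p|MQ T. g (fst p) (snd p))"
    using Fub(1) by (intro nn_integral_eq_integral) (auto simp: case_prod_beta' g_def)
  also have "(LINT p|MQ T. g (fst p) (snd p)) = (LINT t|I0 T. ip (layer \<epsilon> (W t)) (layer \<epsilon> (W t)))"
    using Fub(3) by (simp only: ipg)
  also have "\<dots> = integral {0..T} (\<lambda>t. ip (layer \<epsilon> (W t)) (layer \<epsilon> (W t)))"
    using Fub(2) unfolding ipg by (rule LINT_eq_integral)
  finally show ?thesis .
qed

end

theorem mainTheorem2:
  fixes T \<alpha> \<epsilon>0 :: real
  assumes "T > 0" and "0 < \<alpha>" and "\<alpha> < 2" and "0 < \<epsilon>0" and "\<epsilon>0 < 1"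
  shows "\<exists>C>0. \<forall>u0 w0 u1 f u ut ux.
           H1a_pair \<alpha> u0 w0 \<longrightarrow> L2_01 u1 \<longrightarrow> L1L2 T f \<longrightarrow>
           weak_solution \<alpha> T f u0 u1 u ut ux \<longrightarrow>
           (\<forall>\<epsilon>\<in>{0<..\<epsilon>0}.
              ennreal (1 / \<epsilon>) *
                (\<integral>\<^sup>+ p \<in> {0<..<T} \<times> {1 - \<epsilon><..<1}.
                   ennreal ((snd p) powr \<alpha> * (ux (fst p) (snd p))\<^sup>2) \<partial>lebesgue)
              \<le> ennreal (C * ((L1L2_norm T f)\<^sup>2 + H1a_norm2 \<alpha> u0 w0 + L2_01_norm2 u1)))"
proof -
  \<comment> \<open>The largest \<open>c\<close> with \<open>2 * c \<le> 1 - \<epsilon>\<close> for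
    all admissible \<open>\<epsilon>\<close>. It depends on \<open>\<epsilon>0\<close> alone, so
    \<open>C\<close> depends only on \<open>\<epsilon>0\<close>, \<open>\<alpha>\<close> and
    \<open>T\<close>.\<close>
  define c where "c = (1 - \<epsilon>0) / 2"
  have c: "0 < c" using assms by (simp add: c_def)
  define C where "C = 27 * c powr - (\<alpha> / 2) + 10 * T / c"
  have "C > 0" using c assms by (auto simp: C_def intro!: add_nonneg_pos)
  moreover have "ennreal (1 / \<epsilon>) * (\<integral>\<^sup>+ p \<in> {0<..<T} \<times> {1 - \<epsilon><..<1}.
                   ennreal ((snd p) powr \<alpha> * (ux (fst p) (snd p))\<^sup>2) \<partial>lebesgue)
              \<le> ennreal (C * ((L1L2_norm T f)\<^sup>2 + H1a_norm2 \<alpha> u0 w0 + L2_01_norm2 u1))"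
    if H: "H1a_pair \<alpha> u0 w0" "L2_01 u1" "L1L2 T f" "weak_solution \<alpha> T f u0 u1 u ut ux" and e: "\<epsilon> \<in> {0<..\<epsilon>0}"
    for u0 w0 u1 f u ut ux \<epsilon>
  proof -
    interpret weak_sol \<alpha> T f u0 w0 u1 u ut ux
      by unfold_locales (use assms H in auto)
    have e': "0 < \<epsilon>" "2 * c \<le> 1 - \<epsilon>" "\<epsilon> < 1" using e assms by (auto simp: c_def)
    have "ennreal (1 / \<epsilon>) * ennreal (integral {0..T} (\<lambda>t. ip (layer \<epsilon> (W t)) (layer \<epsilon> (W t))))
      = ennreal ((1 / \<epsilon>) * integral {0..T} (\<lambda>t. ip (layer \<epsilon> (W t)) (layer \<epsilon> (W t))))"
      using e' by (intro ennreal_mult'[symmetric]) auto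
    also have "\<dots> \<le> ennreal (C * datanorm)"
      using layer_bound[OF c e'(1,2)] unfolding C_def by (rule ennreal_leI)
    finally show ?thesis unfolding nn_integral_layer[OF e'(1,3)] datanorm_def .
  qed
  ultimately show ?thesis by blast
qed

end
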